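(* Let $M$ be a saturated geometric structure, $A\subseteq M$ a small subset, and let $(X,F,g)$ be a generically defined group in $M$ over $A$. Then there is a group $(G,\cdot)$ definable in $M$ over a (small) set $B\supseteq A$, with $\dim(G)=\dim(X)$, and a partial $B$-definable function $h:X\to G$ such that: (1) $h$ establishes a bijection between the generic over $B$ points of $X$ and the generic over $B$ points of $G$; in particular $h(X)$ is large in $G$ (i.e. $\dim(G\setminus h(X))<\dim(G)$). (2) For $a,b\in X$ generic and independent over $B$, $h(F(a,b))=h(a)\cdot h(b)$. (3) For $a\in X$ generic over $B$, $h(g(a))=h(a)^{-1}$. Moreover, when $A$ is an elementary substructure of $M$ we can choose $B=A$.
   Context: A geometric structure is a one-sorted structure $M$ in a language $L$ such that algebraic closure yields a pregeometry in every model of $Th(M)$, and $Th(M)$ eliminates $\exists^\infty$: for each formula $\phi(x,\bar y)$ ($x$ a single variable) there is $N_\phi$ such that for any $\bar b$ in $M$, $\phi(x,\bar b)(M)$ is infinite if it has cardinality $>N_\phi$. For a finite tuple $a$ and small set $A$, $\dim(a/A)$ is the cardinality of a maximal subtuple of $a$ algebraically independent over $A$. Tuples $a,b$ are independent over $A$ if $\dim(a,b/A)=\dim(a/A)+\dim(b/A)$ (and similarly for several tuples). For $X\subseteq M^n$ definable over $A$, $\dim(X)=\max\{\dim(a/A):a\in X\}$, and $a\in X$ is generic in $X$ over $A$ if $\dim(a/A)=\dim(X)$. A generically defined group in $M$ over $A$ is an $A$-definable set $X\subseteq M^n$ (some $n$) with $A$-definable partial operations $F:X\times X\to X$ and $g:X\to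 X$ such that: (1) for any $a,b\in X$ generic and independent over $A$, $c=F(a,b)$ is defined, and each of $a,b,c$ is in the definable closure of $A$ and the other two; (2) for $a,b,c\in X$ generic and independent over $A$, $F(F(a,b),c)=F(a,F(b,c))$; (3) for $a\in X$ generic over $A$, $g(a)$ is defined and generic in $X$ over $A$; moreover, if $b$ is also generic in $X$ over $A$ and independent of $a$ over $A$, then $b=F(g(a),F(a,b))$ and $a=F(F(a,b),g(b))$. *)

theory Defs
  imports "HOL-Algebra.Group" "HOL-Library.Equipollence"
begin

section \<open>First-order logic\<close>

record ('f, 'r) lang =
  fun_syms :: "'f set"
  rel_syms :: "'r set"
  fun_arity :: "'f \<Rightarrow> nat"
  rel_arity :: "'r \<Rightarrow> nat"

datatype 'f trm = Var nat | App 'f "'f trm list"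

datatype ('f, 'r) fm =
    Eq "'f trm" "'f trm"
  | Rel 'r "'f trm list"
  | Neg "('f, 'r) fm"
  | Conj "('f, 'r) fm" "('f, 'r) fm"
  | Ex nat "('f, 'r) fm"

fun wf_trm :: "('f, 'r) lang \<Rightarrow> 'f trm \<Rightarrow> bool" where
  "wf_trm L (Var i) \<longleftrightarrow> True"
| "wf_trm L (App f ts) \<longleftrightarrow>
     f \<in> fun_syms L \<and> length ts = fun_arity L f \<and> (\<forall>t\<in>set ts. wf_trm L t)"

primrec wf_fm :: "('f, 'r) lang \<Rightarrow> ('f, 'r) fm \<Rightarrow> bool" where
  "wf_fm L (Eq s t) \<longleftrightarrow> wf_trm L s \<and> wf_trm L t"
| "wf_fm L (Rel r ts) \<longleftrightarrow>
     r \<in> rel_syms L \<and> length ts = rel_arity L r \<and> (\<forall>t\<in>set ts. wf_trm L t)"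
| "wf_fm L (Neg \<phi>) \<longleftrightarrow> wf_fm L \<phi>"
| "wf_fm L (Conj \<phi> \<psi>) \<longleftrightarrow> wf_fm L \<phi> \<and> wf_fm L \<psi>"
| "wf_fm L (Ex i \<phi>) \<longleftrightarrow> wf_fm L \<phi>"

fun vars_trm :: "'f trm \<Rightarrow> nat set" where
  "vars_trm (Var i) = {i}"
| "vars_trm (App f ts) = (\<Union>t\<in>set ts. vars_trm t)"

primrec fv :: "('f, 'r) fm \<Rightarrow> nat set" where
  "fv (Eq s t) = vars_trm s \<union> vars_trm t"
| "fv (Rel r ts) = (\<Union>t\<in>set ts. vars_trm t)"
| "fv (Neg \<phi>) = fv \<phi>"
| "fv (Conj \<phi> \<psi>) = fv \<phi> \<union> fv \<psi>"
| "fv (Ex i \<phi>) = fv \<phi> - {i}"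

definition formulas :: "('f, 'r) lang \<Rightarrow> nat \<Rightarrow> ('f, 'r) fm set" where
  "formulas L n = {\<phi>. wf_fm L \<phi> \<and> fv \<phi> \<subseteq> {..<n}}"

record ('f, 'r, 'u) struct =
  univ :: "'u set"
  fun_int :: "'f \<Rightarrow> 'u list \<Rightarrow> 'u"
  rel_int :: "'r \<Rightarrow> 'u list \<Rightarrow> bool"

definition is_structure :: "('f, 'r) lang \<Rightarrow> ('f, 'r, 'u) struct \<Rightarrow> bool" where
  "is_structure L M \<longleftrightarrow> univ M \<noteq> {} \<and>
     (\<forall>f\<in>fun_syms L. \<forall>as. length as = fun_arity L f \<and> set as \<subseteq> univ M \<longrightarrow> fun_int M f as \<in> univ M)"

primrec eval :: "('f, 'r, 'u) struct \<Rightarrow> (nat \<Rightarrow> 'u) \<Rightarrow> 'f trm \<Rightarrow> 'u" where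
  "eval M e (Var i) = e i"
| "eval M e (App f ts) = fun_int M f (map (eval M e) ts)"

primrec sat :: "('f, 'r, 'u) struct \<Rightarrow> (nat \<Rightarrow> 'u) \<Rightarrow> ('f, 'r) fm \<Rightarrow> bool" where
  "sat M e (Eq s t) \<longleftrightarrow> eval M e s = eval M e t"
| "sat M e (Rel r ts) \<longleftrightarrow> rel_int M r (map (eval M e) ts)"
| "sat M e (Neg \<phi>) \<longleftrightarrow> \<not> sat M e \<phi>"
| "sat M e (Conj \<phi> \<psi>) \<longleftrightarrow> sat M e \<phi> \<and> sat M e \<psi>"
| "sat M e (Ex i \<phi>) \<longleftrightarrow> (\<exists>a\<in>univ M. sat M (e(i := a)) \<phi>)"

text \<open>Sentences are evaluated at the assignment \<open>(!) []\<close>; its values are irrelevant.\<close>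

definition Th :: "('f, 'r) lang \<Rightarrow> ('f, 'r, 'u) struct \<Rightarrow> ('f, 'r) fm set" where
  "Th L M = {\<phi> \<in> formulas L 0. sat M ((!) []) \<phi>}"

definition is_model :: "('f, 'r) lang \<Rightarrow> ('f, 'r, 'u) struct \<Rightarrow> ('f, 'r) fm set \<Rightarrow> bool" where
  "is_model L M T \<longleftrightarrow> is_structure L M \<and> (\<forall>\<phi>\<in>T. sat M ((!) []) \<phi>)"

definition elementary_substructure ::
    "('f, 'r) lang \<Rightarrow> ('f, 'r, 'u) struct \<Rightarrow> 'u set \<Rightarrow> bool" where
  "elementary_substructure L M A \<longleftrightarrow> A \<subseteq> univ M \<and> is_structure L (M\<lparr>univ := A\<rparr>) \<and>
     (\<forall>\<phi> e. wf_fm L \<phi> \<and> range e \<subseteq> A \<longrightarrow> (sat (M\<lparr>univ := A\<rparr>) e \<phi> \<longleftrightarrow> sat M e \<phi>))"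

section \<open>Definable sets and saturation\<close>

definition tuples :: "('f, 'r, 'u) struct \<Rightarrow> nat \<Rightarrow> 'u list set" where
  "tuples M n = {as. length as = n \<and> set as \<subseteq> univ M}"

text \<open>The solution set of \<open>\<phi>(x, bs)\<close>: the variables \<open>0, \<dots>, n - 1\<close> stand for the tuple \<open>x\<close>, and
  the variables \<open>n, n + 1, \<dots>\<close> are assigned the parameters \<open>bs\<close>.\<close>

definition solutions ::
    "('f, 'r, 'u) struct \<Rightarrow> nat \<Rightarrow> ('f, 'r) fm \<Rightarrow> 'u list \<Rightarrow> 'u list set" where
  "solutions M n \<phi> bs = {as \<in> tuples M n. sat M ((!) (as @ bs)) \<phi>}"

definition definable ::
    "('f, 'r) lang \<Rightarrow> ('f, 'r, 'u) struct \<Rightarrow> 'u set \<Rightarrow> nat \<Rightarrow> 'u list set \<Rightarrow> bool" where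
  "definable L M A n X \<longleftrightarrow>
     (\<exists>\<phi> bs. set bs \<subseteq> A \<and> \<phi> \<in> formulas L (n + length bs) \<and> X = solutions M n \<phi> bs)"

definition small :: "('f, 'r, 'u) struct \<Rightarrow> 'u set \<Rightarrow> bool" where
  "small M A \<longleftrightarrow> A \<subseteq> univ M \<and> A \<prec> univ M"

text \<open>A (partial) \<open>n\<close>-type over \<open>A\<close> is a set \<open>p\<close> of pairs \<open>(\<phi>, bs)\<close>, read as the formulas
  \<open>\<phi>(x, bs)\<close> with parameters \<open>bs\<close> in \<open>A\<close>, which is finitely satisfiable in \<open>M\<close>.\<close>

definition saturated :: "('f, 'r) lang \<Rightarrow> ('f, 'r, 'u) struct \<Rightarrow> bool" where
  "saturated L M \<longleftrightarrow>
     (\<forall>A n p. small M A \<and>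
        (\<forall>(\<phi>, bs)\<in>p. set bs \<subseteq> A \<and> \<phi> \<in> formulas L (n + length bs)) \<and>
        (\<forall>q\<subseteq>p. finite q \<longrightarrow> (\<exists>as\<in>tuples M n. \<forall>(\<phi>, bs)\<in>q. as \<in> solutions M n \<phi> bs))
        \<longrightarrow> (\<exists>as\<in>tuples M n. \<forall>(\<phi>, bs)\<in>p. as \<in> solutions M n \<phi> bs))"

section \<open>Geometric structures\<close>

definition acl :: "('f, 'r) lang \<Rightarrow> ('f, 'r, 'u) struct \<Rightarrow> 'u set \<Rightarrow> 'u set" where
  "acl L M A = {a. \<exists>X. definable L M A 1 X \<and> finite X \<and> [a] \<in> X}"

definition dcl :: "('f, 'r) lang \<Rightarrow> ('f, 'r, 'u) struct \<Rightarrow> 'u set \<Rightarrow> 'u set" where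
  "dcl L M A = {a. definable L M A 1 {[a]}}"

definition pregeometry :: "'u set \<Rightarrow> ('u set \<Rightarrow> 'u set) \<Rightarrow> bool" where
  "pregeometry S cl \<longleftrightarrow>
     (\<forall>A\<subseteq>S. A \<subseteq> cl A \<and> cl A \<subseteq> S \<and> cl (cl A) = cl A) \<and>
     (\<forall>A B. A \<subseteq> B \<and> B \<subseteq> S \<longrightarrow> cl A \<subseteq> cl B) \<and>
     (\<forall>A\<subseteq>S. \<forall>a\<in>cl A. \<exists>A0\<subseteq>A. finite A0 \<and> a \<in> cl A0) \<and>
     (\<forall>A\<subseteq>S. \<forall>a\<in>S. \<forall>b\<in>S. a \<in> cl (insert b A) - cl A \<longrightarrow> b \<in> cl (insert a A))"

definition eliminates_exists_infinity ::
    "('f, 'r) lang \<Rightarrow> ('f, 'r, 'u) struct \<Rightarrow> bool" where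
  "eliminates_exists_infinity L M \<longleftrightarrow>
     (\<forall>k. \<forall>\<phi>\<in>formulas L (1 + k). \<exists>N. \<forall>bs\<in>tuples M k.
        infinite (solutions M 1 \<phi> bs) \<or> card (solutions M 1 \<phi> bs) \<le> N)"

text \<open>The models of \<open>Th(M)\<close> are taken with universe contained in the type \<open>'u + 'f + 'r + nat\<close>,
  since a quantifier inside a formula cannot range over all types. This type is infinite and at
  least as large as the language and as \<open>M\<close>; by Loewenheim-Skolem, failure of the pregeometry
  axioms in any model of \<open>Th(M)\<close> is witnessed in one of this kind.\<close>

definition geometric :: "('f, 'r) lang \<Rightarrow> ('f, 'r, 'u) struct \<Rightarrow> bool" where
  "geometric L M \<longleftrightarrow> is_structure L M \<and>
     (\<forall>N :: ('f, 'r, 'u + 'f + 'r + nat) struct.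
        is_model L N (Th L M) \<longrightarrow> pregeometry (univ N) (acl L N)) \<and>
     eliminates_exists_infinity L M"

section \<open>Dimension, independence, genericity\<close>

definition alg_independent ::
    "('f, 'r) lang \<Rightarrow> ('f, 'r, 'u) struct \<Rightarrow> 'u set \<Rightarrow> 'u set \<Rightarrow> bool" where
  "alg_independent L M A S \<longleftrightarrow> (\<forall>s\<in>S. s \<notin> acl L M (A \<union> (S - {s})))"

text \<open>\<open>dim(a/A)\<close>. An independent subtuple has no repeated entries, so it is identified with its set
  of entries.\<close>

definition tuple_dim ::
    "('f, 'r) lang \<Rightarrow> ('f, 'r, 'u) struct \<Rightarrow> 'u set \<Rightarrow> 'u list \<Rightarrow> nat" where
  "tuple_dim L M A a = Max (card ` {S. S \<subseteq> set a \<and> alg_independent L M A S})"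

definition independent_tuples ::
    "('f, 'r) lang \<Rightarrow> ('f, 'r, 'u) struct \<Rightarrow> 'u set \<Rightarrow> 'u list list \<Rightarrow> bool" where
  "independent_tuples L M A as \<longleftrightarrow>
     tuple_dim L M A (concat as) = sum_list (map (tuple_dim L M A) as)"

text \<open>\<open>dim(X)\<close> for \<open>X\<close> definable over \<open>A\<close>; the empty set gets dimension \<open>-1\<close> (for \<open>-\<infinity>\<close>). In a
  saturated geometric structure the value does not depend on the choice of the small set \<open>A\<close>.\<close>

definition set_dim ::
    "('f, 'r) lang \<Rightarrow> ('f, 'r, 'u) struct \<Rightarrow> 'u set \<Rightarrow> 'u list set \<Rightarrow> int" where
  "set_dim L M A X = (if X = {} then -1 else Max ((\<lambda>a. int (tuple_dim L M A a)) ` X))"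

definition generics ::
    "('f, 'r) lang \<Rightarrow> ('f, 'r, 'u) struct \<Rightarrow> 'u set \<Rightarrow> 'u list set \<Rightarrow> 'u list set" where
  "generics L M A X = {a \<in> X. int (tuple_dim L M A a) = set_dim L M A X}"

section \<open>Definable partial maps and groups\<close>

definition definable_pfun1 ::
    "('f, 'r) lang \<Rightarrow> ('f, 'r, 'u) struct \<Rightarrow> 'u set \<Rightarrow> nat \<Rightarrow> 'u list set \<Rightarrow> nat \<Rightarrow> 'u list set \<Rightarrow>
     ('u list \<Rightarrow> 'u list option) \<Rightarrow> bool" where
  "definable_pfun1 L M A n X m Y h \<longleftrightarrow>
     (\<forall>a b. h a = Some b \<longrightarrow> a \<in> X \<and> b \<in> Y) \<and>
     definable L M A (n + m) {a @ b | a b. h a = Some b}"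

definition definable_pfun2 ::
    "('f, 'r) lang \<Rightarrow> ('f, 'r, 'u) struct \<Rightarrow> 'u set \<Rightarrow> nat \<Rightarrow> 'u list set \<Rightarrow>
     ('u list \<Rightarrow> 'u list \<Rightarrow> 'u list option) \<Rightarrow> bool" where
  "definable_pfun2 L M A n X F \<longleftrightarrow>
     (\<forall>a b c. F a b = Some c \<longrightarrow> a \<in> X \<and> b \<in> X \<and> c \<in> X) \<and>
     definable L M A (n + n + n) {a @ b @ c | a b c. F a b = Some c}"

text \<open>An asserted equation between partial expressions includes that both sides are defined.
  \<open>X \<noteq> {}\<close> is implicit in the notion, as \<open>dim(X)\<close> is a maximum over \<open>X\<close>.\<close>

definition gen_defined_group ::
    "('f, 'r) lang \<Rightarrow> ('f, 'r, 'u) struct \<Rightarrow> 'u set \<Rightarrow> nat \<Rightarrow> 'u list set \<Rightarrow>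
     ('u list \<Rightarrow> 'u list \<Rightarrow> 'u list option) \<Rightarrow> ('u list \<Rightarrow> 'u list option) \<Rightarrow> bool" where
  "gen_defined_group L M A n X F g \<longleftrightarrow>
     X \<noteq> {} \<and> definable L M A n X \<and> definable_pfun2 L M A n X F \<and> definable_pfun1 L M A n X n X g \<and>
     (\<forall>a\<in>generics L M A X. \<forall>b\<in>generics L M A X. independent_tuples L M A [a, b] \<longrightarrow>
        (\<exists>c. F a b = Some c \<and>
           set a \<subseteq> dcl L M (A \<union> set b \<union> set c) \<and>
           set b \<subseteq> dcl L M (A \<union> set a \<union> set c) \<and>
           set c \<subseteq> dcl L M (A \<union> set a \<union> set b))) \<and>
     (\<forall>a\<in>generics L M A X. \<forall>b\<in>generics L M A X. \<forall>c\<in>generics L M A X.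
        independent_tuples L M A [a, b, c] \<longrightarrow>
        (\<exists>ab bc d. F a b = Some ab \<and> F b c = Some bc \<and> F ab c = Some d \<and> F a bc = Some d)) \<and>
     (\<forall>a\<in>generics L M A X.
        (\<exists>a'\<in>generics L M A X. g a = Some a' \<and>
          (\<forall>b\<in>generics L M A X. independent_tuples L M A [a, b] \<longrightarrow>
             (\<exists>c b'. F a b = Some c \<and> g b = Some b' \<and> F a' c = Some b \<and> F c b' = Some a))))"

definition definable_group ::
    "('f, 'r) lang \<Rightarrow> ('f, 'r, 'u) struct \<Rightarrow> 'u set \<Rightarrow> nat \<Rightarrow> 'u list monoid \<Rightarrow> bool" where
  "definable_group L M B m G \<longleftrightarrow> group G \<and> definable L M B m (carrier G) \<and>
     definable L M B (m + m + m)
       {a @ b @ (a \<otimes>\<^bsub>G\<^esub> b) | a b. a \<in> carrier G \<and> b \<in> carrier G}"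

end

theory Submission
  imports Defs
begin

text \<open>Left translations by elements of \<open>X\<close> are invertible germs of partial maps at the generic points
  of \<open>X\<close>. They generate a group in which every element is a product of two translations. Elimination
  of \<open>\<exists>\<^sup>\<infinity>\<close> makes dimension definable, hence so is equality of germs, and there is a definable
  \<open>X0 \<subseteq> X\<close> containing the generics whose elements still act faithfully. By counting
  dimensions, any germ \<open>a b\<close> with \<open>a, b \<in> X0\<close> lies in one of the translates \<open>X0 e\<close>, where \<open>e\<close> runs
  through \<open>2 n + 1\<close> independent generics: one of the \<open>e\<close> is generic over \<open>a, b\<close>, and then
  \<open>a b e\<^sup>-\<^sup>1\<close> is generic. So the group is a finite union of definable pieces. The covering property is a
  first-order condition on the finitely many \<open>e\<close>, which can therefore be taken in \<open>A\<close> when \<open>A\<close> is an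
  elementary substructure.\<close>

text \<open>The generic points of \<open>X\<close> form an intersection of definable sets, in
  general not a definable set, so a definable group cannot be built on them directly. This is why
  they are thickened to \<open>X0\<close>, which asks for the group identities at generic arguments
  only. The axioms say nothing about dependent arguments, so products are reduced to independent
  ones by inserting a generic point and its inverse; this costs one extra letter and is why two
  translations are needed. The phrase "at generic points" is expressed by a dimension that mentions
  no parameter set, so a proof may enlarge the base at will without changing the condition. Group
  elements are coded by pairs \<open>y, e\<close> with \<open>e\<close> one of the finitely many
  covering points, and \<open>B\<close> is \<open>A\<close> together with the coordinates of these
  points.\<close>

section \<open>Renaming of variables in terms and formulas\<close>

primrec ren_trm :: "(nat \<Rightarrow> nat) \<Rightarrow> 'f trm \<Rightarrow> 'f trm" where
  "ren_trm f (Var i) = Var (f i)"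
| "ren_trm f (App s ts) = App s (map (ren_trm f) ts)"

lemma wf_ren_trm [simp]: "wf_trm L (ren_trm f t) \<longleftrightarrow> wf_trm L t"
  by (induction t) auto

lemma vars_ren_trm [simp]: "vars_trm (ren_trm f t) = f ` vars_trm t"
  by (induction t) auto

lemma eval_ren_trm [simp]: "eval M e (ren_trm f t) = eval M (e \<circ> f) t"
  by (induction t) (auto cong: map_cong)

lemma eval_cong: "(\<And>i. i \<in> vars_trm t \<Longrightarrow> e i = e' i) \<Longrightarrow> eval M e t = eval M e' t"
proof (induction t)
  case (App f ts)
  have "map (eval M e) ts = map (eval M e') ts"
    by (rule map_cong) (use App in auto)
  then show ?case by (simp del: map_eq_conv)
qed auto

lemma sat_cong: "(\<And>i. i \<in> fv \<phi> \<Longrightarrow> e i = e' i) \<Longrightarrow> sat M e \<phi> \<longleftrightarrow> sat M e' \<phi>"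
proof (induction \<phi> arbitrary: e e')
  case (Eq s t)
  then show ?case using eval_cong[of s e e' M] eval_cong[of t e e' M] by auto
next
  case (Rel r ts)
  have "map (eval M e) ts = map (eval M e') ts"
    by (rule map_cong) (use Rel in \<open>auto intro!: eval_cong\<close>)
  then show ?case by (simp del: map_eq_conv)
next
  case (Neg \<phi>)
  have "sat M e \<phi> \<longleftrightarrow> sat M e' \<phi>"
    by (rule Neg.IH) (use Neg.prems in simp)
  then show ?case by simp
next
  case (Conj \<phi> \<psi>)
  have "sat M e \<phi> \<longleftrightarrow> sat M e' \<phi>" "sat M e \<psi> \<longleftrightarrow> sat M e' \<psi>"
    by (rule Conj.IH; use Conj.prems in simp)+
  then show ?case by simp
next
  case (Ex i \<phi>)
  have "sat M (e(i := a)) \<phi> \<longleftrightarrow> sat M (e'(i := a)) \<phi>" for a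
    by (rule Ex.IH) (use Ex.prems in auto)
  then show ?case by simp
qed

lemma finite_vars_trm [simp]: "finite (vars_trm t)"
  by (induction t) auto

lemma finite_fv [simp]: "finite (fv \<phi>)"
  by (induction \<phi>) auto

text \<open>Stated as an existence result because bound variables may have to be renamed to avoid
  capture; \<open>f\<close> need not be injective.\<close>

lemma rename_fm:
  fixes \<phi> :: "('f, 'r) fm"
  shows "\<exists>\<phi>'. (wf_fm L \<phi> \<longrightarrow> wf_fm L \<phi>') \<and> fv \<phi>' \<subseteq> f ` fv \<phi> \<and>
    (\<forall>M e. sat (M :: ('f, 'r, 'u) struct) e \<phi>' \<longleftrightarrow> sat M (e \<circ> f) \<phi>)"
proof (induction \<phi> arbitrary: f)
  case (Eq s t)
  show ?case by (rule exI[of _ "Eq (ren_trm f s) (ren_trm f t)"]) (auto simp del: o_apply)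
next
  case (Rel r ts)
  show ?case by (rule exI[of _ "Rel r (map (ren_trm f) ts)"]) (auto simp: comp_def)
next
  case (Neg \<phi>)
  then obtain \<phi>' where "wf_fm L \<phi> \<longrightarrow> wf_fm L \<phi>'" "fv \<phi>' \<subseteq> f ` fv \<phi>"
    "\<forall>(M :: ('f, 'r, 'u) struct) e. sat M e \<phi>' \<longleftrightarrow> sat M (e \<circ> f) \<phi>" by blast
  then show ?case by (intro exI[of _ "Neg \<phi>'"]) (auto simp del: o_apply)
next
  case (Conj \<phi> \<psi>)
  obtain \<phi>' where "wf_fm L \<phi> \<longrightarrow> wf_fm L \<phi>'" "fv \<phi>' \<subseteq> f ` fv \<phi>"
    "\<forall>(M :: ('f, 'r, 'u) struct) e. sat M e \<phi>' \<longleftrightarrow> sat M (e \<circ> f) \<phi>" using Conj.IH(1) by blast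
  moreover obtain \<psi>' where "wf_fm L \<psi> \<longrightarrow> wf_fm L \<psi>'" "fv \<psi>' \<subseteq> f ` fv \<psi>"
    "\<forall>(M :: ('f, 'r, 'u) struct) e. sat M e \<psi>' \<longleftrightarrow> sat M (e \<circ> f) \<psi>" using Conj.IH(2) by blast
  ultimately show ?case by (intro exI[of _ "Conj \<phi>' \<psi>'"]) (auto simp del: o_apply)
next
  case (Ex i \<phi>)
  \<comment> \<open>The new bound variable avoids the images of the free variables, so
    \<open>f(i := j)\<close> renames bound and free occurrences without capture.\<close>
  obtain j where j: "j \<notin> f ` fv \<phi>"
    using ex_new_if_finite[of "f ` fv \<phi>"] by auto
  obtain \<phi>' where \<phi>': "wf_fm L \<phi> \<longrightarrow> wf_fm L \<phi>'" "fv \<phi>' \<subseteq> f(i := j) ` fv \<phi>"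
    "\<And>(M :: ('f, 'r, 'u) struct) e. sat M e \<phi>' \<longleftrightarrow> sat M (e \<circ> f(i := j)) \<phi>"
    using Ex.IH[of "f(i := j)"] by blast
  have "sat M ((e(j := a)) \<circ> f(i := j)) \<phi> \<longleftrightarrow> sat M ((e \<circ> f)(i := a)) \<phi>"
    for M :: "('f, 'r, 'u) struct" and e a
    by (rule sat_cong) (use j in auto)
  then show ?case using \<phi>' by (intro exI[of _ "Ex j \<phi>'"]) (auto simp del: o_apply)
qed

section \<open>Definable predicates on assignments\<close>

text \<open>A variable of a formula is instantiated by a parameter (\<open>Inl\<close>) or by an entry of the
  assignment (\<open>Inr\<close>).\<close>

definition inst :: "(nat \<Rightarrow> 'u + nat) \<Rightarrow> (nat \<Rightarrow> 'u) \<Rightarrow> nat \<Rightarrow> 'u" where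
  "inst \<sigma> e i = case_sum id e (\<sigma> i)"

definition over :: "'u set \<Rightarrow> (nat \<Rightarrow> 'u + nat) \<Rightarrow> bool" where
  "over A \<sigma> \<longleftrightarrow> (\<forall>i a. \<sigma> i = Inl a \<longrightarrow> a \<in> A)"

lemma over_map_sum: "over A \<sigma> \<Longrightarrow> over A (\<lambda>i. map_sum id f (\<sigma> i))"
  by (fastforce simp: over_def map_sum_def split: sum.splits)

text \<open>Quantified entries are pushed in front of the assignment and the outer entries shift up,
  as with de Bruijn indices.\<close>

definition app :: "'a list \<Rightarrow> (nat \<Rightarrow> 'a) \<Rightarrow> nat \<Rightarrow> 'a" where
  "app w e i = (if i < length w then w ! i else e (i - length w))"

lemma app_Nil [simp]: "app [] e = e"
  by (auto simp: app_def)

lemma app_snoc: "app (w @ [x]) e = app w (case_nat x e)"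
proof
  fix i
  consider "i < length w" | "i = length w" | k where "i = length w + Suc k"
    by (metis add_Suc_right less_imp_Suc_add linorder_neqE_nat)
  then show "app (w @ [x]) e i = app w (case_nat x e) i"
    by cases (auto simp: app_def nth_append)
qed

lemma range_case_nat: "range (case_nat x e) \<subseteq> U \<longleftrightarrow> x \<in> U \<and> range e \<subseteq> U"
  by (auto split: nat.splits simp: image_subset_iff)

lemma range_app: "set w \<subseteq> U \<Longrightarrow> range e \<subseteq> U \<Longrightarrow> range (app w e) \<subseteq> U"
  by (auto simp: app_def)

lemma map_app: "map (app w e) [0..<length w] = w"
  by (rule nth_equalityI) (auto simp: app_def)

lemma inst_range: "over A \<sigma> \<Longrightarrow> A \<subseteq> U \<Longrightarrow> range e \<subseteq> U \<Longrightarrow> range (inst \<sigma> e) \<subseteq> U"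
  by (fastforce simp: inst_def over_def image_subset_iff split: sum.splits)

locale fo_structure =
  fixes L :: "('f, 'r) lang" and M :: "('f, 'r, 'u) struct"
begin

abbreviation "U \<equiv> univ M"

text \<open>Predicates on infinite assignments have no arity, and parameters are plugged in by
  \<open>\<sigma>\<close> rather than appended to the tuple, so closure under connectives and
  quantifiers needs no variable counting. \<open>definable_iff\<close> returns to definable sets of
  tuples.\<close>

definition dpred :: "'u set \<Rightarrow> ((nat \<Rightarrow> 'u) \<Rightarrow> bool) \<Rightarrow> bool" where
  "dpred A P \<longleftrightarrow> (\<exists>\<phi> \<sigma>. wf_fm L \<phi> \<and> over A \<sigma> \<and> (\<forall>e. range e \<subseteq> U \<longrightarrow> P e = sat M (inst \<sigma> e) \<phi>))"

lemma dpredI: "wf_fm L \<phi> \<Longrightarrow> over A \<sigma> \<Longrightarrow> (\<And>e. range e \<subseteq> U \<Longrightarrow> P e = sat M (inst \<sigma> e) \<phi>) \<Longrightarrow> dpred A P"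
  unfolding dpred_def by blast

lemma dpredE:
  assumes "dpred A P"
  obtains \<phi> \<sigma> where "wf_fm L \<phi>" "over A \<sigma>" "\<And>e. range e \<subseteq> U \<Longrightarrow> P e = sat M (inst \<sigma> e) \<phi>"
  using assms unfolding dpred_def by blast

lemma dpred_cong: "(\<And>e. range e \<subseteq> U \<Longrightarrow> P e = Q e) \<Longrightarrow> dpred A P \<longleftrightarrow> dpred A Q"
  unfolding dpred_def by (metis (full_types))

lemma dpred_mono: "dpred A P \<Longrightarrow> A \<subseteq> B \<Longrightarrow> dpred B P"
  unfolding dpred_def over_def by (metis subsetD)

lemma dpred_neg: "dpred A P \<Longrightarrow> dpred A (\<lambda>e. \<not> P e)"
  by (elim dpredE, rule dpredI[of "Neg _"]) auto

text \<open>Even variables carry the first formula and odd ones the second, so the two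
  instantiations merge into one.\<close>

lemma dpred_conj:
  assumes "dpred A P" "dpred A Q"
  shows "dpred A (\<lambda>e. P e \<and> Q e)"
proof -
  obtain \<phi> \<sigma> where 1: "wf_fm L \<phi>" "over A \<sigma>" "\<And>e. range e \<subseteq> U \<Longrightarrow> P e = sat M (inst \<sigma> e) \<phi>"
    using assms(1) by (rule dpredE) blast
  obtain \<psi> \<tau> where 2: "wf_fm L \<psi>" "over A \<tau>" "\<And>e. range e \<subseteq> U \<Longrightarrow> Q e = sat M (inst \<tau> e) \<psi>"
    using assms(2) by (rule dpredE) blast
  obtain \<phi>' where 3: "wf_fm L \<phi>'" "\<And>e. sat M e \<phi>' \<longleftrightarrow> sat M (e \<circ> (\<lambda>i. 2 * i)) \<phi>"
    using rename_fm[of L \<phi> "\<lambda>i. 2 * i"] 1(1) by blast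
  obtain \<psi>' where 4: "wf_fm L \<psi>'" "\<And>e. sat M e \<psi>' \<longleftrightarrow> sat M (e \<circ> (\<lambda>i. 2 * i + 1)) \<psi>"
    using rename_fm[of L \<psi> "\<lambda>i. 2 * i + 1"] 2(1) by blast
  let ?\<rho> = "\<lambda>i. if even i then \<sigma> (i div 2) else \<tau> (i div 2)"
  have "inst ?\<rho> e \<circ> (\<lambda>i. 2 * i) = inst \<sigma> e" "inst ?\<rho> e \<circ> (\<lambda>i. 2 * i + 1) = inst \<tau> e" for e
    by (auto simp: inst_def)
  then show ?thesis
    using 1 2 3 4 by (intro dpredI[of "Conj \<phi>' \<psi>'" _ ?\<rho>]) (auto simp: over_def)
qed

lemma dpred_disj: "dpred A P \<Longrightarrow> dpred A Q \<Longrightarrow> dpred A (\<lambda>e. P e \<or> Q e)"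
  using dpred_neg[OF dpred_conj[OF dpred_neg dpred_neg]] by simp

lemma dpred_const: "dpred A (\<lambda>e. b)"
proof -
  have "dpred A (\<lambda>e. True)"
    by (rule dpredI[of "Eq (Var 0) (Var 0)" _ Inr]) (auto simp: over_def)
  then show ?thesis using dpred_neg[of A "\<lambda>e. True"] by (cases b) auto
qed

lemma dpred_eq: "dpred A (\<lambda>e. e i = e j)"
  by (rule dpredI[of "Eq (Var i) (Var j)" _ Inr]) (auto simp: over_def inst_def)

lemma dpred_ex:
  assumes "dpred A P"
  shows "dpred A (\<lambda>e. \<exists>x\<in>U. P (case_nat x e))"
proof -
  obtain \<phi> \<sigma> where 1: "wf_fm L \<phi>" "over A \<sigma>" "\<And>e. range e \<subseteq> U \<Longrightarrow> P e = sat M (inst \<sigma> e) \<phi>"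
    using assms by (rule dpredE) blast
  \<comment> \<open>All variables instantiated by entry \<open>0\<close> are merged into variable
    \<open>0\<close>, so a single quantifier binds them; the others move up. In
    \<open>?\<tau>\<close> below the outer entry \<open>j\<close> becomes \<open>j - 1\<close>;
    where \<open>\<sigma> i = Inr 0\<close>, its value is a default that is never read.\<close>
  let ?f = "\<lambda>i. if \<sigma> i = Inr 0 then 0 else Suc i"
  obtain \<phi>' where 2: "wf_fm L \<phi>'" "\<And>e. sat M e \<phi>' \<longleftrightarrow> sat M (e \<circ> ?f) \<phi>"
    using rename_fm[of L \<phi> ?f] 1(1) by blast
  let ?\<tau> = "case_nat (Inr 0) (\<lambda>i. map_sum id (\<lambda>j. j - 1) (\<sigma> i))"
  have "(inst ?\<tau> e)(0 := x) \<circ> ?f = inst \<sigma> (case_nat x e)" for e x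
    by (auto simp: inst_def fun_eq_iff split: sum.splits nat.splits)
  moreover have "over A ?\<tau>"
    using over_map_sum[OF 1(2)] by (auto simp: over_def split: nat.splits)
  ultimately show ?thesis using 1 2
    by (intro dpredI[of "Ex 0 \<phi>'" _ ?\<tau>]) (auto simp: range_case_nat)
qed

lemma dpred_subst:
  assumes "dpred A P" "over A \<tau>" "A \<subseteq> U"
  shows "dpred A (\<lambda>e. P (inst \<tau> e))"
proof -
  obtain \<phi> \<sigma> where 1: "wf_fm L \<phi>" "over A \<sigma>" "\<And>e. range e \<subseteq> U \<Longrightarrow> P e = sat M (inst \<sigma> e) \<phi>"
    using assms by (elim dpredE) blast
  let ?\<rho> = "\<lambda>i. case_sum Inl \<tau> (\<sigma> i)"
  have "inst ?\<rho> e = inst \<sigma> (inst \<tau> e)" for e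
    by (auto simp: inst_def fun_eq_iff split: sum.splits)
  then show ?thesis using 1 assms inst_range[OF assms(2,3)]
    by (intro dpredI[of \<phi> _ ?\<rho>]) (auto simp: over_def split: sum.splits)
qed

lemma dpred_reindex:
  assumes "dpred A P" shows "dpred A (\<lambda>e. P (e \<circ> f))"
proof -
  obtain \<phi> \<sigma> where 1: "wf_fm L \<phi>" "over A \<sigma>" "\<And>e. range e \<subseteq> U \<Longrightarrow> P e = sat M (inst \<sigma> e) \<phi>"
    using assms by (elim dpredE) blast
  have "inst (map_sum id f \<circ> \<sigma>) e = inst \<sigma> (e \<circ> f)" for e
    by (auto simp: inst_def fun_eq_iff split: sum.splits)
  moreover have "over A (map_sum id f \<circ> \<sigma>)"
    using over_map_sum[OF 1(2)] by (simp add: comp_def)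
  moreover have "range (e \<circ> f) \<subseteq> U" if "range e \<subseteq> U" for e
    using that by auto
  ultimately show ?thesis using 1 by (intro dpredI[of \<phi>]) (auto simp del: o_apply)
qed

lemma dpred_exs:
  assumes "dpred A P"
  shows "dpred A (\<lambda>e. \<exists>w\<in>tuples M n. P (app w e))"
  using assms
proof (induction n arbitrary: P)
  case 0
  then show ?case by (auto simp: tuples_def)
next
  case (Suc n)
  have *: "(\<exists>w\<in>tuples M (Suc n). P (app w e)) \<longleftrightarrow> (\<exists>x\<in>U. \<exists>w\<in>tuples M n. P (app w (case_nat x e)))" for e
  proof
    assume "\<exists>w\<in>tuples M (Suc n). P (app w e)"
    then obtain w where w: "w \<in> tuples M (Suc n)" "P (app w e)" by blast
    then obtain v x where "w = v @ [x]" by (cases w rule: rev_cases) (auto simp: tuples_def)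
    then show "\<exists>x\<in>U. \<exists>w\<in>tuples M n. P (app w (case_nat x e))"
      using w by (auto simp: tuples_def app_snoc)
  next
    assume "\<exists>x\<in>U. \<exists>w\<in>tuples M n. P (app w (case_nat x e))"
    then obtain w x where "w \<in> tuples M n" "x \<in> U" "P (app w (case_nat x e))" by blast
    then show "\<exists>w\<in>tuples M (Suc n). P (app w e)"
      by (intro bexI[of _ "w @ [x]"]) (auto simp: tuples_def app_snoc)
  qed
  show ?case unfolding * by (rule dpred_ex[OF Suc.IH[OF Suc.prems]])
qed

text \<open>Bridges to \<open>formulas L m\<close>, which bounds the free variables: those from
  \<open>m\<close> on are bound existentially, the largest first.\<close>

lemma sat_exs:
  assumes "wf_fm L \<phi>"
  shows "\<exists>\<phi>'\<in>formulas L m. \<forall>e. range e \<subseteq> U \<longrightarrow>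
    (sat M e \<phi>' \<longleftrightarrow> (\<exists>e'. range e' \<subseteq> U \<and> (\<forall>i<m. e' i = e i) \<and> sat M e' \<phi>))"
proof -
  obtain k where k: "fv \<phi> \<subseteq> {..<m + k}"
    using finite_nat_bounded[OF finite_fv[of \<phi>]]
    by (metis le_add2 lessThan_subset_iff order_trans)
  have "\<exists>\<phi>'. wf_fm L \<phi>' \<and> fv \<phi>' \<subseteq> {..<m} \<and> (\<forall>e. range e \<subseteq> U \<longrightarrow>
    (sat M e \<phi>' \<longleftrightarrow> (\<exists>e'. range e' \<subseteq> U \<and> (\<forall>i<m. e' i = e i) \<and> sat M e' \<phi>)))"
    using assms k
  proof (induction k arbitrary: \<phi>)
    case 0
    have "sat M e \<phi> \<longleftrightarrow> (\<exists>e'. range e' \<subseteq> U \<and> (\<forall>i<m. e' i = e i) \<and> sat M e' \<phi>)"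
      if "range e \<subseteq> U" for e
    proof
      assume "\<exists>e'. range e' \<subseteq> U \<and> (\<forall>i<m. e' i = e i) \<and> sat M e' \<phi>"
      then obtain e' where "\<forall>i<m. e' i = e i" "sat M e' \<phi>" by blast
      moreover have "sat M e' \<phi> \<longleftrightarrow> sat M e \<phi>"
        by (rule sat_cong) (use 0 calculation in auto)
      ultimately show "sat M e \<phi>" by simp
    qed (use that in blast)
    then show ?case using 0 by auto
  next
    case (Suc k)
    have "i < m + k" if "i < m + Suc k" "i \<noteq> m + k" for i
      using that by linarith
    then have "fv (Ex (m + k) \<phi>) \<subseteq> {..<m + k}" using Suc.prems by auto
    then obtain \<phi>' where \<phi>': "wf_fm L \<phi>'" "fv \<phi>' \<subseteq> {..<m}" "\<And>e. range e \<subseteq> U \<Longrightarrow>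
      sat M e \<phi>' \<longleftrightarrow> (\<exists>e'. range e' \<subseteq> U \<and> (\<forall>i<m. e' i = e i) \<and> sat M e' (Ex (m + k) \<phi>))"
      using Suc.IH[of "Ex (m + k) \<phi>"] Suc.prems by auto
    have "(\<exists>e'. range e' \<subseteq> U \<and> (\<forall>i<m. e' i = e i) \<and> sat M e' (Ex (m + k) \<phi>)) \<longleftrightarrow>
      (\<exists>e'. range e' \<subseteq> U \<and> (\<forall>i<m. e' i = e i) \<and> sat M e' \<phi>)" for e
    proof
      assume "\<exists>e'. range e' \<subseteq> U \<and> (\<forall>i<m. e' i = e i) \<and> sat M e' (Ex (m + k) \<phi>)"
      then obtain e' a where "range e' \<subseteq> U" "\<forall>i<m. e' i = e i" "a \<in> U" "sat M (e'(m + k := a)) \<phi>"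
        by auto
      then show "\<exists>e'. range e' \<subseteq> U \<and> (\<forall>i<m. e' i = e i) \<and> sat M e' \<phi>"
        by (intro exI[of _ "e'(m + k := a)"]) (auto simp: image_subset_iff)
    next
      assume "\<exists>e'. range e' \<subseteq> U \<and> (\<forall>i<m. e' i = e i) \<and> sat M e' \<phi>"
      then obtain e' where "range e' \<subseteq> U" "\<forall>i<m. e' i = e i" "sat M e' \<phi>" by blast
      then show "\<exists>e'. range e' \<subseteq> U \<and> (\<forall>i<m. e' i = e i) \<and> sat M e' (Ex (m + k) \<phi>)"
        by (intro exI[of _ e']) (auto intro!: bexI[of _ "e' (m + k)"])
    qed
    then show ?case using \<phi>' by auto
  qed
  then show ?thesis by (auto simp: formulas_def)
qed

text \<open>From right to left, a formula for the predicate may mention entries beyond the first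
  \<open>n\<close>, although membership in \<open>X\<close> does not depend on them; quantifying
  them away leaves a formula in the tuple and the parameters only.\<close>

lemma definable_iff:
  assumes "A \<subseteq> U" "U \<noteq> {}"
  shows "definable L M A n X \<longleftrightarrow> X \<subseteq> tuples M n \<and> dpred A (\<lambda>e. map e [0..<n] \<in> X)"
proof
  assume "definable L M A n X"
  then obtain \<phi> bs where *: "set bs \<subseteq> A" "\<phi> \<in> formulas L (n + length bs)" "X = solutions M n \<phi> bs"
    unfolding definable_def by blast
  let ?\<sigma> = "\<lambda>i. if i < n then Inr i else if i - n < length bs then Inl (bs ! (i - n)) else Inr 0"
  have "map e [0..<n] \<in> X \<longleftrightarrow> sat M (inst ?\<sigma> e) \<phi>" if "range e \<subseteq> U" for e
  proof -
    have "sat M ((!) (map e [0..<n] @ bs)) \<phi> \<longleftrightarrow> sat M (inst ?\<sigma> e) \<phi>"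
      by (rule sat_cong) (use * in \<open>auto simp: formulas_def inst_def nth_append\<close>)
    then show ?thesis using that by (auto simp: *(3) solutions_def tuples_def)
  qed
  moreover have "over A ?\<sigma>" using *(1) by (auto simp: over_def split: if_splits)
  ultimately show "X \<subseteq> tuples M n \<and> dpred A (\<lambda>e. map e [0..<n] \<in> X)"
    using * by (auto simp: solutions_def formulas_def intro!: dpredI)
next
  assume *: "X \<subseteq> tuples M n \<and> dpred A (\<lambda>e. map e [0..<n] \<in> X)"
  then obtain \<phi> \<sigma> where 1: "wf_fm L \<phi>" "over A \<sigma>"
    "\<And>e. range e \<subseteq> U \<Longrightarrow> map e [0..<n] \<in> X \<longleftrightarrow> sat M (inst \<sigma> e) \<phi>"
    using dpredE by blast
  define S where "S = {i \<in> fv \<phi>. \<exists>a. \<sigma> i = Inl a}"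
  define ks where "ks = sorted_list_of_set S"
  have ks: "set ks = S" "finite S" by (auto simp: ks_def S_def)
  define bs where "bs = map (\<lambda>i. projl (\<sigma> i)) ks"
  define idx where "idx i = (SOME k. k < length ks \<and> ks ! k = i)" for i
  have idx: "idx i < length ks" "ks ! idx i = i" if "i \<in> S" for i
    using someI_ex[of "\<lambda>k. k < length ks \<and> ks ! k = i"] that ks
    by (auto simp: idx_def in_set_conv_nth)
  let ?m = "n + length bs"
  have len: "length bs = length ks" by (simp add: bs_def)
  \<comment> \<open>Three ranges: the tuple at \<open>0, ..., n - 1\<close>, the parameters
    \<open>bs\<close> right after it, and the stray entries from \<open>?m\<close> on, which
    \<open>sat_exs\<close> removes.\<close>
  define f where "f i = (case \<sigma> i of Inl a \<Rightarrow> n + idx i | Inr j \<Rightarrow> if j < n then j else ?m + j)" for i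
  obtain \<phi>' where 2: "wf_fm L \<phi>'" "\<And>e. sat M e \<phi>' \<longleftrightarrow> sat M (e \<circ> f) \<phi>"
    using rename_fm[of L \<phi> f] 1(1) by blast
  have bsA: "set bs \<subseteq> A" using 1(2) ks by (auto simp: bs_def S_def over_def)
  obtain u where u: "u \<in> U" using assms by blast
  have key: "sat M (app (as @ bs) e) \<phi>' \<longleftrightarrow> as \<in> X" if "as \<in> tuples M n" "range e \<subseteq> U" for as e
  proof -
    let ?e = "\<lambda>j. if j < n then as ! j else e j"
    have r: "range ?e \<subseteq> U"
      using that by (auto simp: tuples_def image_subset_iff)
    have "sat M (app (as @ bs) e \<circ> f) \<phi> \<longleftrightarrow> sat M (inst \<sigma> ?e) \<phi>"
    proof (rule sat_cong)
      fix i assume i: "i \<in> fv \<phi>"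
      show "(app (as @ bs) e \<circ> f) i = inst \<sigma> ?e i"
      proof (cases "\<sigma> i")
        case (Inl a)
        then have "i \<in> S" using i by (auto simp: S_def)
        then show ?thesis using idx[of i] Inl that len
          by (auto simp: f_def inst_def app_def nth_append bs_def tuples_def)
      next
        case (Inr j)
        then show ?thesis using that
          by (auto simp: f_def inst_def app_def nth_append tuples_def)
      qed
    qed
    moreover have "map ?e [0..<n] = as"
      using that by (intro nth_equalityI) (auto simp: tuples_def)
    ultimately show ?thesis using 1(3)[OF r] 2(2) by simp
  qed
  obtain \<phi>'' where 3: "\<phi>'' \<in> formulas L ?m" "\<And>e. range e \<subseteq> U \<Longrightarrow>
    sat M e \<phi>'' \<longleftrightarrow> (\<exists>e'. range e' \<subseteq> U \<and> (\<forall>i<?m. e' i = e i) \<and> sat M e' \<phi>')"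
    by (rule bexE[OF sat_exs[OF 2(1), of ?m]]) (rule that, assumption, simp only:)
  have "as \<in> X \<longleftrightarrow> sat M ((!) (as @ bs)) \<phi>''" if as: "as \<in> tuples M n" for as
  proof -
    let ?e = "app (as @ bs) (\<lambda>_. u)"
    have r: "range ?e \<subseteq> U"
      by (rule range_app) (use as bsA assms u in \<open>auto simp: tuples_def\<close>)
    have "sat M ((!) (as @ bs)) \<phi>'' \<longleftrightarrow> sat M ?e \<phi>''"
      by (rule sat_cong) (use 3(1) as in \<open>auto simp: formulas_def app_def tuples_def\<close>)
    also have "\<dots> \<longleftrightarrow> (\<exists>e'. range e' \<subseteq> U \<and> (\<forall>i<?m. e' i = ?e i) \<and> sat M e' \<phi>')"
      using 3(2)[OF r] .
    also have "\<dots> \<longleftrightarrow> (\<exists>e'. range e' \<subseteq> U \<and> sat M (app (as @ bs) e') \<phi>')"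
    proof
      assume "\<exists>e'. range e' \<subseteq> U \<and> (\<forall>i<?m. e' i = ?e i) \<and> sat M e' \<phi>'"
      then obtain e' where e': "range e' \<subseteq> U" "\<forall>i<?m. e' i = ?e i" "sat M e' \<phi>'" by blast
      have len_as: "length (as @ bs) = ?m" using as by (simp add: tuples_def)
      have "e' = app (as @ bs) (\<lambda>j. e' (?m + j))"
      proof
        fix i show "e' i = app (as @ bs) (\<lambda>j. e' (?m + j)) i"
          using e'(2) len_as unfolding app_def by (cases "i < ?m") auto
      qed
      then show "\<exists>e'. range e' \<subseteq> U \<and> sat M (app (as @ bs) e') \<phi>'"
        using e' by (intro exI[of _ "\<lambda>j. e' (?m + j)"]) auto
    next
      assume "\<exists>e'. range e' \<subseteq> U \<and> sat M (app (as @ bs) e') \<phi>'"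
      then obtain e' where e': "range e' \<subseteq> U" "sat M (app (as @ bs) e') \<phi>'" by blast
      then have "range (app (as @ bs) e') \<subseteq> U"
        by (intro range_app) (use as bsA assms in \<open>auto simp: tuples_def\<close>)
      then show "\<exists>e'. range e' \<subseteq> U \<and> (\<forall>i<?m. e' i = ?e i) \<and> sat M e' \<phi>'"
        using e' as by (intro exI[of _ "app (as @ bs) e'"]) (auto simp: app_def tuples_def)
    qed
    also have "\<dots> \<longleftrightarrow> as \<in> X"
    proof
      assume "\<exists>e'. range e' \<subseteq> U \<and> sat M (app (as @ bs) e') \<phi>'"
      then show "as \<in> X" using key[OF as] by blast
    next
      assume "as \<in> X"
      moreover have "range (\<lambda>_::nat. u) \<subseteq> U" using u by auto
      ultimately show "\<exists>e'. range e' \<subseteq> U \<and> sat M (app (as @ bs) e') \<phi>'"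
        using key[OF as] by blast
    qed
    finally show ?thesis by simp
  qed
  then have "X = solutions M n \<phi>'' bs" using * by (auto simp: solutions_def)
  then show "definable L M A n X" using 3 bsA unfolding definable_def by blast
qed

end

section \<open>Dimension in a pregeometry\<close>

text \<open>Greedy count of the entries outside the closure of \<open>C\<close> and their
  predecessors. Additivity over concatenation is built in, which the maximum in
  \<open>tuple_dim\<close> does not show; \<open>Max_card_independent\<close> identifies the
  two.\<close>

primrec ldim :: "('a set \<Rightarrow> 'a set) \<Rightarrow> 'a set \<Rightarrow> 'a list \<Rightarrow> nat" where
  "ldim cl C [] = 0"
| "ldim cl C (x # xs) = (if x \<in> cl C then 0 else 1) + ldim cl (insert x C) xs"

lemma ldim_append: "ldim cl C (xs @ ys) = ldim cl C xs + ldim cl (C \<union> set xs) ys"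
  by (induction xs arbitrary: C) (auto simp: insert_commute)

lemma ldim_le_length: "ldim cl C xs \<le> length xs"
  by (induction xs arbitrary: C) (simp_all add: le_SucI)

locale pregeom =
  fixes S :: "'a set" and cl :: "'a set \<Rightarrow> 'a set"
  assumes pregeometry: "pregeometry S cl"
begin

lemma cl_subset: "C \<subseteq> S \<Longrightarrow> cl C \<subseteq> S"
  and cl_incl: "C \<subseteq> S \<Longrightarrow> C \<subseteq> cl C"
  and cl_idem: "C \<subseteq> S \<Longrightarrow> cl (cl C) = cl C"
  using pregeometry[unfolded pregeometry_def, THEN conjunct1] by simp_all

lemma cl_mono: "C \<subseteq> D \<Longrightarrow> D \<subseteq> S \<Longrightarrow> cl C \<subseteq> cl D"
  using pregeometry[unfolded pregeometry_def, THEN conjunct2, THEN conjunct1] by simp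

lemma cl_finitary: "C \<subseteq> S \<Longrightarrow> a \<in> cl C \<Longrightarrow> \<exists>C0\<subseteq>C. finite C0 \<and> a \<in> cl C0"
  using pregeometry[unfolded pregeometry_def, THEN conjunct2, THEN conjunct2, THEN conjunct1] by simp

lemma exchange:
  "C \<subseteq> S \<Longrightarrow> a \<in> S \<Longrightarrow> b \<in> S \<Longrightarrow> a \<in> cl (insert b C) \<Longrightarrow> a \<notin> cl C \<Longrightarrow> b \<in> cl (insert a C)"
  using pregeometry[unfolded pregeometry_def, THEN conjunct2, THEN conjunct2, THEN conjunct2] by simp

lemma cl_least: "C \<subseteq> cl D \<Longrightarrow> D \<subseteq> S \<Longrightarrow> cl C \<subseteq> cl D"
  by (metis cl_idem cl_mono cl_subset)

lemma cl_eqI: "C \<subseteq> cl D \<Longrightarrow> D \<subseteq> cl C \<Longrightarrow> C \<subseteq> S \<Longrightarrow> D \<subseteq> S \<Longrightarrow> cl C = cl D"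
  by (meson cl_least subset_antisym)

lemma cl_insert_cong:
  assumes "cl C = cl D" "C \<subseteq> S" "D \<subseteq> S" "x \<in> S"
  shows "cl (insert x C) = cl (insert x D)"
proof (rule cl_eqI)
  have "C \<subseteq> cl D" "D \<subseteq> cl C" using cl_incl assms by auto
  moreover have "cl D \<subseteq> cl (insert x D)" "cl C \<subseteq> cl (insert x C)"
    by (rule cl_mono; use assms in auto)+
  moreover have "x \<in> cl (insert x D)" "x \<in> cl (insert x C)"
    using cl_incl[of "insert x D"] cl_incl[of "insert x C"] assms by auto
  ultimately show "insert x C \<subseteq> cl (insert x D)" "insert x D \<subseteq> cl (insert x C)" by auto
qed (use assms in auto)

lemma ldim_cl_cong:
  assumes "cl C = cl D" "C \<subseteq> S" "D \<subseteq> S" "set xs \<subseteq> S"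
  shows "ldim cl C xs = ldim cl D xs"
  using assms
proof (induction xs arbitrary: C D)
  case (Cons x xs)
  have "ldim cl (insert x C) xs = ldim cl (insert x D) xs"
    by (rule Cons.IH[OF cl_insert_cong[OF Cons.prems(1-3), of x]]) (use Cons.prems in simp_all)
  then show ?case using Cons.prems(1) by simp
qed simp

lemma cl_insert_absorb: "x \<in> cl C \<Longrightarrow> C \<subseteq> S \<Longrightarrow> cl (insert x C) = cl C"
  by (rule cl_eqI) (use cl_incl[of C] cl_incl[of "insert x C"] cl_subset[of C] in auto)

lemma ldim_insert_absorb:
  "x \<in> cl C \<Longrightarrow> C \<subseteq> S \<Longrightarrow> set xs \<subseteq> S \<Longrightarrow> ldim cl (insert x C) xs = ldim cl C xs"
  by (rule ldim_cl_cong) (use cl_insert_absorb[of x C] cl_subset[of C] in auto)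

lemma ldim_0: "set xs \<subseteq> cl C \<Longrightarrow> C \<subseteq> S \<Longrightarrow> ldim cl C xs = 0"
proof (induction xs)
  case (Cons x xs)
  have "set xs \<subseteq> S" using Cons.prems cl_subset[of C] by auto
  then show ?case using Cons ldim_insert_absorb[of x C xs] by simp
qed simp

text \<open>The exchange axiom enters the dimension theory here: it makes the greedy count
  independent of the order.\<close>

lemma ldim_swap:
  assumes "C \<subseteq> S" "x \<in> S" "y \<in> S"
  shows "ldim cl C (x # y # zs) = ldim cl C (y # x # zs)"
proof -
  have "x \<in> cl C \<Longrightarrow> x \<in> cl (insert y C)" "y \<in> cl C \<Longrightarrow> y \<in> cl (insert x C)"
    using cl_mono[of C "insert y C"] cl_mono[of C "insert x C"] assms by auto
  then show ?thesis
    using exchange[of C x y] exchange[of C y x] assms cl_insert_absorb[of x C] cl_insert_absorb[of y C]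
    by (auto simp: insert_commute)
qed

lemma ldim_move:
  assumes "C \<subseteq> S" "x \<in> S" "set us \<subseteq> S"
  shows "ldim cl C (us @ x # vs) = ldim cl C (x # us @ vs)"
  using assms
proof (induction us arbitrary: C)
  case (Cons u us)
  have "ldim cl C (u # us @ x # vs) = ldim cl C (u # x # us @ vs)"
    using Cons.IH[of "insert u C"] Cons.prems by simp
  then show ?case using ldim_swap[of C u x] Cons.prems by simp
qed simp

lemma ldim_commute:
  assumes "C \<subseteq> S" "set us \<subseteq> S" "set vs \<subseteq> S"
  shows "ldim cl C (us @ vs) = ldim cl C (vs @ us)"
  using assms
proof (induction vs arbitrary: C)
  case (Cons v vs)
  have "ldim cl C (us @ v # vs) = ldim cl C (v # us @ vs)"
    by (rule ldim_move) (use Cons.prems in auto)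
  then show ?case using Cons.IH[of "insert v C"] Cons.prems by simp
qed simp

lemma ldim_absorb:
  assumes "C \<subseteq> S" "set xs \<subseteq> S" "set ys \<subseteq> cl (C \<union> set xs)"
  shows "ldim cl C (xs @ ys) = ldim cl C xs"
  using ldim_0[of ys "C \<union> set xs"] assms by (simp add: ldim_append)

text \<open>Counting \<open>xs\<close> and \<open>ys\<close> together in both orders gives the
  dimension of \<open>xs\<close> on one side and at least that of \<open>ys\<close> on the
  other.\<close>

lemma ldim_le:
  assumes "C \<subseteq> S" "set xs \<subseteq> S" "set ys \<subseteq> cl (C \<union> set xs)"
  shows "ldim cl C ys \<le> ldim cl C xs"
proof -
  have "set ys \<subseteq> S" using assms cl_subset[of "C \<union> set xs"] by auto
  then show ?thesis
    using ldim_absorb[OF assms] ldim_commute[of C xs ys] assms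
    by (simp add: ldim_append)
qed

lemma ldim_subset: "C \<subseteq> S \<Longrightarrow> set xs \<subseteq> S \<Longrightarrow> set ys \<subseteq> set xs \<Longrightarrow> ldim cl C ys \<le> ldim cl C xs"
  by (rule ldim_le) (use cl_incl[of "C \<union> set xs"] in auto)

lemma ldim_set: "C \<subseteq> S \<Longrightarrow> set xs \<subseteq> S \<Longrightarrow> set ys = set xs \<Longrightarrow> ldim cl C ys = ldim cl C xs"
  by (simp add: ldim_subset order_antisym)

lemma ldim_mono:
  assumes "C \<subseteq> D" "D \<subseteq> S" "set xs \<subseteq> S"
  shows "ldim cl D xs \<le> ldim cl C xs"
  using assms
proof (induction xs arbitrary: C D)
  case (Cons x xs)
  have "ldim cl (insert x D) xs \<le> ldim cl (insert x C) xs"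
    by (rule Cons.IH) (use Cons.prems in auto)
  moreover have "cl C \<subseteq> cl D" using cl_mono Cons.prems by auto
  ultimately show ?case by auto
qed simp

lemma ldim_independent:
  assumes "\<And>s. s \<in> set xs \<Longrightarrow> s \<notin> cl (C \<union> (set xs - {s}))" "distinct xs" "C \<subseteq> S" "set xs \<subseteq> S"
  shows "ldim cl C xs = length xs"
  using assms
proof (induction xs arbitrary: C)
  case (Cons x xs)
  have "x \<notin> cl C"
    using Cons.prems(1)[of x] cl_mono[of C "C \<union> (set (x # xs) - {x})"] Cons.prems by auto
  moreover have "insert x C \<union> (set xs - {s}) = C \<union> (set (x # xs) - {s})" if "s \<in> set xs" for s
    using that Cons.prems(2) by auto
  then have "ldim cl (insert x C) xs = length xs"
    using Cons.prems by (intro Cons.IH) auto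
  ultimately show ?case by simp
qed simp

text \<open>With \<open>s\<close> moved to the end, the remaining entries contribute at most one
  less than the length, so \<open>s\<close> itself must contribute.\<close>

lemma ldim_eq_length:
  assumes "ldim cl C xs = length xs" "C \<subseteq> S" "set xs \<subseteq> S"
  shows "distinct xs" "\<And>s. s \<in> set xs \<Longrightarrow> s \<notin> cl (C \<union> (set xs - {s}))"
proof -
  have *: "s \<notin> cl (C \<union> set (us @ vs))" if "xs = us @ s # vs" for us s vs
  proof -
    have "ldim cl C ((us @ vs) @ [s]) = length xs"
      using assms that ldim_set[of C xs "(us @ vs) @ [s]"] by auto
    then show ?thesis
      using that ldim_le_length[of cl C "us @ vs"] unfolding ldim_append[of _ _ "us @ vs"]
      by (auto split: if_splits)
  qed
  have incl: "C \<union> set ys \<subseteq> cl (C \<union> set ys)" if "set ys \<subseteq> set xs" for ys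
    using cl_incl[of "C \<union> set ys"] assms that by blast
  have **: "s \<notin> set (us @ vs)" if "xs = us @ s # vs" for us s vs
    using *[OF that] incl[of "us @ vs"] that by auto
  show "distinct xs"
  proof (rule ccontr)
    assume "\<not> distinct xs"
    then obtain us y vs ws where "xs = us @ [y] @ vs @ [y] @ ws" using not_distinct_decomp by blast
    then show False using **[of us y "vs @ y # ws"] by simp
  qed
  fix s assume "s \<in> set xs"
  then obtain us vs where xs: "xs = us @ s # vs" by (meson split_list)
  then have "set xs - {s} = set (us @ vs)" using **[OF xs] by auto
  then show "s \<notin> cl (C \<union> (set xs - {s}))" using *[OF xs] by simp
qed

lemma ldim_basis:
  assumes "C \<subseteq> S" "set xs \<subseteq> S"
  shows "\<exists>ys. set ys \<subseteq> set xs \<and> ldim cl C ys = length ys \<and> length ys = ldim cl C xs"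
  using assms
proof (induction xs arbitrary: C)
  case (Cons x xs)
  then obtain ys where ys: "set ys \<subseteq> set xs" "ldim cl (insert x C) ys = length ys"
    "length ys = ldim cl (insert x C) xs" by (meson insert_subset list.set_intros(1) order.trans set_subset_Cons subset_iff)
  show ?case
  proof (cases "x \<in> cl C")
    case True
    then show ?thesis using ys ldim_insert_absorb[of x C ys] Cons.prems by (intro exI[of _ ys]) auto
  next
    case False
    then show ?thesis using ys by (intro exI[of _ "x # ys"]) auto
  qed
qed simp

lemma Max_card_independent:
  assumes "C \<subseteq> S" "set xs \<subseteq> S"
  shows "Max (card ` {T. T \<subseteq> set xs \<and> (\<forall>s\<in>T. s \<notin> cl (C \<union> (T - {s})))}) = ldim cl C xs"
proof (rule Max_eqI)
  show "finite (card ` {T. T \<subseteq> set xs \<and> (\<forall>s\<in>T. s \<notin> cl (C \<union> (T - {s})))})" by simp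
next
  fix k assume "k \<in> card ` {T. T \<subseteq> set xs \<and> (\<forall>s\<in>T. s \<notin> cl (C \<union> (T - {s})))}"
  then obtain T where T: "T \<subseteq> set xs" "\<forall>s\<in>T. s \<notin> cl (C \<union> (T - {s}))" "k = card T" by blast
  then obtain ts where ts: "set ts = T" "distinct ts"
    using finite_distinct_list[of T] finite_subset by blast
  then have "ldim cl C ts = length ts" by (intro ldim_independent) (use T assms in auto)
  then show "k \<le> ldim cl C xs"
    using ldim_subset[of C xs ts] ts T assms distinct_card[of ts] by auto
next
  obtain ys where ys: "set ys \<subseteq> set xs" "ldim cl C ys = length ys" "length ys = ldim cl C xs"
    using ldim_basis[OF assms] by blast
  have "set ys \<subseteq> S" using ys assms by auto
  note * = ldim_eq_length[OF ys(2) assms(1) this]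
  show "ldim cl C xs \<in> card ` {T. T \<subseteq> set xs \<and> (\<forall>s\<in>T. s \<notin> cl (C \<union> (T - {s})))}"
    by (rule image_eqI[of _ _ "set ys"]) (use * ys distinct_card[of ys] in auto)
qed

end

section \<open>The pregeometry of the given structure\<close>

text \<open>The pregeometry hypothesis speaks of models on a larger type, so \<open>M\<close> is
  first moved there along \<open>Inl\<close>.\<close>

definition copy :: "('f, 'r, 'u) struct \<Rightarrow> ('f, 'r, 'u + 'b) struct" where
  "copy M = \<lparr>univ = Inl ` univ M, fun_int = (\<lambda>f as. Inl (fun_int M f (map projl as))),
    rel_int = (\<lambda>r as. rel_int M r (map projl as))\<rparr>"

lemma eval_copy: "eval (copy M :: ('f, 'r, 'u + 'b) struct) (Inl \<circ> e) t = Inl (eval M e t)"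
proof (induction t)
  case (App f ts)
  have "map (projl \<circ> eval (copy M :: ('f, 'r, 'u + 'b) struct) (Inl \<circ> e)) ts = map (eval M e) ts"
    by (rule map_cong) (use App in \<open>auto simp del: o_apply simp: o_apply[of projl]\<close>)
  then show ?case by (simp add: copy_def del: map_eq_conv o_apply)
qed simp

lemma sat_copy: "sat (copy M :: ('f, 'r, 'u + 'b) struct) (Inl \<circ> e) \<phi> \<longleftrightarrow> sat M e \<phi>"
proof (induction \<phi> arbitrary: e)
  case (Rel r ts)
  have "map (projl \<circ> eval (copy M :: ('f, 'r, 'u + 'b) struct) (Inl \<circ> e)) ts = map (eval M e) ts"
    by (rule map_cong) (simp_all add: eval_copy)
  then show ?case by (simp add: copy_def del: map_eq_conv o_apply)
next
  case (Ex i \<phi>)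
  let ?N = "copy M :: ('f, 'r, 'u + 'b) struct"
  have "(Inl \<circ> e)(i := Inl a) = (Inl \<circ> e(i := a) :: nat \<Rightarrow> 'u + 'b)" for a
    by auto
  then have "sat ?N ((Inl \<circ> e)(i := Inl a)) \<phi> \<longleftrightarrow> sat M (e(i := a)) \<phi>" for a
    using Ex.IH[of "e(i := a)"] by (simp only:)
  moreover have "univ ?N = Inl ` univ M" by (simp add: copy_def)
  ultimately show ?case by (simp del: fun_upd_apply o_apply)
qed (auto simp: eval_copy)

lemma solutions_copy:
  assumes "\<phi> \<in> formulas L (n + length bs)"
  shows "solutions (copy M :: ('f, 'r, 'u + 'b) struct) n \<phi> (map Inl bs) = map Inl ` solutions M n \<phi> bs"
proof -
  let ?N = "copy M :: ('f, 'r, 'u + 'b) struct"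
  have *: "sat ?N ((!) (map Inl as @ map Inl bs)) \<phi> \<longleftrightarrow> sat M ((!) (as @ bs)) \<phi>"
    if "length as = n" for as
  proof -
    have "sat ?N ((!) (map Inl as @ map Inl bs)) \<phi> \<longleftrightarrow> sat ?N (Inl \<circ> (!) (as @ bs)) \<phi>"
      by (rule sat_cong) (use assms that in \<open>auto simp: formulas_def nth_append\<close>)
    then show ?thesis by (simp add: sat_copy)
  qed
  have "tuples ?N n = map Inl ` tuples M n"
  proof (intro equalityI subsetI)
    fix as assume as: "as \<in> tuples ?N n"
    then have "a \<in> Inl ` univ M" if "a \<in> set as" for a
      using that by (auto simp: tuples_def copy_def)
    then have "map Inl (map projl as) = as" "set (map projl as) \<subseteq> univ M"
      by (auto intro!: map_idI) fastforce+
    moreover have "length (map projl as) = n" using as by (simp add: tuples_def)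
    ultimately show "as \<in> map Inl ` tuples M n"
      unfolding tuples_def by (intro image_eqI[of _ _ "map projl as"]) auto
  qed (auto simp: tuples_def copy_def intro!: imageI)
  then show ?thesis using * by (auto simp: solutions_def tuples_def)
qed

lemma definable_copy:
  "definable L (copy M) (Inl ` A) n Y \<longleftrightarrow> (\<exists>X. definable L M A n X \<and> Y = map Inl ` X)"
proof
  assume "definable L (copy M) (Inl ` A) n Y"
  then obtain \<phi> bs where *: "set bs \<subseteq> Inl ` A" "\<phi> \<in> formulas L (n + length bs)"
    "Y = solutions (copy M) n \<phi> bs" unfolding definable_def by blast
  have "map Inl (map projl bs) = bs" "set (map projl bs) \<subseteq> A"
    using *(1) by (auto simp: comp_def intro!: map_idI)
  moreover have "\<phi> \<in> formulas L (n + length (map projl bs))" using *(2) by simp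
  ultimately show "\<exists>X. definable L M A n X \<and> Y = map Inl ` X"
    using solutions_copy[of \<phi> L n "map projl bs" M] *(3) unfolding definable_def by metis
next
  assume "\<exists>X. definable L M A n X \<and> Y = map Inl ` X"
  then obtain \<phi> bs where *: "set bs \<subseteq> A" "\<phi> \<in> formulas L (n + length bs)"
    "Y = map Inl ` solutions M n \<phi> bs" unfolding definable_def by blast
  then show "definable L (copy M) (Inl ` A) n Y"
    unfolding definable_def
    by (intro exI[of _ \<phi>] exI[of _ "map Inl bs"]) (auto simp: solutions_copy)
qed

lemma acl_copy: "acl L (copy M :: ('f, 'r, 'u + 'b) struct) (Inl ` A) = Inl ` acl L M A"
proof (intro equalityI subsetI)
  fix b :: "'u + 'b"
  assume "b \<in> acl L (copy M) (Inl ` A)"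
  then obtain Y where "definable L (copy M) (Inl ` A) 1 Y" "finite Y" "[b] \<in> Y"
    unfolding acl_def mem_Collect_eq by (elim exE conjE)
  then obtain X where X: "definable L M A 1 X" "finite (map Inl ` X :: ('u + 'b) list set)"
    "[b] \<in> map Inl ` X"
    unfolding definable_copy by (elim exE conjE) simp
  have "finite X" using X(2) by (rule finite_imageD) (auto intro: inj_on_mapI)
  moreover obtain a where "b = Inl a" "[a] \<in> X" using X(3) by (auto simp: Cons_eq_map_conv)
  ultimately show "b \<in> Inl ` acl L M A" using X(1) unfolding acl_def by blast
next
  fix b :: "'u + 'b"
  assume "b \<in> Inl ` acl L M A"
  then obtain a X where *: "b = Inl a" "definable L M A 1 X" "finite X" "[a] \<in> X"
    unfolding acl_def by blast
  have "definable L (copy M) (Inl ` A) 1 (map Inl ` X :: ('u + 'b) list set)"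
    using *(2) by (auto simp: definable_copy)
  moreover have "[b] \<in> map Inl ` X" using * by (intro image_eqI[of _ _ "[a]"]) auto
  ultimately show "b \<in> acl L (copy M) (Inl ` A)"
    using *(3) unfolding acl_def mem_Collect_eq
    by (intro exI[of _ "map Inl ` X"] conjI) auto
qed

text \<open>The copy is a model of the theory; each axiom is pulled back along the injection
  \<open>Inl\<close>, with which closure commutes.\<close>

lemma pregeometry_acl:
  assumes "geometric L (M :: ('f, 'r, 'u) struct)"
  shows "pregeometry (univ M) (acl L M)"
proof -
  let ?N = "copy M :: ('f, 'r, 'u + 'f + 'r + nat) struct"
  have "sat ?N ((!) []) \<phi>" if "\<phi> \<in> Th L M" for \<phi>
  proof -
    have "sat ?N ((!) []) \<phi> \<longleftrightarrow> sat ?N (Inl \<circ> (!) []) \<phi>"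
      by (rule sat_cong) (use that in \<open>auto simp: Th_def formulas_def\<close>)
    then show ?thesis using that by (simp add: sat_copy Th_def)
  qed
  moreover have "is_structure L ?N"
    unfolding is_structure_def
  proof (intro conjI ballI allI impI)
    show "univ ?N \<noteq> {}" using assms by (auto simp: geometric_def is_structure_def copy_def)
    fix f as assume f: "f \<in> fun_syms L" "length as = fun_arity L f \<and> set as \<subseteq> univ ?N"
    then have "set (map projl as) \<subseteq> univ M" by (auto simp: copy_def)
    then show "fun_int ?N f as \<in> univ ?N"
      using assms f by (auto simp: geometric_def is_structure_def copy_def)
  qed
  ultimately have "pregeometry (univ ?N) (acl L ?N)"
    using assms by (simp add: geometric_def is_model_def)
  then have N: "pregeometry (Inl ` univ M) (acl L ?N)" by (simp add: copy_def)
  have inj: "inj (Inl :: 'u \<Rightarrow> 'u + 'f + 'r + nat)" by simp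
  interpret N: pregeom "Inl ` univ M" "acl L ?N" using N by unfold_locales
  note incl = inj_image_subset_iff[OF inj]
  show ?thesis unfolding pregeometry_def
  proof (intro conjI allI impI ballI)
    fix A assume A: "A \<subseteq> univ M"
    show "A \<subseteq> acl L M A" "acl L M A \<subseteq> univ M"
      using N.cl_incl[of "Inl ` A"] N.cl_subset[of "Inl ` A"] A by (auto simp: acl_copy)
    show "acl L M (acl L M A) = acl L M A"
      using N.cl_idem[of "Inl ` A"] A by (simp add: acl_copy inj_image_eq_iff image_mono)
    show "\<exists>A0\<subseteq>A. finite A0 \<and> a \<in> acl L M A0" if a: "a \<in> acl L M A" for a
    proof -
      have "Inl a \<in> acl L ?N (Inl ` A)" using a by (simp add: acl_copy)
      then obtain B where "B \<subseteq> Inl ` A" "finite B" "Inl a \<in> acl L ?N B"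
        using N.cl_finitary[of "Inl ` A" "Inl a"] A by (auto intro: image_mono)
      then obtain A0 where "A0 \<subseteq> A" "B = Inl ` A0" "finite A0"
        by (metis finite_subset_image finite_imageD image_mono subset_image_iff inj inj_on_subset subset_UNIV)
      then show ?thesis using \<open>Inl a \<in> acl L ?N B\<close> by (auto simp: acl_copy)
    qed
    show "b \<in> acl L M (insert a A)"
      if "a \<in> univ M" "b \<in> univ M" "a \<in> acl L M (insert b A) - acl L M A" for a b
      using N.exchange[of "Inl ` A" "Inl a" "Inl b"] that A
      by (auto simp: acl_copy inj_image_mem_iff simp flip: image_insert)
  next
    fix A B assume "A \<subseteq> B \<and> B \<subseteq> univ M"
    then show "acl L M A \<subseteq> acl L M B"
      using N.cl_mono[of "Inl ` A" "Inl ` B"] by (auto simp: acl_copy image_mono inj_image_mem_iff)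
  qed
qed

section \<open>Definability of dimension\<close>

text \<open>Counting by removal of a point translates into nested quantifiers, so definability
  follows by recursion.\<close>

primrec atleast :: "nat \<Rightarrow> 'a set \<Rightarrow> bool" where
  "atleast 0 S \<longleftrightarrow> True"
| "atleast (Suc m) S \<longleftrightarrow> (\<exists>x\<in>S. atleast m (S - {x}))"

lemma atleast_iff: "atleast m S \<longleftrightarrow> infinite S \<or> m \<le> card S"
proof (induction m arbitrary: S)
  case (Suc m)
  show ?case
  proof (cases "finite S")
    case True
    then have "atleast (Suc m) S \<longleftrightarrow> (\<exists>x\<in>S. m \<le> card S - 1)"
      using Suc by simp
    also have "\<dots> \<longleftrightarrow> Suc m \<le> card S"
    proof (cases "S = {}")
      case False
      then have "0 < card S" using True by (simp add: card_gt_0_iff)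
      then show ?thesis using False by auto
    qed simp
    finally show ?thesis using True by simp
  next
    case False
    then show ?thesis using Suc by (auto simp: infinite_imp_nonempty ex_in_conv)
  qed
qed simp

context fo_structure
begin

lemma dpred_atleast:
  assumes "dpred A P"
  shows "dpred A (\<lambda>e. atleast m {x \<in> U. P (case_nat x e)})"
  using assms
proof (induction m arbitrary: P)
  case 0
  show ?case using dpred_const[of A True] by simp
next
  case (Suc m)
  \<comment> \<open>Composition with \<open>?f\<close> drops entry \<open>1\<close>, the removed
    point \<open>x\<close>, so that \<open>P\<close> is asked of \<open>y\<close> and the outer
    assignment.\<close>
  let ?f = "case_nat 0 (\<lambda>i. Suc (Suc i))"
  let ?Q = "\<lambda>e. P (e \<circ> ?f) \<and> \<not> e 0 = e 1"
  have f: "case_nat y (case_nat x e) \<circ> ?f = case_nat y e" for x y and e :: "nat \<Rightarrow> 'u"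
    by (auto simp: fun_eq_iff split: nat.splits)
  have "dpred A ?Q"
    by (intro dpred_conj dpred_neg dpred_eq dpred_reindex Suc.prems)
  from Suc.IH[OF this] have "dpred A (\<lambda>e. P e \<and> atleast m {y \<in> U. ?Q (case_nat y e)})"
    by (intro dpred_conj Suc.prems)
  from dpred_ex[OF this] have "dpred A (\<lambda>e. \<exists>x\<in>U. P (case_nat x e) \<and>
      atleast m {y \<in> U. P (case_nat y e) \<and> y \<noteq> x})"
    by (simp only: f) simp
  moreover have "atleast (Suc m) {x \<in> U. P (case_nat x e)} \<longleftrightarrow> (\<exists>x\<in>U. P (case_nat x e) \<and>
      atleast m {y \<in> U. P (case_nat y e) \<and> y \<noteq> x})" for e
  proof -
    have "{y \<in> U. P (case_nat y e)} - {x} = {y \<in> U. P (case_nat y e) \<and> y \<noteq> x}" for x by auto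
    then show ?thesis by auto
  qed
  ultimately show ?case by simp
qed

text \<open>\<open>dimge n k W\<close> expresses \<open>dim W \<ge> k\<close> for \<open>W \<subseteq> M\<^sup>n\<close> by fibering over the last
  coordinate. It mentions no parameter set, and elimination of \<open>\<exists>\<^sup>\<infinity>\<close> makes it definable in families.\<close>

primrec dimge :: "nat \<Rightarrow> nat \<Rightarrow> 'u list set \<Rightarrow> bool" where
  "dimge 0 k W \<longleftrightarrow> k = 0 \<and> [] \<in> W"
| "dimge (Suc n) k W \<longleftrightarrow> (\<exists>x\<in>U. dimge n k {w. w @ [x] \<in> W}) \<or>
     (0 < k \<and> infinite {x \<in> U. dimge n (k - 1) {w. w @ [x] \<in> W}})"

end

locale geometric_structure = fo_structure L M
  for L :: "('f, 'r) lang" and M :: "('f, 'r, 'u) struct" +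
  assumes geometric: "geometric L M" and saturated: "saturated L M"
begin

abbreviation "cl \<equiv> acl L M"

sublocale pregeom U cl
  by unfold_locales (rule pregeometry_acl[OF geometric])

lemma U_nonempty: "U \<noteq> {}"
  using geometric by (auto simp: geometric_def is_structure_def)

lemma definable_iff_dpred:
  "A \<subseteq> U \<Longrightarrow> definable L M A n X \<longleftrightarrow> X \<subseteq> tuples M n \<and> dpred A (\<lambda>e. map e [0..<n] \<in> X)"
  by (rule definable_iff[OF _ U_nonempty])

lemma tuple_dim_eq: "C \<subseteq> U \<Longrightarrow> set a \<subseteq> U \<Longrightarrow> tuple_dim L M C a = ldim cl C a"
  using Max_card_independent[of C a] by (simp add: tuple_dim_def alg_independent_def)

text \<open>The uniform bound is given for one formula and a finite parameter tuple. Only variables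
  below \<open>k\<close> occur in \<open>\<phi>\<close>, so their values under the assignment serve
  as this tuple.\<close>

lemma finite_fibre_bound:
  assumes "dpred A P" "A \<subseteq> U"
  shows "\<exists>N. \<forall>e. range e \<subseteq> U \<longrightarrow>
    infinite {x \<in> U. P (case_nat x e)} \<or> card {x \<in> U. P (case_nat x e)} \<le> N"
proof -
  obtain \<phi> \<sigma> where 1: "wf_fm L \<phi>" "over A \<sigma>" "\<And>e. range e \<subseteq> U \<Longrightarrow> P e = sat M (inst \<sigma> e) \<phi>"
    using assms(1) by (rule dpredE) blast
  let ?f = "\<lambda>i. if \<sigma> i = Inr 0 then 0 else Suc i"
  obtain \<phi>' where 2: "wf_fm L \<phi>'" "fv \<phi>' \<subseteq> ?f ` fv \<phi>"
    "\<And>e. sat M e \<phi>' \<longleftrightarrow> sat M (e \<circ> ?f) \<phi>"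
    using rename_fm[of L \<phi> ?f] 1(1) by blast
  obtain k where k: "fv \<phi> \<subseteq> {..<k}" using finite_nat_bounded[OF finite_fv[of \<phi>]] by blast
  have "\<phi>' \<in> formulas L (1 + k)" using 2 k by (auto simp: formulas_def)
  then obtain N where N: "\<And>bs. bs \<in> tuples M k \<Longrightarrow>
      infinite (solutions M 1 \<phi>' bs) \<or> card (solutions M 1 \<phi>' bs) \<le> N"
    using geometric unfolding geometric_def eliminates_exists_infinity_def by blast
  obtain u where u: "u \<in> U" using U_nonempty by blast
  have "infinite {x \<in> U. P (case_nat x e)} \<or> card {x \<in> U. P (case_nat x e)} \<le> N"
    if e: "range e \<subseteq> U" for e
  proof -
    \<comment> \<open>\<open>u\<close> fills the places instantiated by entry \<open>0\<close>;
      these are read from variable \<open>0\<close> instead.\<close>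
    let ?bs = "map (inst \<sigma> (case_nat u e)) [0..<k]"
    have "range (inst \<sigma> (case_nat u e)) \<subseteq> U"
      by (rule inst_range[OF 1(2) assms(2)]) (use e u in \<open>simp add: range_case_nat\<close>)
    then have bs: "?bs \<in> tuples M k" by (auto simp: tuples_def)
    have "sat M ((!) ([x] @ ?bs)) \<phi>' \<longleftrightarrow> P (case_nat x e)" if "x \<in> U" for x
    proof -
      have "sat M ((!) ([x] @ ?bs) \<circ> ?f) \<phi> \<longleftrightarrow> sat M (inst \<sigma> (case_nat x e)) \<phi>"
      proof (rule sat_cong)
        fix i assume "i \<in> fv \<phi>"
        then have "i < k" using k by auto
        then show "((!) ([x] @ ?bs) \<circ> ?f) i = inst \<sigma> (case_nat x e) i"
          by (auto simp: inst_def split: sum.splits nat.splits)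
      qed
      then show ?thesis using 1(3)[of "case_nat x e"] 2(3) that e by (simp add: range_case_nat)
    qed
    then have "solutions M 1 \<phi>' ?bs = (\<lambda>x. [x]) ` {x \<in> U. P (case_nat x e)}"
      by (auto simp: solutions_def tuples_def length_Suc_conv)
    moreover have inj: "inj_on (\<lambda>x. [x]) {x \<in> U. P (case_nat x e)}" by (auto intro: inj_onI)
    ultimately have "finite (solutions M 1 \<phi>' ?bs) \<longleftrightarrow> finite {x \<in> U. P (case_nat x e)}"
      "card (solutions M 1 \<phi>' ?bs) = card {x \<in> U. P (case_nat x e)}"
      by (simp_all only: card_image[OF inj] finite_image_iff[OF inj])
    then show ?thesis using N[OF bs] by (simp only:)
  qed
  then show ?thesis by blast
qed

text \<open>Given the uniform bound \<open>N\<close>, an infinite fibre is one with at least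
  \<open>N + 1\<close> points.\<close>

lemma dpred_infinite:
  assumes "dpred A P" "A \<subseteq> U"
  shows "dpred A (\<lambda>e. infinite {x \<in> U. P (case_nat x e)})"
proof -
  obtain N where N: "\<And>e. range e \<subseteq> U \<Longrightarrow>
      infinite {x \<in> U. P (case_nat x e)} \<or> card {x \<in> U. P (case_nat x e)} \<le> N"
    using finite_fibre_bound[OF assms] by blast
  have "infinite {x \<in> U. P (case_nat x e)} \<longleftrightarrow> atleast (Suc N) {x \<in> U. P (case_nat x e)}"
    if "range e \<subseteq> U" for e
    using N[OF that] by (auto simp: atleast_iff)
  then show ?thesis
    by (rule dpred_cong[THEN iffD2, OF _ dpred_atleast[OF assms(1), of "Suc N"]])
qed

lemma dpred_dimge:
  assumes "dpred A P" "A \<subseteq> U"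
  shows "dpred A (\<lambda>e. dimge n k {w \<in> tuples M n. P (app w e)})"
  using assms(1)
proof (induction n arbitrary: P k)
  case 0
  have "dimge 0 k {w \<in> tuples M 0. P (app w e)} \<longleftrightarrow> k = 0 \<and> P e" for e
    by (simp add: tuples_def)
  then show ?case using dpred_conj[OF dpred_const[of A "k = 0"] 0] by simp
next
  case (Suc n)
  let ?W = "\<lambda>x e. {w \<in> tuples M n. P (app w (case_nat x e))}"
  have *: "{w. w @ [x] \<in> {w \<in> tuples M (Suc n). P (app w e)}} = ?W x e" if "x \<in> U" for x e
    using that by (auto simp: tuples_def app_snoc)
  have "dimge (Suc n) k {w \<in> tuples M (Suc n). P (app w e)} \<longleftrightarrow>
      (\<exists>x\<in>U. dimge n k (?W x e)) \<or> (0 < k \<and> infinite {x \<in> U. dimge n (k - 1) (?W x e)})" for e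
  proof -
    have "{x \<in> U. dimge n (k - 1) {w. w @ [x] \<in> {w \<in> tuples M (Suc n). P (app w e)}}} =
        {x \<in> U. dimge n (k - 1) (?W x e)}"
      by (intro Collect_cong conj_cong refl) (simp only: *)
    then show ?thesis by (simp only: dimge.simps * cong: bex_cong)
  qed
  then show ?case
    using dpred_disj[OF dpred_ex[OF Suc.IH[OF Suc.prems, of k]]
        dpred_conj[OF dpred_const[of A "0 < k"] dpred_infinite[OF Suc.IH[OF Suc.prems, of "k - 1"] assms(2)]]]
    by simp
qed

section \<open>Algebraic closure, saturation and small sets\<close>

lemma in_cl_finite:
  assumes "C \<subseteq> U" "dpred C (\<lambda>e. e 0 \<in> S)" "S \<subseteq> U" "finite S" "x \<in> S"
  shows "x \<in> cl C"
proof -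
  have *: "map e [0..<1] \<in> (\<lambda>x. [x]) ` S \<longleftrightarrow> e 0 \<in> S" for e by auto
  have "definable L M C 1 ((\<lambda>x. [x]) ` S)"
    unfolding definable_iff_dpred[OF assms(1)] *
    using assms by (auto simp: tuples_def)
  then show ?thesis using assms unfolding acl_def by auto
qed

text \<open>Saturation realises the type saying that \<open>x\<close> lies in \<open>S\<close> and
  in no finite set definable over \<open>C\<close>. Finitely many such exclusions remove finitely
  many points, and \<open>S\<close> is infinite.\<close>

lemma infinite_not_cl:
  assumes "small M C" "dpred C (\<lambda>e. e 0 \<in> S)" "S \<subseteq> U" "infinite S"
  shows "\<exists>x\<in>S. x \<notin> cl C"
proof -
  have C: "C \<subseteq> U" using assms(1) by (simp add: small_def)
  have *: "map e [0..<1] \<in> (\<lambda>x. [x]) ` S \<longleftrightarrow> e 0 \<in> S" for e by auto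
  have "definable L M C 1 ((\<lambda>x. [x]) ` S)"
    unfolding definable_iff_dpred[OF C] *
    using assms by (auto simp: tuples_def)
  then obtain \<phi> bs where \<phi>: "set bs \<subseteq> C" "\<phi> \<in> formulas L (1 + length bs)"
    "(\<lambda>x. [x]) ` S = solutions M 1 \<phi> bs" unfolding definable_def by blast
  let ?q = "{(Neg \<psi>, cs) | \<psi> cs. set cs \<subseteq> C \<and> \<psi> \<in> formulas L (1 + length cs) \<and> finite (solutions M 1 \<psi> cs)}"
  let ?p = "insert (\<phi>, bs) ?q"
  have neg: "solutions M 1 (Neg \<psi>) cs = tuples M 1 - solutions M 1 \<psi> cs" for \<psi> cs
    by (auto simp: solutions_def)
  have fin: "\<exists>as\<in>tuples M 1. \<forall>(\<phi>, bs)\<in>q. as \<in> solutions M 1 \<phi> bs" if q: "q \<subseteq> ?p" "finite q" for q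
  proof -
    \<comment> \<open>The pair \<open>(\<phi>, bs)\<close> may itself be one of the negations; it is
      left out because membership in \<open>S\<close> already gives it.\<close>
    let ?bad = "\<Union>(\<psi>, cs)\<in>q - {(\<phi>, bs)}. tuples M 1 - solutions M 1 \<psi> cs"
    have "finite ?bad"
    proof (rule finite_UN_I)
      show "finite (q - {(\<phi>, bs)})" using q by simp
      fix r assume "r \<in> q - {(\<phi>, bs)}"
      then obtain \<psi> cs where r: "r = (Neg \<psi>, cs)" "finite (solutions M 1 \<psi> cs)" using q by blast
      have "tuples M 1 - solutions M 1 (Neg \<psi>) cs \<subseteq> solutions M 1 \<psi> cs" unfolding neg by blast
      then show "finite (case r of (\<psi>, cs) \<Rightarrow> tuples M 1 - solutions M 1 \<psi> cs)"
        using r finite_subset by auto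
    qed
    moreover have "infinite ((\<lambda>x. [x]) ` S)" using assms(4) by (simp add: finite_image_iff inj_on_def)
    ultimately have "(\<lambda>x. [x]) ` S - ?bad \<noteq> {}" by (metis Diff_infinite_finite finite.emptyI)
    then obtain as where as: "as \<in> (\<lambda>x. [x]) ` S" "as \<notin> ?bad" by blast
    have "as \<in> tuples M 1" using as assms(3) by (auto simp: tuples_def)
    moreover have "as \<in> solutions M 1 \<psi> cs" if "(\<psi>, cs) \<in> q" for \<psi> cs
      using that as \<phi>(3) calculation by (cases "(\<psi>, cs) = (\<phi>, bs)") auto
    ultimately show ?thesis by blast
  qed
  have "\<forall>(\<phi>, bs)\<in>?p. set bs \<subseteq> C \<and> \<phi> \<in> formulas L (1 + length bs)"
    using \<phi> by (auto simp: formulas_def)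
  then obtain as where as: "as \<in> tuples M 1" "\<forall>(\<phi>, bs)\<in>?p. as \<in> solutions M 1 \<phi> bs"
    using saturated[unfolded saturated_def, rule_format, of C ?p 1] assms(1) fin by blast
  have "as \<in> (\<lambda>x. [x]) ` S" unfolding \<phi>(3) using as(2) by blast
  then obtain x where x: "as = [x]" "x \<in> S" by blast
  have "x \<notin> cl C"
  proof
    assume "x \<in> cl C"
    then obtain \<psi> cs where "set cs \<subseteq> C" "\<psi> \<in> formulas L (1 + length cs)"
      "finite (solutions M 1 \<psi> cs)" "[x] \<in> solutions M 1 \<psi> cs"
      unfolding acl_def definable_def by blast
    moreover from this have "as \<in> solutions M 1 (Neg \<psi>) cs" using as(2) by blast
    ultimately show False using x(1) unfolding neg by blast
  qed
  then show ?thesis using x(2) by blast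
qed

lemma small_finite_Un:
  assumes "infinite U" "small M C" "finite D" "D \<subseteq> U"
  shows "small M (C \<union> D)"
proof (cases "finite C")
  case True
  then have "finite (C \<union> D)" using assms by simp
  then show ?thesis using assms unfolding small_def
    by (metis Un_least finite_lesspoll_infinite)
next
  case False
  have "C \<union> D \<approx> C"
    using assms(3)
  proof (induction D rule: finite_induct)
    case (insert x F)
    have "C \<union> insert x F \<approx> C \<union> F"
      using infinite_insert_eqpoll[of "C \<union> F" x] False by simp
    then show ?case using insert eqpoll_trans by blast
  qed auto
  then show ?thesis using assms unfolding small_def
    by (metis Un_least lesspoll_eq_trans eq_lesspoll_trans)
qed

end

locale infinite_geometric_structure = geometric_structure +
  assumes infinite_U: "infinite U"
begin

text \<open>By additivity, \<open>w\<close> followed by \<open>x\<close> has the dimension of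
  \<open>x\<close> over \<open>C\<close> plus that of \<open>w\<close> over \<open>C\<close> and
  \<open>x\<close>. The points \<open>x\<close> whose fibre has dimension at least
  \<open>k - 1\<close> form a set definable over \<open>C\<close>; it is infinite exactly when it
  has a point outside the closure of \<open>C\<close>, one direction being saturation. The base
  grows by \<open>x\<close> in the induction, so smallness must be preserved.\<close>

lemma dimge_iff:
  assumes "small M C" "W \<subseteq> tuples M n" "dpred C (\<lambda>e. map e [0..<n] \<in> W)"
  shows "dimge n k W \<longleftrightarrow> (\<exists>w\<in>W. k \<le> ldim cl C w)"
  using assms
proof (induction n arbitrary: C W k)
  case 0
  then show ?case by (auto simp: tuples_def)
next
  case (Suc n)
  have C: "C \<subseteq> U" using Suc.prems(1) by (simp add: small_def)
  let ?W = "\<lambda>x. {w. w @ [x] \<in> W}"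
  have W: "?W x \<subseteq> tuples M n" for x using Suc.prems(2) by (force simp: tuples_def)
  have IH: "dimge n j (?W x) \<longleftrightarrow> (\<exists>w\<in>?W x. j \<le> ldim cl (insert x C) w)" if x: "x \<in> U" for x j
  proof (rule Suc.IH)
    show "small M (insert x C)"
      using small_finite_Un[OF infinite_U Suc.prems(1), of "{x}"] x by simp
    let ?\<tau> = "\<lambda>i. if i < n then Inr i else Inl x"
    have "dpred (insert x C) (\<lambda>e. map e [0..<Suc n] \<in> W)"
      using Suc.prems(3) by (rule dpred_mono) auto
    then have "dpred (insert x C) (\<lambda>e. map (inst ?\<tau> e) [0..<Suc n] \<in> W)"
      by (rule dpred_subst) (use C x in \<open>auto simp: over_def\<close>)
    moreover have "map (inst ?\<tau> e) [0..<Suc n] = map e [0..<n] @ [x]" for e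
      by (auto simp: inst_def)
    ultimately show "dpred (insert x C) (\<lambda>e. map e [0..<n] \<in> ?W x)"
      by (simp only: mem_Collect_eq)
  qed (rule W)
  have D: "dpred C (\<lambda>e. e 0 \<in> {x \<in> U. dimge n j (?W x)})" for j
  proof -
    have "{w \<in> tuples M n. map (app w e) [0..<Suc n] \<in> W} = ?W (e 0)" for e
    proof -
      have "map (app w e) [0..<Suc n] = w @ [e 0]" if "w \<in> tuples M n" for w
        using that map_app[of w e] by (auto simp: tuples_def app_def)
      then show ?thesis using W[of "e 0"] by fastforce
    qed
    with dpred_dimge[OF Suc.prems(3) C, of n j]
    have "dpred C (\<lambda>e. dimge n j (?W (e 0)))" by simp
    then show ?thesis by (rule dpred_cong[THEN iffD1, rotated]) auto
  qed
  have ldim_snoc: "ldim cl C (w @ [x]) = (if x \<in> cl C then 0 else 1) + ldim cl (insert x C) w"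
    if "w @ [x] \<in> W" for w x
    using ldim_commute[of C w "[x]"] that Suc.prems(2) C by (auto simp: tuples_def)
  show ?case
  proof
    assume "dimge (Suc n) k W"
    then consider x where "x \<in> U" "dimge n k (?W x)"
      | "0 < k" "infinite {x \<in> U. dimge n (k - 1) (?W x)}" by auto
    then show "\<exists>w\<in>W. k \<le> ldim cl C w"
    proof cases
      case 1
      then obtain w where "w @ [x] \<in> W" "k \<le> ldim cl (insert x C) w" using IH by auto
      then show ?thesis using ldim_snoc by (intro bexI[of _ "w @ [x]"]) auto
    next
      case 2
      obtain x where x: "x \<in> U" "dimge n (k - 1) (?W x)" "x \<notin> cl C"
        using infinite_not_cl[OF Suc.prems(1) D _ 2(2)] by auto
      then obtain w where "w @ [x] \<in> W" "k - 1 \<le> ldim cl (insert x C) w" using IH by auto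
      then show ?thesis using ldim_snoc x(3) by (intro bexI[of _ "w @ [x]"]) auto
    qed
  next
    assume "\<exists>w\<in>W. k \<le> ldim cl C w"
    then obtain v where v: "v \<in> W" "k \<le> ldim cl C v" by blast
    then have "length v = Suc n" using Suc.prems(2) by (auto simp: tuples_def)
    then obtain w x where "v = w @ [x]" by (cases v rule: rev_cases) auto
    then have w: "w @ [x] \<in> W" "k \<le> ldim cl C (w @ [x])" using v by auto
    have x: "x \<in> U" using w Suc.prems(2) by (auto simp: tuples_def)
    show "dimge (Suc n) k W"
    proof (cases "k \<le> ldim cl (insert x C) w")
      case True
      then have "dimge n k (?W x)" using IH[OF x] w(1) by auto
      then show ?thesis using x by auto
    next
      case False
      then have k: "0 < k" "x \<notin> cl C" "k - 1 \<le> ldim cl (insert x C) w"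
        using w ldim_snoc[OF w(1)] by (auto split: if_splits)
      then have "x \<in> {x \<in> U. dimge n (k - 1) (?W x)}" using IH[OF x] w(1) x by auto
      then have "infinite {x \<in> U. dimge n (k - 1) (?W x)}"
        using in_cl_finite[OF C D] k(2) by blast
      then show ?thesis using k(1) by simp
    qed
  qed
qed

end

section \<open>Definable predicates on sequences of tuples\<close>

text \<open>The Tarski-Vaught argument, one variable of \<open>J\<close> at a time.\<close>

lemma sat_elementary_witness:
  assumes "elementary_substructure L M A" "finite J" "wf_fm L \<phi>"
    and "range e \<subseteq> univ M" "\<And>i. i \<notin> J \<Longrightarrow> e i \<in> A" "sat M e \<phi>"
  shows "\<exists>e'. range e' \<subseteq> A \<and> (\<forall>i. i \<notin> J \<longrightarrow> e' i = e i) \<and> sat M e' \<phi>"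
  using assms(2-)
proof (induction J arbitrary: \<phi> e rule: finite_induct)
  case empty
  then show ?case by (intro exI[of _ e]) auto
next
  case (insert j J)
  \<comment> \<open>\<open>a\<close> is a placeholder for entry \<open>j\<close>, which
    \<open>Ex j\<close> binds below.\<close>
  obtain a where a: "a \<in> A"
    using assms(1) by (auto simp: elementary_substructure_def is_structure_def)
  have A: "A \<subseteq> univ M" using assms(1) by (simp add: elementary_substructure_def)
  have "\<exists>e'. range e' \<subseteq> A \<and> (\<forall>i. i \<notin> J \<longrightarrow> e' i = (e(j := a)) i) \<and> sat M e' (Ex j \<phi>)"
  proof (rule insert.IH)
    show "sat M (e(j := a)) (Ex j \<phi>)"
      using insert.prems(2,4) by (auto intro!: bexI[of _ "e j"])
  qed (use a A insert.prems in auto)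
  then obtain e' where e': "range e' \<subseteq> A" "\<And>i. i \<notin> J \<Longrightarrow> e' i = (e(j := a)) i" "sat M e' (Ex j \<phi>)"
    by blast
  then have "sat (M\<lparr>univ := A\<rparr>) e' (Ex j \<phi>)"
    using assms(1) insert.prems(1) unfolding elementary_substructure_def by (metis wf_fm.simps(5))
  then obtain b where b: "b \<in> A" "sat (M\<lparr>univ := A\<rparr>) (e'(j := b)) \<phi>" by auto
  have r: "range (e'(j := b)) \<subseteq> A" using e'(1) b(1) by auto
  then have "sat M (e'(j := b)) \<phi>"
    using assms(1) insert.prems(1) b(2) unfolding elementary_substructure_def by metis
  then show ?case using r e'(2)
    by (intro exI[of _ "e'(j := b)"] conjI) (auto simp del: fun_upd_apply simp: fun_upd_other)
qed

text \<open>Parameters must stay fixed while the entries move into \<open>A\<close>. Variables for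
  entries go to even positions and those for parameters to odd ones; \<open>J\<close> holds the
  finitely many even positions that occur.\<close>

lemma (in fo_structure) dpred_elementary_witness:
  assumes "elementary_substructure L M A" "dpred A P" "range e \<subseteq> U" "P e"
  shows "\<exists>e'. range e' \<subseteq> A \<and> P e'"
proof -
  have A: "A \<subseteq> U" using assms(1) by (simp add: elementary_substructure_def)
  obtain a where a: "a \<in> A"
    using assms(1) by (auto simp: elementary_substructure_def is_structure_def)
  obtain \<phi> \<sigma> where 1: "wf_fm L \<phi>" "over A \<sigma>" "\<And>e. range e \<subseteq> U \<Longrightarrow> P e = sat M (inst \<sigma> e) \<phi>"
    using assms(2) by (rule dpredE) blast
  define f where "f i = (case \<sigma> i of Inl _ \<Rightarrow> 2 * i + 1 | Inr j \<Rightarrow> 2 * j)" for i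
  obtain \<phi>' where 2: "wf_fm L \<phi>'" "\<And>e. sat M e \<phi>' \<longleftrightarrow> sat M (e \<circ> f) \<phi>"
    using rename_fm[of L \<phi> f] 1(1) by blast
  define J where "J = {p \<in> f ` fv \<phi>. even p}"
  define v where "v p = (if even p then if p \<in> J then e (p div 2) else a
    else case \<sigma> (p div 2) of Inl b \<Rightarrow> b | Inr _ \<Rightarrow> a)" for p
  have "\<exists>v'. range v' \<subseteq> A \<and> (\<forall>p. p \<notin> J \<longrightarrow> v' p = v p) \<and> sat M v' \<phi>'"
  proof (rule sat_elementary_witness[OF assms(1) _ 2(1)])
    show "finite J" by (simp add: J_def)
    show out: "v p \<in> A" if "p \<notin> J" for p
      using that a 1(2) by (auto simp: v_def over_def split: sum.splits)
    show "range v \<subseteq> U"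
    proof
      fix x assume "x \<in> range v"
      then obtain p where p: "x = v p" by blast
      then show "x \<in> U"
        using out[of p] A assms(3) by (cases "p \<in> J") (auto simp: v_def J_def)
    qed
    have "sat M (v \<circ> f) \<phi> \<longleftrightarrow> sat M (inst \<sigma> e) \<phi>"
    proof (rule sat_cong)
      fix i assume "i \<in> fv \<phi>"
      then show "(v \<circ> f) i = inst \<sigma> e i"
        by (cases "\<sigma> i") (auto simp: v_def f_def J_def inst_def intro: rev_image_eqI)
    qed
    then show "sat M v \<phi>'" using 1(3)[OF assms(3)] assms(4) 2(2) by simp
  qed
  then obtain v' where v': "range v' \<subseteq> A" "\<And>p. p \<notin> J \<Longrightarrow> v' p = v p" "sat M v' \<phi>'" by blast
  have r: "range (\<lambda>j. v' (2 * j)) \<subseteq> A" using v'(1) by auto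
  have "sat M (v' \<circ> f) \<phi> \<longleftrightarrow> sat M (inst \<sigma> (\<lambda>j. v' (2 * j))) \<phi>"
  proof (rule sat_cong)
    fix i
    show "(v' \<circ> f) i = inst \<sigma> (\<lambda>j. v' (2 * j)) i"
      by (cases "\<sigma> i") (auto simp: f_def inst_def v'(2) J_def v_def)
  qed
  then have "P (\<lambda>j. v' (2 * j))" using 1(3)[of "\<lambda>j. v' (2 * j)"] v'(3) 2(2) r A by auto
  then show ?thesis using r by blast
qed

section \<open>Assignments read as sequences of \<open>n\<close>-tuples\<close>

definition slice :: "nat \<Rightarrow> (nat \<Rightarrow> 'a) \<Rightarrow> nat \<Rightarrow> 'a list" where
  "slice n e i = map e [i * n..<i * n + n]"

lemma length_slice [simp]: "length (slice n e i) = n"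
  by (simp add: slice_def)

lemma nth_slice [simp]: "r < n \<Longrightarrow> slice n e i ! r = e (i * n + r)"
  by (simp add: slice_def)

lemma slice_app:
  assumes "length w = n"
  shows "slice n (app w e) 0 = w" "slice n (app w e) (Suc i) = slice n e i"
proof -
  show "slice n (app w e) 0 = w"
    by (rule nth_equalityI) (simp_all add: assms app_def)
  show "slice n (app w e) (Suc i) = slice n e i"
    by (rule nth_equalityI) (simp_all add: assms app_def add.assoc)
qed

lemma concat_slice: "concat (map (slice n e) [0..<m]) = map e [0..<m * n]"
proof (induction m)
  case (Suc m)
  have "[0..<m * n + n] = [0..<m * n] @ [m * n..<m * n + n]" by (rule upt_add_eq_append) simp
  then show ?case using Suc by (simp add: slice_def add.commute)
qed simp

lemma slice_surj:
  assumes "\<And>i. length (E i) = n"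
  shows "0 < n \<Longrightarrow> slice n (\<lambda>p. E (p div n) ! (p mod n)) = E"
  using assms by (intro ext nth_equalityI) auto

locale tuple_structure = geometric_structure L M
  for L :: "('f, 'r) lang" and M :: "('f, 'r, 'u) struct" +
  fixes n :: nat
begin

abbreviation "T \<equiv> tuples M n"

definition tp :: "'u set \<Rightarrow> ((nat \<Rightarrow> 'u list) \<Rightarrow> bool) \<Rightarrow> bool" where
  "tp A P \<longleftrightarrow> dpred A (\<lambda>e. P (slice n e))"

lemma slice_T: "range e \<subseteq> U \<Longrightarrow> slice n e i \<in> T"
  by (auto simp: tuples_def slice_def)

lemma tp_cong: "(\<And>E. (\<And>i. E i \<in> T) \<Longrightarrow> P E = Q E) \<Longrightarrow> tp A P \<longleftrightarrow> tp A Q"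
  unfolding tp_def by (rule dpred_cong) (simp add: slice_T)

lemma tp_congI: "tp A P \<Longrightarrow> (\<And>E. (\<And>i. E i \<in> T) \<Longrightarrow> P E = Q E) \<Longrightarrow> tp A Q"
  using tp_cong[of P Q A] by simp

lemma tp_mono: "tp A P \<Longrightarrow> A \<subseteq> B \<Longrightarrow> tp B P"
  unfolding tp_def by (rule dpred_mono)

lemma tp_neg: "tp A P \<Longrightarrow> tp A (\<lambda>E. \<not> P E)"
  unfolding tp_def by (rule dpred_neg)

lemma tp_conj: "tp A P \<Longrightarrow> tp A Q \<Longrightarrow> tp A (\<lambda>E. P E \<and> Q E)"
  unfolding tp_def by (rule dpred_conj)

lemma tp_disj: "tp A P \<Longrightarrow> tp A Q \<Longrightarrow> tp A (\<lambda>E. P E \<or> Q E)"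
  unfolding tp_def by (rule dpred_disj)

lemma tp_imp: "tp A P \<Longrightarrow> tp A Q \<Longrightarrow> tp A (\<lambda>E. P E \<longrightarrow> Q E)"
  unfolding imp_conv_disj by (intro tp_disj tp_neg)

lemma tp_iff: "tp A P \<Longrightarrow> tp A Q \<Longrightarrow> tp A (\<lambda>E. P E \<longleftrightarrow> Q E)"
  unfolding iff_conv_conj_imp by (intro tp_conj tp_imp)

lemma tp_const: "tp A (\<lambda>E. b)"
  unfolding tp_def by (rule dpred_const)

lemma tp_ex:
  assumes "tp A (\<lambda>E. P (E 0) (\<lambda>i. E (Suc i)))"
  shows "tp A (\<lambda>E. \<exists>w\<in>T. P w E)"
proof -
  have "(\<exists>w\<in>T. P (slice n (app w e) 0) (\<lambda>i. slice n (app w e) (Suc i))) \<longleftrightarrow> (\<exists>w\<in>T. P w (slice n e))" for e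
    by (rule bex_cong) (auto simp: tuples_def slice_app)
  then show ?thesis using dpred_exs[OF assms[unfolded tp_def], of n] by (simp add: tp_def)
qed

lemma tp_all:
  assumes "tp A (\<lambda>E. P (E 0) (\<lambda>i. E (Suc i)))"
  shows "tp A (\<lambda>E. \<forall>w\<in>T. P w E)"
  using tp_neg[OF tp_ex[of A "\<lambda>w E. \<not> P w E", OF tp_neg[OF assms]]] by simp

lemma tp_dimge:
  assumes "tp A (\<lambda>E. P (E 0) (\<lambda>i. E (Suc i)))" "A \<subseteq> U"
  shows "tp A (\<lambda>E. dimge n k {w \<in> T. P w E})"
proof -
  have "{w \<in> T. P (slice n (app w e) 0) (\<lambda>i. slice n (app w e) (Suc i))} = {w \<in> T. P w (slice n e)}" for e
    by (auto simp: tuples_def slice_app)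
  then show ?thesis using dpred_dimge[OF assms(1)[unfolded tp_def] assms(2), of n k] by (simp add: tp_def)
qed

text \<open>Only variables and constant tuples are terms; values of the partial maps are named by
  quantifying over their graphs.\<close>

definition tm :: "'u set \<Rightarrow> ((nat \<Rightarrow> 'u list) \<Rightarrow> 'u list) \<Rightarrow> bool" where
  "tm A t \<longleftrightarrow> (\<exists>i. t = (\<lambda>E. E i)) \<or> (\<exists>c. t = (\<lambda>E. c) \<and> c \<in> T \<and> set c \<subseteq> A)"

lemma tm_var: "tm A (\<lambda>E. E i)"
  unfolding tm_def by blast

lemma tm_const: "c \<in> T \<Longrightarrow> set c \<subseteq> A \<Longrightarrow> tm A (\<lambda>E. c)"
  unfolding tm_def by blast

lemma tp_terms:
  assumes "tp A P" "\<And>i. tm A (ts i)" "A \<subseteq> U"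
  shows "tp A (\<lambda>E. P (\<lambda>i. ts i E))"
\<comment> \<open>Positions are located by \<open>div n\<close> and \<open>mod n\<close>, which
  needs \<open>n > 0\<close>; for \<open>n = 0\<close> every block is the empty list.\<close>
proof (cases "n = 0")
  case True
  have "ts i E = []" if "\<And>i. E i \<in> T" for i E
  proof -
    have "ts i E \<in> T" using assms(2)[of i] that unfolding tm_def by (elim disjE exE) auto
    then show ?thesis using True by (simp add: tuples_def)
  qed
  then have "(\<lambda>i. ts i E) = E" if "\<And>i. E i \<in> T" for E
    using that True by (auto simp: tuples_def)
  then have "tp A (\<lambda>E. P (\<lambda>i. ts i E)) \<longleftrightarrow> tp A P" by (intro tp_cong) simp
  then show ?thesis using assms(1) by simp
next
  case False
  define var where "var i \<longleftrightarrow> (\<exists>j. ts i = (\<lambda>E. E j))" for i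
  define idx where "idx i = (SOME j. ts i = (\<lambda>E. E j))" for i
  have var: "ts i = (\<lambda>E. E (idx i))" if "var i" for i
    using that someI_ex[of "\<lambda>j. ts i = (\<lambda>E. E j)"] by (simp add: var_def idx_def)
  define con where "con i = (SOME c. ts i = (\<lambda>E. c) \<and> c \<in> T \<and> set c \<subseteq> A)" for i
  have con: "ts i = (\<lambda>E. con i)" "con i \<in> T" "set (con i) \<subseteq> A" if "\<not> var i" for i
    using that assms(2)[of i] someI_ex[of "\<lambda>c. ts i = (\<lambda>E. c) \<and> c \<in> T \<and> set c \<subseteq> A"]
    unfolding var_def tm_def con_def by blast+
  define \<sigma> where "\<sigma> p = (if var (p div n) then Inr (idx (p div n) * n + p mod n)
    else Inl (con (p div n) ! (p mod n)))" for p
  have "over A \<sigma>"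
    using con(2,3) False by (fastforce simp: over_def \<sigma>_def tuples_def split: if_splits)
  then have "dpred A (\<lambda>e. P (slice n (inst \<sigma> e)))"
    by (intro dpred_subst assms(1)[unfolded tp_def] assms(3))
  moreover have "slice n (inst \<sigma> e) i = ts i (slice n e)" for e i
  proof (cases "var i")
    case True
    then show ?thesis using var[OF True] False
      by (auto intro!: nth_equalityI simp: inst_def \<sigma>_def)
  next
    case nv: False
    then have len: "length (con i) = n" using con(2) by (simp add: tuples_def)
    have "slice n (inst \<sigma> e) i = con i"
      by (rule nth_equalityI) (use nv in \<open>simp_all add: len inst_def \<sigma>_def\<close>)
    then show ?thesis using con(1)[OF nv] by simp
  qed
  then have "slice n (inst \<sigma> e) = (\<lambda>i. ts i (slice n e))" for e by blast
  ultimately show ?thesis by (simp add: tp_def)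
qed

lemma tp_terms1:
  assumes "tp A (\<lambda>E. R (E 0))" "A \<subseteq> U" "tm A t"
  shows "tp A (\<lambda>E. R (t E))"
  using tp_terms[OF assms(1) _ assms(2), of "\<lambda>_. t"] assms(3) by simp

lemma tp_terms2:
  assumes "tp A (\<lambda>E. R (E 0) (E 1))" "A \<subseteq> U" "tm A t" "tm A s"
  shows "tp A (\<lambda>E. R (t E) (s E))"
  using tp_terms[OF assms(1) _ assms(2), of "\<lambda>i. if i = 0 then t else s"] assms(3,4) by simp

lemma tp_terms3:
  assumes "tp A (\<lambda>E. R (E 0) (E 1) (E 2))" "A \<subseteq> U" "tm A t" "tm A s" "tm A r"
  shows "tp A (\<lambda>E. R (t E) (s E) (r E))"
  using tp_terms[OF assms(1) _ assms(2), of "\<lambda>i. if i = 0 then t else if i = 1 then s else r"] assms(3-)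
  by simp

lemma definable_iff_tp:
  assumes "A \<subseteq> U"
  shows "definable L M A (m * n) W \<longleftrightarrow> W \<subseteq> tuples M (m * n) \<and> tp A (\<lambda>E. concat (map E [0..<m]) \<in> W)"
  unfolding definable_iff_dpred[OF assms] tp_def concat_slice ..

lemma tp_eq:
  assumes "A \<subseteq> U" "tm A t" "tm A s"
  shows "tp A (\<lambda>E. t E = s E)"
proof (rule tp_terms2[OF _ assms])
  have "dpred A (\<lambda>e. \<forall>r<k. e r = e (n + r))" for k
  proof (induction k)
    case (Suc k)
    have "dpred A (\<lambda>e. (\<forall>r<k. e r = e (n + r)) \<and> e k = e (n + k))"
      by (intro dpred_conj Suc dpred_eq)
    then show ?case by (rule dpred_cong[THEN iffD1, rotated]) (auto simp: less_Suc_eq)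
  qed (simp add: dpred_const)
  moreover have "slice n e 0 = slice n e 1 \<longleftrightarrow> (\<forall>r<n. e r = e (n + r))" for e :: "nat \<Rightarrow> 'u"
    by (simp add: list_eq_iff_nth_eq)
  ultimately show "tp A (\<lambda>E. E 0 = E 1)" by (simp add: tp_def)
qed

text \<open>Each coordinate of the only solution is itself the only point of a set definable over
  \<open>C\<close>, hence algebraic over \<open>C\<close>. This is how points are shown to depend on
  one another below.\<close>

lemma tp_unique_acl:
  assumes "tp C (\<lambda>E. R (E 0))" "C \<subseteq> U" "c \<in> T" "R c" "\<And>c'. c' \<in> T \<Longrightarrow> R c' \<Longrightarrow> c' = c"
  shows "set c \<subseteq> cl C"
proof
  fix x assume "x \<in> set c"
  then obtain i where i: "i < n" "x = c ! i" using assms(3) by (auto simp: in_set_conv_nth tuples_def)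
  \<comment> \<open>Entries \<open>0, ..., n - 1\<close> hold the solution, and entry
    \<open>n\<close> is the free variable compared with coordinate \<open>i\<close>.\<close>
  have "dpred C (\<lambda>e. R (slice n e 0) \<and> e i = e n)"
    by (intro dpred_conj dpred_eq) (use assms(1) in \<open>simp add: tp_def\<close>)
  from dpred_exs[OF this, of n]
  have "dpred C (\<lambda>e. \<exists>w\<in>T. R (slice n (app w e) 0) \<and> app w e i = app w e n)" .
  moreover have "(\<exists>w\<in>T. R (slice n (app w e) 0) \<and> app w e i = app w e n) \<longleftrightarrow> e 0 \<in> {x}" for e
  proof
    assume "\<exists>w\<in>T. R (slice n (app w e) 0) \<and> app w e i = app w e n"
    then obtain w where "w \<in> T" "R (slice n (app w e) 0)" "app w e i = app w e n" by blast
    then show "e 0 \<in> {x}"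
      using assms(5)[of w] i by (auto simp: tuples_def slice_app app_def)
  next
    assume "e 0 \<in> {x}"
    then show "\<exists>w\<in>T. R (slice n (app w e) 0) \<and> app w e i = app w e n"
      using assms(3,4) i by (intro bexI[of _ c]) (auto simp: tuples_def slice_app app_def)
  qed
  ultimately have "dpred C (\<lambda>e. e 0 \<in> {x})" by simp
  then show "x \<in> cl C"
    by (rule in_cl_finite[OF assms(2)]) (use \<open>x \<in> set c\<close> assms(3) in \<open>auto simp: tuples_def\<close>)
qed

lemma tp_elementary_witness:
  assumes "elementary_substructure L M A" "tp A P" "\<And>i. E i \<in> T" "P E"
  shows "\<exists>E'. (\<forall>i. E' i \<in> T \<and> set (E' i) \<subseteq> A) \<and> P E'"
proof -
  have A: "A \<subseteq> U" using assms(1) by (simp add: elementary_substructure_def)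
  obtain u where u: "u \<in> U" using U_nonempty by blast
  define e where "e p = (if n = 0 then u else E (p div n) ! (p mod n))" for p
  have len: "length (E i) = n" for i using assms(3) by (simp add: tuples_def)
  have "slice n e = E"
  proof (cases "n = 0")
    case True
    then have "slice n e i = E i" for i using len[of i] by (simp add: slice_def)
    then show ?thesis by blast
  next
    case False
    then show ?thesis using slice_surj[OF len] unfolding e_def by simp
  qed
  moreover have "range e \<subseteq> U"
  proof
    fix x assume "x \<in> range e"
    then obtain p where p: "x = e p" by blast
    show "x \<in> U"
      using u assms(3)[of "p div n"] unfolding p e_def tuples_def
      by (cases "n = 0") (auto intro!: subsetD[of "set (E (p div n))" U])
  qed
  ultimately obtain e' where e': "range e' \<subseteq> A" "P (slice n e')"
    using dpred_elementary_witness[OF assms(1) assms(2)[unfolded tp_def], of e] assms(4) by auto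
  moreover have "slice n e' i \<in> T" "set (slice n e' i) \<subseteq> A" for i
    using slice_T[of e' i] e'(1) A by (auto simp: slice_def)
  ultimately show ?thesis by blast
qed

end

section \<open>The group of germs of translations\<close>

context geometric_structure
begin

lemma set_dim_eqI:
  assumes "C \<subseteq> U" "Y \<subseteq> tuples M m" "\<And>a. a \<in> Y \<Longrightarrow> ldim cl C a \<le> k" "a \<in> Y" "ldim cl C a = k"
  shows "set_dim L M C Y = int k"
proof -
  have eq: "tuple_dim L M C a = ldim cl C a" if "a \<in> Y" for a
    using tuple_dim_eq[OF assms(1)] that assms(2) by (auto simp: tuples_def)
  have "Max ((\<lambda>a. int (tuple_dim L M C a)) ` Y) = int k"
  proof (rule Max_eqI)
    show "finite ((\<lambda>a. int (tuple_dim L M C a)) ` Y)"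
      by (rule finite_subset[of _ "int ` {..k}"]) (use assms(3) eq in auto)
  qed (use assms(3-5) eq in \<open>auto intro!: image_eqI[of _ _ a]\<close>)
  then show ?thesis using assms(4) by (auto simp: set_dim_def)
qed

lemma set_dim_attained:
  assumes "C \<subseteq> U" "Y \<subseteq> tuples M m" "Y \<noteq> {}"
  obtains a where "a \<in> Y" "set_dim L M C Y = int (ldim cl C a)" "\<And>b. b \<in> Y \<Longrightarrow> ldim cl C b \<le> ldim cl C a"
proof -
  have "finite (ldim cl C ` Y)"
    by (rule finite_subset[of _ "{..m}"])
      (use assms(2) ldim_le_length[of cl C] in \<open>force simp: tuples_def\<close>, simp)
  then obtain a where a: "a \<in> Y" "\<And>b. b \<in> Y \<Longrightarrow> ldim cl C b \<le> ldim cl C a"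
    using assms(3) Max_in[of "ldim cl C ` Y"] Max_ge[of "ldim cl C ` Y"] by fastforce
  then show ?thesis using that set_dim_eqI[OF assms(1,2) a(2) a(1)] by simp
qed

end

locale germ_group = tuple_structure L M n + infinite_geometric_structure L M
  for L :: "('f, 'r) lang" and M :: "('f, 'r, 'u) struct" and n :: nat +
  fixes A :: "'u set" and X :: "'u list set"
    and F :: "'u list \<Rightarrow> 'u list \<Rightarrow> 'u list option" and g :: "'u list \<Rightarrow> 'u list option"
  assumes small_A: "small M A" and gen_group: "gen_defined_group L M A n X F g"
begin

lemma A_subset: "A \<subseteq> U"
  using small_A by (simp add: small_def)

lemma X_definable: "definable L M A n X" and F_definable: "definable_pfun2 L M A n X F"
  and g_definable: "definable_pfun1 L M A n X n X g" and X_nonempty: "X \<noteq> {}"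
  using gen_group by (simp_all add: gen_defined_group_def)

lemma X_T: "x \<in> X \<Longrightarrow> x \<in> T"
  using X_definable definable_iff_dpred[OF A_subset] by auto

lemma X_U: "x \<in> X \<Longrightarrow> set x \<subseteq> U"
  using X_T by (auto simp: tuples_def)

lemma F_X: "F a b = Some c \<Longrightarrow> a \<in> X \<and> b \<in> X \<and> c \<in> X"
  using F_definable by (simp add: definable_pfun2_def)

lemma g_X: "g a = Some b \<Longrightarrow> a \<in> X \<and> b \<in> X"
  using g_definable by (simp add: definable_pfun1_def)

section \<open>Generic points over varying parameter sets\<close>

definition d :: nat where "d = nat (set_dim L M A X)"

text \<open>The number \<open>d\<close> is fixed once, at the base \<open>A\<close>, while
  \<open>C\<close> varies. Dimension can only drop over larger bases, so over any \<open>C\<close>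
  containing \<open>A\<close> no point of \<open>X\<close> exceeds \<open>d\<close>.\<close>

definition gen :: "'u set \<Rightarrow> 'u list \<Rightarrow> bool" where
  "gen C a \<longleftrightarrow> a \<in> X \<and> ldim cl C a = d"

definition ok :: "'u set \<Rightarrow> bool" where
  "ok C \<longleftrightarrow> A \<subseteq> C \<and> small M C"

lemma okD: "ok C \<Longrightarrow> A \<subseteq> C" "ok C \<Longrightarrow> C \<subseteq> U" "ok C \<Longrightarrow> small M C"
  by (auto simp: ok_def small_def)

lemma ok_A [simp]: "ok A"
  by (simp add: ok_def small_A)

lemma ok_Un: "ok C \<Longrightarrow> finite D \<Longrightarrow> D \<subseteq> U \<Longrightarrow> ok (C \<union> D)"
  using small_finite_Un[OF infinite_U] by (auto simp: ok_def)

lemma ok_Un_set: "ok C \<Longrightarrow> x \<in> X \<Longrightarrow> ok (C \<union> set x)"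
  by (rule ok_Un) (auto dest: X_U)

lemma X_sub_T: "X \<subseteq> T"
  using X_T by blast

lemma set_dim_X: "set_dim L M A X = int d"
  by (rule set_dim_attained[OF A_subset X_sub_T X_nonempty]) (simp add: d_def)

lemma ldim_le_d: "A \<subseteq> C \<Longrightarrow> C \<subseteq> U \<Longrightarrow> a \<in> X \<Longrightarrow> ldim cl C a \<le> d"
  using ldim_mono[of A C a] X_U[of a]
  by (rule_tac set_dim_attained[OF A_subset X_sub_T X_nonempty]) (fastforce simp: d_def)

lemma gen_mono: "gen D a \<Longrightarrow> A \<subseteq> C \<Longrightarrow> C \<subseteq> D \<Longrightarrow> D \<subseteq> U \<Longrightarrow> gen C a"
  using ldim_mono[of C D a] ldim_le_d[of C a] X_U[of a] by (force simp: gen_def)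

text \<open>\<open>b\<close> has at least the dimension of \<open>a\<close>, which is already
  maximal.\<close>

lemma gen_transfer:
  assumes "gen C a" "ok C" "b \<in> X" "set a \<subseteq> cl (C \<union> set b)"
  shows "gen C b"
  using assms ldim_le[of C b a] ldim_le_d[of C b] X_U[of b] okD[OF assms(2)]
  by (auto simp: gen_def)

lemma gen_cl:
  assumes "gen C a" "ok C" "set c \<subseteq> cl C"
  shows "gen (C \<union> set c) a"
proof -
  have c: "set c \<subseteq> U" using assms(3) cl_subset okD(2)[OF assms(2)] by blast
  have "cl (C \<union> set c) = cl C"
    by (rule cl_eqI) (use assms c okD(2)[OF assms(2)] cl_incl[of C] cl_incl[of "C \<union> set c"] in auto)
  then show ?thesis
    using assms(1) ldim_cl_cong[of "C \<union> set c" C a] c okD(2)[OF assms(2)] X_U by (auto simp: gen_def)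
qed

text \<open>Additivity of the dimension of the pair, computed in both orders.\<close>

lemma gen_sym:
  assumes "gen C a" "gen (C \<union> set a) b" "ok C"
  shows "gen (C \<union> set b) a"
proof -
  have "set a \<subseteq> U" "set b \<subseteq> U" using assms X_U by (auto simp: gen_def)
  then have "ldim cl C (a @ b) = ldim cl C (b @ a)" using ldim_commute okD(2)[OF assms(3)] by blast
  moreover have "gen C b" by (rule gen_mono[OF assms(2)]) (use okD[OF assms(3)] \<open>set a \<subseteq> U\<close> in auto)
  ultimately show ?thesis using assms by (auto simp: gen_def ldim_append)
qed

lemma gen_X: "gen C a \<Longrightarrow> a \<in> X"
  by (simp add: gen_def)

section \<open>Definability of \<open>X\<close>, \<open>F\<close>, \<open>g\<close> and algebraic
  dependence of their values\<close>

lemma tp_X: "A \<subseteq> C \<Longrightarrow> C \<subseteq> U \<Longrightarrow> tm C t \<Longrightarrow> tp C (\<lambda>E. t E \<in> X)"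
proof (rule tp_terms1)
  assume "A \<subseteq> C"
  have "tp A (\<lambda>E. E 0 \<in> X)"
    using X_definable definable_iff_tp[OF A_subset, of 1 X] by simp
  then show "tp C (\<lambda>E. E 0 \<in> X)" using \<open>A \<subseteq> C\<close> by (rule tp_mono)
qed

lemma tp_F:
  assumes "A \<subseteq> C" "C \<subseteq> U" "tm C t" "tm C s" "tm C r"
  shows "tp C (\<lambda>E. F (t E) (s E) = Some (r E))"
proof (rule tp_terms3[OF _ assms(2-)])
  have "definable L M A (3 * n) {a @ b @ c | a b c. F a b = Some c}"
    using F_definable by (simp add: definable_pfun2_def numeral_3_eq_3 add.assoc)
  then have concat: "tp A (\<lambda>E. concat (map E [0..<3]) \<in> {a @ b @ c | a b c. F a b = Some c})"
    using definable_iff_tp[OF A_subset] by blast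
  have eq: "concat (map E [0..<3]) \<in> {a @ b @ c | a b c. F a b = Some c} \<longleftrightarrow> F (E 0) (E 1) = Some (E 2)"
    if "\<And>i. E i \<in> T" for E
  proof -
    have "E 0 @ E 1 @ E 2 = a @ b @ c \<longleftrightarrow> E 0 = a \<and> E 1 = b \<and> E 2 = c" if "F a b = Some c" for a b c
      using \<open>\<And>i. E i \<in> T\<close> F_X[OF that] X_T by (auto simp: tuples_def)
    then show ?thesis by (auto simp: numeral_3_eq_3 numeral_2_eq_2)
  qed
  have "tp A (\<lambda>E. F (E 0) (E 1) = Some (E 2))" using concat by (rule tp_congI) (rule eq)
  then show "tp C (\<lambda>E. F (E 0) (E 1) = Some (E 2))" using assms(1) by (rule tp_mono)
qed

lemma tp_g:
  assumes "A \<subseteq> C" "C \<subseteq> U" "tm C t" "tm C s"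
  shows "tp C (\<lambda>E. g (t E) = Some (s E))"
proof (rule tp_terms2[OF _ assms(2-)])
  have "definable L M A (2 * n) {a @ b | a b. g a = Some b}"
    using g_definable by (simp add: definable_pfun1_def mult_2)
  then have concat: "tp A (\<lambda>E. concat (map E [0..<2]) \<in> {a @ b | a b. g a = Some b})"
    using definable_iff_tp[OF A_subset] by blast
  have eq: "concat (map E [0..<2]) \<in> {a @ b | a b. g a = Some b} \<longleftrightarrow> g (E 0) = Some (E 1)"
    if "\<And>i. E i \<in> T" for E
  proof -
    have "E 0 @ E 1 = a @ b \<longleftrightarrow> E 0 = a \<and> E 1 = b" if "g a = Some b" for a b
      using \<open>\<And>i. E i \<in> T\<close> g_X[OF that] X_T by (auto simp: tuples_def)
    then show ?thesis by (auto simp: numeral_2_eq_2)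
  qed
  have "tp A (\<lambda>E. g (E 0) = Some (E 1))" using concat by (rule tp_congI) (rule eq)
  then show "tp C (\<lambda>E. g (E 0) = Some (E 1))" using assms(1) by (rule tp_mono)
qed

lemma F_cl:
  assumes "F a b = Some c" "A \<subseteq> C" "C \<subseteq> U"
  shows "set c \<subseteq> cl (C \<union> set a \<union> set b)"
proof (rule tp_unique_acl[of _ "\<lambda>c. F a b = Some c"])
  note X = F_X[OF assms(1)]
  show U: "C \<union> set a \<union> set b \<subseteq> U" using assms X X_U by blast
  show "tp (C \<union> set a \<union> set b) (\<lambda>E. F a b = Some (E 0))"
    by (intro tp_F tm_const tm_var U) (use X X_T assms in auto)
qed (use assms F_X X_T in auto)

lemma g_cl:
  assumes "g a = Some b" "A \<subseteq> C" "C \<subseteq> U"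
  shows "set b \<subseteq> cl (C \<union> set a)"
proof (rule tp_unique_acl[of _ "\<lambda>b. g a = Some b"])
  note X = g_X[OF assms(1)]
  show U: "C \<union> set a \<subseteq> U" using assms X X_U by blast
  show "tp (C \<union> set a) (\<lambda>E. g a = Some (E 0))"
    by (intro tp_g tm_const tm_var U) (use X X_T assms in auto)
qed (use assms g_X X_T in auto)

text \<open>Serves to recover a factor: if \<open>c\<close> is the product of \<open>a\<close> and
  \<open>w\<close>, then \<open>w = F x c\<close> with \<open>x = g a\<close>.\<close>

lemma F_g_cl:
  assumes "F x c = Some w" "g a = Some x" "A \<subseteq> C" "C \<subseteq> U"
  shows "set w \<subseteq> cl (C \<union> set a \<union> set c)"
proof -
  have U: "C \<union> set a \<union> set c \<subseteq> U" using assms F_X g_X X_U by blast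
  have "set x \<subseteq> cl (C \<union> set a)" using g_cl assms by blast
  also have "\<dots> \<subseteq> cl (C \<union> set a \<union> set c)" by (rule cl_mono) (use U in auto)
  finally have "C \<union> set x \<union> set c \<subseteq> cl (C \<union> set a \<union> set c)"
    using cl_incl[OF U] by auto
  then show ?thesis using F_cl[OF assms(1,3,4)] cl_least[OF _ U] by blast
qed

text \<open>The quantifier ``for all generic points of \<open>X\<close>'', in a form that preserves definability.\<close>

definition gall :: "('u list \<Rightarrow> bool) \<Rightarrow> bool" where
  "gall Q \<longleftrightarrow> \<not> dimge n d {w \<in> T. w \<in> X \<and> \<not> Q w}"

lemma tp_gall:
  assumes "A \<subseteq> C" "C \<subseteq> U" "tp C (\<lambda>E. Q (E 0) (\<lambda>i. E (Suc i)))"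
  shows "tp C (\<lambda>E. gall (\<lambda>w. Q w E))"
  unfolding gall_def
  by (intro tp_neg tp_dimge tp_conj tp_X tm_var assms)

text \<open>The failure set is definable over \<open>C\<close>, so dimension at least
  \<open>d\<close> means having a point generic over \<open>C\<close>. The left side does not
  mention \<open>C\<close>: the same condition may be read over any good base that contains its
  parameters.\<close>

lemma gall_iff:
  assumes "ok C" "tp C (\<lambda>E. Q (E 0))"
  shows "gall Q \<longleftrightarrow> (\<forall>w. gen C w \<longrightarrow> Q w)"
proof -
  have "tp C (\<lambda>E. E 0 \<in> X \<and> \<not> Q (E 0))"
    by (intro tp_conj tp_neg tp_X tm_var okD assms)
  then have "tp C (\<lambda>E. E 0 \<in> {w \<in> T. w \<in> X \<and> \<not> Q w})" by (rule tp_congI) simp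
  then have "dpred C (\<lambda>e. map e [0..<n] \<in> {w \<in> T. w \<in> X \<and> \<not> Q w})"
    by (simp add: tp_def slice_def)
  from dimge_iff[OF okD(3)[OF assms(1)] _ this, of d]
  have "dimge n d {w \<in> T. w \<in> X \<and> \<not> Q w} \<longleftrightarrow> (\<exists>w. w \<in> X \<and> \<not> Q w \<and> d \<le> ldim cl C w)"
    using X_T by auto
  then show ?thesis
    using ldim_le_d[OF okD(1,2)[OF assms(1)]] by (auto simp: gall_def gen_def) (metis order_antisym)
qed

text \<open>A generic point over \<open>A\<close> refutes \<open>gall\<close> of the false
  predicate; this does not depend on the base, so there is one over \<open>C\<close> as
  well.\<close>

lemma gen_ex:
  assumes "ok C" shows "\<exists>w. gen C w"
proof -
  obtain a where "gen A a"
    using set_dim_attained[OF A_subset X_sub_T X_nonempty] set_dim_X by (metis gen_def of_nat_eq_iff)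
  then have "\<not> gall (\<lambda>_. False)" using gall_iff[OF ok_A, of "\<lambda>_. False"] tp_const by blast
  then show ?thesis using gall_iff[OF assms, of "\<lambda>_. False"] tp_const by blast
qed

lemma generics_eq: "gen A a \<longleftrightarrow> a \<in> generics L M A X"
  using tuple_dim_eq[OF A_subset] X_U set_dim_X by (auto simp: gen_def generics_def)

text \<open>Independence of generic points is stated here and below as genericity of each over
  \<open>A\<close> and its predecessors, a form that iterates.\<close>

lemma F_gen:
  assumes "gen A a" "gen (A \<union> set a) b"
  shows "\<exists>c a' b'. F a b = Some c \<and> g a = Some a' \<and> gen A a' \<and> g b = Some b' \<and> F a' c = Some b \<and> F c b' = Some a"
proof -
  have X: "a \<in> X" "b \<in> X" using assms by (auto simp: gen_def)
  have b: "gen A b" by (rule gen_mono[OF assms(2)]) (use X_U[OF X(1)] A_subset in auto)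
  have "independent_tuples L M A [a, b]"
    using tuple_dim_eq[OF A_subset, of a] tuple_dim_eq[OF A_subset, of b] tuple_dim_eq[OF A_subset, of "a @ b"]
      X_U[OF X(1)] X_U[OF X(2)] assms b by (simp add: independent_tuples_def ldim_append gen_def)
  then show ?thesis
    using gen_group assms(1) b unfolding gen_defined_group_def generics_eq by blast
qed

lemma assoc_gen:
  assumes "gen A a" "gen (A \<union> set a) b" "gen (A \<union> set a \<union> set b) c"
  shows "\<exists>ab bc e. F a b = Some ab \<and> F b c = Some bc \<and> F ab c = Some e \<and> F a bc = Some e"
proof -
  have X: "a \<in> X" "b \<in> X" "c \<in> X" using assms by (auto simp: gen_def)
  have b: "gen A b" by (rule gen_mono[OF assms(2)]) (use X_U[OF X(1)] A_subset in auto)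
  have c: "gen A c" by (rule gen_mono[OF assms(3)]) (use X_U[OF X(1)] X_U[OF X(2)] A_subset in auto)
  have "independent_tuples L M A [a, b, c]"
    using tuple_dim_eq[OF A_subset, of a] tuple_dim_eq[OF A_subset, of b] tuple_dim_eq[OF A_subset, of c]
      tuple_dim_eq[OF A_subset, of "a @ b @ c"] X_U[OF X(1)] X_U[OF X(2)] X_U[OF X(3)] assms b c
    by (simp add: independent_tuples_def ldim_append gen_def)
  then show ?thesis
    using gen_group assms(1) b c unfolding gen_defined_group_def generics_eq by blast
qed

text \<open>\<open>X0\<close> is an \<open>A\<close>-definable set containing the generics over \<open>A\<close> whose elements all act by left
  translation on generic points, injectively and compatibly with \<open>F\<close>.\<close>

definition good :: "'u list \<Rightarrow> 'u list \<Rightarrow> bool" where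
  "good x w \<longleftrightarrow> (\<exists>c\<in>T. F x w = Some c \<and>
     (\<exists>x'\<in>T. g x = Some x' \<and> F x' c = Some w) \<and> (\<exists>w'\<in>T. g w = Some w' \<and> F c w' = Some x) \<and>
     gall (\<lambda>z. \<exists>y\<in>T. \<exists>v\<in>T. F w z = Some y \<and> F x y = Some v \<and> F c z = Some v))"

definition X0 :: "'u list set" where
  "X0 = {x \<in> X. gall (good x)}"

lemma tp_good:
  assumes "A \<subseteq> C" "C \<subseteq> U" "tm C t" "tm C s"
  shows "tp C (\<lambda>E. good (t E) (s E))"
proof (rule tp_terms2[OF _ assms(2-)])
  show "tp C (\<lambda>E. good (E 0) (E 1))"
    unfolding good_def by (intro tp_ex tp_conj tp_F tp_g tp_gall tm_var assms)
qed

lemma tp_X0: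
  assumes "A \<subseteq> C" "C \<subseteq> U" "tm C t"
  shows "tp C (\<lambda>E. t E \<in> X0)"
proof (rule tp_terms1[OF _ assms(2-)])
  show "tp C (\<lambda>E. E 0 \<in> X0)"
    unfolding X0_def mem_Collect_eq by (intro tp_conj tp_X tp_gall tp_good tm_var assms)
qed

lemma X0_X: "x \<in> X0 \<Longrightarrow> x \<in> X"
  by (simp add: X0_def)

lemma gen_X0:
  assumes "gen A a" shows "a \<in> X0"
proof -
  have X: "a \<in> X" using assms gen_X by blast
  have ok: "ok (A \<union> set a)" by (rule ok_Un_set[OF ok_A X])
  have "good a w" if w: "gen (A \<union> set a) w" for w
  proof -
    have wX: "w \<in> X" using w gen_X by blast
    obtain c a' w' where c: "F a w = Some c" "g a = Some a'" "g w = Some w'" "F a' c = Some w" "F c w' = Some a"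
      using F_gen[OF assms w] by blast
    have XT: "a \<in> T" "w \<in> T" "c \<in> T" "a' \<in> T" "w' \<in> T" using c F_X g_X X_T by blast+
    have cX: "c \<in> X" using c F_X by blast
    \<comment> \<open>The identity for \<open>z\<close> mentions \<open>a\<close>, \<open>w\<close>
      and \<open>c\<close>, so \<open>gall\<close> is read over a base containing all three.\<close>
    let ?C = "A \<union> set a \<union> set w \<union> set c"
    have okC: "ok ?C" by (intro ok_Un_set ok_A X wX cX)
    have "gall (\<lambda>z. \<exists>y\<in>T. \<exists>v\<in>T. F w z = Some y \<and> F a y = Some v \<and> F c z = Some v)"
    proof (subst gall_iff[OF okC], goal_cases)
      case 1
      show ?case by (intro tp_ex tp_conj tp_F tm_var tm_const XT okD[OF okC]) auto
    next
      case 2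
      have "\<exists>y\<in>T. \<exists>v\<in>T. F w z = Some y \<and> F a y = Some v \<and> F c z = Some v" if "gen ?C z" for z
      proof -
        have "gen (A \<union> set a \<union> set w) z"
          by (rule gen_mono[OF that]) (use okD[OF okC] in auto)
        then show ?thesis using assoc_gen[OF assms w] c(1) F_X X_T by (metis option.inject)
      qed
      then show ?case by blast
    qed
    then show ?thesis unfolding good_def using c XT by blast
  qed
  moreover have "tp (A \<union> set a) (\<lambda>E. good a (E 0))"
    by (intro tp_good tm_const tm_var okD[OF ok]) (use X_T[OF X] in auto)
  ultimately have "gall (good a)" using gall_iff[OF ok] by blast
  then show ?thesis using X by (simp add: X0_def)
qed

text \<open>Words over \<open>X0\<close> act on generic points by composing left translations; \<open>equ\<close> says that two
  words have the same germ. Since \<open>D\<close> may be enlarged, transitivity needs no definability.\<close>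

primrec act :: "'u list list \<Rightarrow> 'u list \<Rightarrow> 'u list option" where
  "act [] w = Some w"
| "act (x # u) w = Option.bind (act u w) (F x)"

lemma act_append: "act (u @ v) w = Option.bind (act v w) (act u)"
  by (induction u) (auto simp: Option.bind_assoc)

definition equ :: "'u list list \<Rightarrow> 'u list list \<Rightarrow> bool" where
  "equ u v \<longleftrightarrow> (\<exists>D. finite D \<and> D \<subseteq> U \<and> (\<forall>w. gen (A \<union> D) w \<longrightarrow> act u w = act v w))"

lemma equ_refl [simp]: "equ u u"
  by (auto simp: equ_def)

lemma equ_sym: "equ u v \<Longrightarrow> equ v u"
  by (force simp: equ_def)

lemma equ_trans [trans]:
  assumes "equ u v" "equ v w" shows "equ u w"
proof -
  obtain D D' where *: "finite D" "D \<subseteq> U" "\<And>w. gen (A \<union> D) w \<Longrightarrow> act u w = act v w"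
    "finite D'" "D' \<subseteq> U" "\<And>x. gen (A \<union> D') x \<Longrightarrow> act v x = act w x"
    using assms unfolding equ_def by blast
  have "gen (A \<union> D) x \<and> gen (A \<union> D') x" if "gen (A \<union> (D \<union> D')) x" for x
    using that A_subset * by (intro conjI gen_mono[OF that]) auto
  then show ?thesis unfolding equ_def using * by (intro exI[of _ "D \<union> D'"]) auto
qed

text \<open>\<open>w\<close> is algebraic over \<open>C\<close> and \<open>c\<close>, because
  \<open>g x\<close> undoes the translation; so \<open>c\<close> inherits genericity from
  \<open>w\<close>. The last clause turns a value of \<open>F\<close> into an equality of
  germs.\<close>

lemma X0_act:
  assumes "x \<in> X0" "ok C" "set x \<subseteq> C" "gen C w"
  shows "\<exists>c. F x w = Some c \<and> gen C c \<and> (\<exists>w'. g w = Some w' \<and> F c w' = Some x) \<and> equ [x, w] [c]"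
proof -
  have X: "x \<in> X" "w \<in> X" using assms X0_X gen_X by blast+
  have "tp C (\<lambda>E. good x (E 0))"
    by (intro tp_good tm_const tm_var okD[OF assms(2)]) (use X_T[OF X(1)] assms(3) in auto)
  then have "good x w" using assms gall_iff[OF assms(2), of "good x"] by (auto simp: X0_def)
  then obtain c x' w' where c: "F x w = Some c" "g x = Some x'" "F x' c = Some w" "g w = Some w'" "F c w' = Some x"
    "gall (\<lambda>z. \<exists>y\<in>T. \<exists>v\<in>T. F w z = Some y \<and> F x y = Some v \<and> F c z = Some v)"
    unfolding good_def by blast
  have cX: "c \<in> X" using c F_X by blast
  have XT: "x \<in> T" "w \<in> T" "c \<in> T" using X cX X_T by blast+
  have "set w \<subseteq> cl (C \<union> set x \<union> set c)" by (rule F_g_cl[OF c(3,2) okD(1,2)[OF assms(2)]])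
  then have "gen C c"
    using gen_transfer[OF assms(4,2) cX] assms(3) by (simp add: Un_absorb2)
  moreover have "equ [x, w] [c]"
  proof -
    let ?D = "set x \<union> set w \<union> set c"
    have okD': "ok (A \<union> ?D)" by (rule ok_Un) (use X cX X_U in auto)
    have "tp (A \<union> ?D) (\<lambda>E. \<exists>y\<in>T. \<exists>v\<in>T. F w (E 0) = Some y \<and> F x y = Some v \<and> F c (E 0) = Some v)"
      by (intro tp_ex tp_conj tp_F tm_var tm_const XT okD[OF okD']) auto
    from gall_iff[OF okD' this] have "\<forall>z. gen (A \<union> ?D) z \<longrightarrow> (\<exists>y\<in>T. \<exists>v\<in>T. F w z = Some y \<and> F x y = Some v \<and> F c z = Some v)"
      using c(6) by blast
    then have "act [x, w] z = act [c] z" if "gen (A \<union> ?D) z" for z using that by fastforce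
    then show ?thesis unfolding equ_def using X cX X_U by (intro exI[of _ ?D]) auto
  qed
  ultimately show ?thesis using c by blast
qed

section \<open>Compatibility of germs with concatenation, and faithfulness\<close>

definition params :: "'u list list \<Rightarrow> 'u set" where
  "params u = (\<Union>x\<in>set u. set x)"

lemma params_simps [simp]: "params [] = {}" "params (x # u) = set x \<union> params u"
  "params (u @ v) = params u \<union> params v"
  by (auto simp: params_def)

lemma params: "set u \<subseteq> X0 \<Longrightarrow> finite (params u) \<and> params u \<subseteq> U"
  using X0_X X_U by (fastforce simp: params_def)

lemma act_gen:
  assumes "set u \<subseteq> X0" "ok C" "params u \<subseteq> C" "gen C w"
  shows "\<exists>c. act u w = Some c \<and> gen C c"
  using assms(1,3)
proof (induction u)
  case (Cons x u)
  then obtain c where "act u w = Some c" "gen C c" by auto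
  then show ?case using X0_act[OF _ assms(2), of x c] Cons.prems by auto
qed (use assms in auto)

lemma equ_append_left: "equ u u' \<Longrightarrow> equ (v @ u) (v @ u')"
  unfolding equ_def act_append by metis

text \<open>After \<open>v\<close> has acted, the result is still generic over \<open>D\<close>,
  where \<open>u\<close> and \<open>u'\<close> agree.\<close>

lemma equ_append_right:
  assumes "equ u u'" "set v \<subseteq> X0"
  shows "equ (u @ v) (u' @ v)"
proof -
  obtain D where D: "finite D" "D \<subseteq> U" "\<And>w. gen (A \<union> D) w \<Longrightarrow> act u w = act u' w"
    using assms(1) unfolding equ_def by blast
  let ?D = "D \<union> params v"
  have ok: "ok (A \<union> ?D)" by (rule ok_Un) (use D params[OF assms(2)] in auto)
  have "act (u @ v) w = act (u' @ v) w" if w: "gen (A \<union> ?D) w" for w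
  proof -
    obtain c where c: "act v w = Some c" "gen (A \<union> ?D) c"
      using act_gen[OF assms(2) ok _ w] by auto
    have "gen (A \<union> D) c" by (rule gen_mono[OF c(2)]) (use okD[OF ok] in auto)
    then show ?thesis using D(3) c(1) by (simp add: act_append)
  qed
  then show ?thesis unfolding equ_def using D params[OF assms(2)] by (intro exI[of _ ?D]) auto
qed

lemma equ_append: "equ u u' \<Longrightarrow> equ v v' \<Longrightarrow> set v \<subseteq> X0 \<Longrightarrow> equ (u @ v) (u' @ v')"
  using equ_append_left equ_append_right equ_trans by blast

lemma equ_mid: "equ u u' \<Longrightarrow> set w \<subseteq> X0 \<Longrightarrow> equ (v @ u @ w) (v @ u' @ w)"
  by (intro equ_append_left equ_append_right)

text \<open>One generic \<open>w\<close> decides: if both points send \<open>w\<close> to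
  \<open>c\<close>, both are equal to \<open>F c (g w)\<close>.\<close>

lemma X0_inj:
  assumes "x \<in> X0" "y \<in> X0" "equ [x] [y]" shows "x = y"
proof -
  obtain D where D: "finite D" "D \<subseteq> U" "\<And>w. gen (A \<union> D) w \<Longrightarrow> act [x] w = act [y] w"
    using assms(3) unfolding equ_def by blast
  let ?C = "A \<union> (D \<union> params [x, y])"
  have ok: "ok ?C" by (rule ok_Un) (use D params[of "[x, y]"] assms in auto)
  obtain w where w: "gen ?C w" using gen_ex[OF ok] by blast
  have "gen (A \<union> D) w" by (rule gen_mono[OF w]) (use okD[OF ok] in auto)
  then have "F x w = F y w" using D(3) by simp
  moreover obtain c w' where "F x w = Some c" "g w = Some w'" "F c w' = Some x"
    using X0_act[OF assms(1) ok _ w] by auto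
  moreover obtain c' w'' where "F y w = Some c'" "g w = Some w''" "F c' w'' = Some y"
    using X0_act[OF assms(2) ok _ w] by auto
  ultimately show ?thesis by simp
qed

lemma g_gen:
  assumes "gen A a"
  shows "\<exists>a'. g a = Some a' \<and> gen A a' \<and> equ [a', a] []"
proof -
  have ok: "ok (A \<union> set a)" by (rule ok_Un_set[OF ok_A gen_X[OF assms]])
  obtain w where "gen (A \<union> set a) w" using gen_ex[OF ok] by blast
  then obtain a' where a': "g a = Some a'" "gen A a'" using F_gen[OF assms] by blast
  have "act [a', a] w = act [] w" if "gen (A \<union> set a) w" for w
    using F_gen[OF assms that] a' by auto
  then show ?thesis using a' X_U[OF gen_X[OF assms]] unfolding equ_def
    by (intro exI[of _ a'] conjI exI[of _ "set a"]) auto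
qed

text \<open>As in a group, \<open>a'' = a'' a' a = a\<close> for germs, and faithfulness turns this
  into equality of points.\<close>

lemma g_involutive:
  assumes "gen A a" "g a = Some a'" shows "g a' = Some a"
proof -
  have a': "gen A a'" "equ [a', a] []" using g_gen[OF assms(1)] assms(2) by auto
  obtain a'' where a'': "g a' = Some a''" "gen A a''" "equ [a'', a'] []" using g_gen[OF a'(1)] by blast
  have X0: "a \<in> X0" "a' \<in> X0" "a'' \<in> X0" using assms(1) a' a'' gen_X0 by auto
  have "equ [a''] ([a''] @ [a', a])" using equ_append_left[OF equ_sym[OF a'(2)], of "[a'']"] by simp
  also have "equ ([a''] @ [a', a]) [a]" using equ_append_right[OF a''(3), of "[a]"] X0 by simp
  finally show ?thesis using X0_inj X0 a''(1) by blast
qed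

lemma g_inverse:
  assumes "gen C a" "ok C"
  shows "\<exists>a'. g a = Some a' \<and> gen C a' \<and> equ [a', a] [] \<and> equ [a, a'] []"
proof -
  have a: "gen A a" by (rule gen_mono[OF assms(1)]) (use okD[OF assms(2)] in auto)
  obtain a' where a': "g a = Some a'" "gen A a'" "equ [a', a] []" using g_gen[OF a] by blast
  have inv: "g a' = Some a" by (rule g_involutive[OF a a'(1)])
  \<comment> \<open>\<open>a\<close> is the value of \<open>g\<close> at \<open>a'\<close>, hence
    algebraic over \<open>C\<close> and \<open>a'\<close>.\<close>
  have "gen C a'"
    by (rule gen_transfer[OF assms gen_X[OF a'(2)]]) (rule g_cl[OF inv okD(1,2)[OF assms(2)]])
  moreover have "equ [a, a'] []" using g_gen[OF a'(2)] inv by auto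
  ultimately show ?thesis using a' by blast
qed

section \<open>Products with a generic factor\<close>

lemma gen_A: "gen C a \<Longrightarrow> ok C \<Longrightarrow> gen A a"
  by (rule gen_mono) (auto dest: okD)

lemma mult_left:
  assumes "x \<in> X0" "ok C" "set x \<subseteq> C" "gen C w"
  shows "\<exists>c. gen C c \<and> equ [x, w] [c]"
  using X0_act[OF assms] by blast

text \<open>Multiply by an auxiliary generic \<open>y\<close>: \<open>w x = w (x y) y\<^sup>-\<^sup>1\<close>, where now all
  products are of independent generics.\<close>

lemma mult_right:
  assumes "x \<in> X0" "ok C" "set x \<subseteq> C" "gen C w"
  shows "\<exists>c. gen C c \<and> equ [w, x] [c]"
proof -
  have wX: "w \<in> X" and wA: "gen A w" using assms gen_X gen_A by blast+
  have okw: "ok (C \<union> set w)" by (rule ok_Un_set[OF assms(2) wX])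
  obtain y where y: "gen (C \<union> set w) y" using gen_ex[OF okw] by blast
  have yX: "y \<in> X" using y gen_X by blast
  have yC: "gen C y" by (rule gen_mono[OF y]) (use okD[OF okw] okD[OF assms(2)] in auto)
  have oky: "ok (C \<union> set y)" by (rule ok_Un_set[OF assms(2) yX])
  obtain c where c: "F x y = Some c" "gen (C \<union> set w) c" "equ [x, y] [c]"
    using X0_act[OF assms(1) okw _ y] assms(3) by blast
  have cX: "c \<in> X" using c gen_X by blast
  have "set c \<subseteq> cl (C \<union> set x \<union> set y)" by (rule F_cl[OF c(1) okD(1,2)[OF assms(2)]])
  then have c_cl: "set c \<subseteq> cl (C \<union> set y)" using assms(3) by (simp add: Un_absorb2)
  \<comment> \<open>\<open>w\<close> and \<open>y\<close> are independent over \<open>C\<close>, and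
    \<open>c\<close> lies in the closure of \<open>C\<close> and \<open>y\<close>.\<close>
  have wyc: "gen (C \<union> set y \<union> set c) w"
    by (rule gen_cl[OF gen_sym[OF assms(4) y assms(2)] oky c_cl])
  have okyc: "ok (C \<union> set y \<union> set c)" by (rule ok_Un_set[OF oky cX])
  obtain v c' where v: "F w c = Some v" "g c = Some c'" "F v c' = Some w" "equ [w, c] [v]"
    using X0_act[OF gen_X0[OF wA] okw _ c(2)] by auto
  have vX: "v \<in> X" using v F_X by blast
  \<comment> \<open>\<open>v c' = w\<close> recovers \<open>w\<close> from \<open>v\<close> and
    \<open>c\<close>.\<close>
  have vyc: "gen (C \<union> set y \<union> set c) v"
  proof (rule gen_transfer[OF wyc okyc vX])
    let ?C = "C \<union> set y \<union> set c"
    have U: "?C \<union> set v \<subseteq> U" using okD[OF okyc] X_U[OF vX] by blast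
    have "set c' \<subseteq> cl (?C \<union> set c)" by (rule g_cl[OF v(2) okD(1,2)[OF okyc]])
    also have "\<dots> \<subseteq> cl (?C \<union> set v)" by (rule cl_mono) (use U in auto)
    finally have "?C \<union> set v \<union> set c' \<subseteq> cl (?C \<union> set v)" using cl_incl[OF U] by blast
    then show "set w \<subseteq> cl (?C \<union> set v)"
      using F_cl[OF v(3) okD(1,2)[OF okyc]] cl_least[OF _ U] by blast
  qed
  have vy: "gen (C \<union> set y) v" by (rule gen_mono[OF vyc]) (use okD[OF okyc] okD[OF oky] in auto)
  have vA: "gen A v" by (rule gen_A[OF vy oky])
  have okv: "ok (C \<union> set v)" by (rule ok_Un_set[OF assms(2) vX])
  \<comment> \<open>Independence of \<open>v\<close> and \<open>y\<close> makes \<open>v\<close>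
    times the inverse of \<open>y\<close> a product of independent generic points.\<close>
  have "gen (C \<union> set v) y" by (rule gen_sym[OF yC vy assms(2)])
  then obtain y' where y': "gen (C \<union> set v) y'" "equ [y, y'] []" using g_inverse[OF _ okv] by blast
  obtain u where u: "gen (C \<union> set v) u" "equ [v, y'] [u]"
    using mult_left[OF gen_X0[OF vA] okv _ y'(1)] by blast
  have X0: "w \<in> X0" "x \<in> X0" "y \<in> X0" "c \<in> X0" "y' \<in> X0"
    using wA assms(1) gen_X0 gen_A[OF yC assms(2)] gen_A[OF c(2) okw] gen_A[OF y'(1) okv] by auto
  have "equ [w, x] ([w, x] @ [y, y'])"
    using equ_append_left[OF equ_sym[OF y'(2)], of "[w, x]"] by simp
  also have "equ ([w, x] @ [y, y']) ([w] @ [c] @ [y'])"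
    using equ_mid[OF c(3), of "[y']" "[w]"] X0 by simp
  also have "equ ([w] @ [c] @ [y']) ([v] @ [y'])"
    using equ_append_right[OF v(4), of "[y']"] X0 by simp
  also have "equ ([v] @ [y']) [u]" using u(2) by simp
  finally have "equ [w, x] [u]" .
  moreover have "gen C u" by (rule gen_mono[OF u(1)]) (use okD[OF okv] okD[OF assms(2)] in auto)
  ultimately show ?thesis by blast
qed

section \<open>Inverses and cancellation of germs\<close>

text \<open>The inverse of a letter is sought as a word, not as a point of \<open>X0\<close>. With
  \<open>y\<close> generic over \<open>x\<close>, both \<open>y\<close> and \<open>c = x y\<close>
  are generic and \<open>x = c y'\<close>, so the two-letter word \<open>y c'\<close> inverts
  \<open>x\<close>.\<close>

lemma word_inverse:
  assumes "set u \<subseteq> X0"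
  shows "\<exists>v. set v \<subseteq> X0 \<and> equ (v @ u) [] \<and> equ (u @ v) []"
  using assms
proof (induction u)
  case (Cons x u)
  then obtain v where v: "set v \<subseteq> X0" "equ (v @ u) []" "equ (u @ v) []" by auto
  have x: "x \<in> X0" using Cons.prems by simp
  have ok: "ok (A \<union> set x)" by (rule ok_Un_set[OF ok_A X0_X[OF x]])
  obtain y where y: "gen (A \<union> set x) y" using gen_ex[OF ok] by blast
  obtain y' where y': "gen (A \<union> set x) y'" "equ [y, y'] []" using g_inverse[OF y ok] by blast
  obtain c where c: "gen (A \<union> set x) c" "equ [x, y] [c]" using mult_left[OF x ok _ y] by auto
  obtain c' where c': "gen (A \<union> set x) c'" "equ [c, c'] []" "equ [c', c] []" using g_inverse[OF c(1) ok] by blast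
  have X0: "y \<in> X0" "y' \<in> X0" "c \<in> X0" "c' \<in> X0"
    using y y' c c' gen_A[OF _ ok] gen_X0 by auto
  have xcy: "equ [x] [c, y']"
  proof -
    have "equ [x] ([x] @ [y, y'])" using equ_append_left[OF equ_sym[OF y'(2)], of "[x]"] by simp
    also have "equ ([x] @ [y, y']) [c, y']" using equ_append_right[OF c(2), of "[y']"] X0 by simp
    finally show ?thesis .
  qed
  have r: "equ ([x] @ [y, c']) []"
    using equ_trans[OF equ_append_right[OF c(2), of "[c']"]] c'(2) X0 by simp
  have l: "equ ([y, c'] @ [x]) []"
  proof -
    have "equ ([y, c'] @ [x]) ([y, c'] @ [c, y'])" by (rule equ_append_left[OF xcy])
    also have "equ ([y, c'] @ [c, y']) [y, y']"
      using equ_mid[OF c'(3), of "[y']" "[y]"] X0 by simp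
    also note y'(2)
    finally show ?thesis .
  qed
  have "equ ((v @ [y, c']) @ (x # u)) (v @ u)"
    using equ_mid[OF l, of u v] Cons.prems by simp
  then have 1: "equ ((v @ [y, c']) @ (x # u)) []" using v(2) by (rule equ_trans)
  have "equ ([x] @ (u @ v) @ [y, c']) ([x] @ [] @ [y, c'])"
    by (rule equ_mid[OF v(3)]) (use X0 in simp)
  then have 2: "equ ((x # u) @ (v @ [y, c'])) []" using r equ_trans by simp
  show ?case using 1 2 v(1) X0 by (intro exI[of _ "v @ [y, c']"]) auto
qed (auto intro: exI[of _ "[]"])

lemma equ_cancel_right:
  assumes "equ (u @ w) (v @ w)" "set u \<subseteq> X0" "set v \<subseteq> X0" "set w \<subseteq> X0"
  shows "equ u v"
proof -
  obtain w' where w': "set w' \<subseteq> X0" "equ (w @ w') []" using word_inverse[OF assms(4)] by blast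
  have "equ u (u @ w @ w')" using equ_append_left[OF equ_sym[OF w'(2)], of u] by simp
  also have "equ (u @ w @ w') (v @ w @ w')" using equ_append_right[OF assms(1) w'(1)] by simp
  also have "equ (v @ w @ w') v" using equ_append_left[OF w'(2), of v] by simp
  finally show ?thesis .
qed

section \<open>Covering by finitely many translates\<close>

lemma independent_generics: "\<exists>es. length es = k \<and> set es \<subseteq> {e. gen A e} \<and> ldim cl A (concat es) = k * d"
proof (induction k)
  case (Suc k)
  then obtain es where es: "length es = k" "set es \<subseteq> {e. gen A e}" "ldim cl A (concat es) = k * d" by blast
  have "set (concat es) \<subseteq> U" using es(2) gen_X X_U by fastforce
  then have ok: "ok (A \<union> set (concat es))" by (intro ok_Un) auto
  obtain e where "gen (A \<union> set (concat es)) e" using gen_ex[OF ok] by blast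
  then show ?case using es gen_A[OF _ ok]
    by (intro exI[of _ "es @ [e]"]) (auto simp: ldim_append gen_def)
qed auto

text \<open>Since \<open>ldim cl A (a @ b) \<le> 2 * n\<close>, not every member of an independent sequence of
  \<open>2 * n + 1\<close> generics can lose dimension over \<open>a, b\<close>.\<close>

lemma generic_over_pair:
  assumes es: "length es = Suc (2 * n)" "set es \<subseteq> {e. gen A e}" "ldim cl A (concat es) = Suc (2 * n) * d"
    and "a \<in> X" "b \<in> X"
  shows "\<exists>e\<in>set es. gen (A \<union> set a \<union> set b) e"
proof (rule ccontr)
  let ?C = "A \<union> set a \<union> set b"
  have ok: "ok ?C" by (intro ok_Un_set ok_A assms)
  assume "\<not> (\<exists>e\<in>set es. gen ?C e)"
  then have less: "ldim cl ?C e < d" if "e \<in> set es" for e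
    using that es(2) ldim_le_d[OF okD(1,2)[OF ok], of e] by (force simp: gen_def)
  have esU: "set (concat es) \<subseteq> U" using es(2) gen_X X_U by fastforce
  \<comment> \<open>Each member falls short of \<open>d\<close> by at least one; the loss is kept on
    the left as \<open>length fs\<close> to avoid subtraction of naturals.\<close>
  have bound: "ldim cl ?C (concat fs) + length fs \<le> length fs * d" if "set fs \<subseteq> set es" for fs
    using that
  proof (induction fs)
    case (Cons f fs)
    have fU: "set f \<subseteq> U" "set (concat fs) \<subseteq> U" using Cons.prems esU by auto
    have "ldim cl (?C \<union> set f) (concat fs) \<le> ldim cl ?C (concat fs)"
      by (rule ldim_mono) (use okD[OF ok] fU in auto)
    then show ?case using Cons less[of f] by (simp add: ldim_append)
  qed simp
  have "ldim cl A (concat es) \<le> ldim cl A ((a @ b) @ concat es)"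
    by (rule ldim_subset) (use A_subset X_U assms esU in auto)
  also have "\<dots> = ldim cl A (a @ b) + ldim cl ?C (concat es)"
    by (simp add: ldim_append Un_assoc)
  also have "\<dots> \<le> 2 * n + ldim cl ?C (concat es)"
    using ldim_le_length[of cl A "a @ b"] X_T[OF assms(4)] X_T[OF assms(5)] by (simp add: tuples_def)
  finally show False using bound[of es] es by simp
qed

text \<open>Membership in \<open>X0\<close> replaces genericity of the list, since a list inside
  \<open>A\<close> has dimension \<open>0\<close> over \<open>A\<close>; this weaker condition
  survives the descent to an elementary substructure.\<close>

definition covers :: "'u list list \<Rightarrow> bool" where
  "covers es \<longleftrightarrow> set es \<subseteq> X0 \<and> (\<forall>a\<in>X0. \<forall>b\<in>X0. \<exists>e\<in>set es. \<exists>y\<in>X0. equ [a, b] [y, e])"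

text \<open>For \<open>e\<close> generic over \<open>a, b\<close> with inverse \<open>e'\<close>,
  write \<open>a b = (a (b e')) e\<close>. Each inner product has a generic factor, so the outer
  bracket is the germ of a generic point.\<close>

lemma covers_ex: "\<exists>es. length es = Suc (2 * n) \<and> covers es"
proof -
  obtain es where es: "length es = Suc (2 * n)" "set es \<subseteq> {e. gen A e}" "ldim cl A (concat es) = Suc (2 * n) * d"
    using independent_generics by blast
  have "\<exists>e\<in>set es. \<exists>y\<in>X0. equ [a, b] [y, e]" if ab: "a \<in> X0" "b \<in> X0" for a b
  proof -
    let ?C = "A \<union> set a \<union> set b"
    have ok: "ok ?C" by (intro ok_Un_set ok_A X0_X ab)
    obtain e where e: "e \<in> set es" "gen ?C e" using generic_over_pair[OF es] ab X0_X by blast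
    obtain e' where e': "gen ?C e'" "equ [e', e] []" using g_inverse[OF e(2) ok] by blast
    obtain c where c: "gen ?C c" "equ [b, e'] [c]" using mult_left[OF ab(2) ok _ e'(1)] by auto
    obtain y where y: "gen ?C y" "equ [a, c] [y]" using mult_left[OF ab(1) ok _ c(1)] by auto
    have X0: "e \<in> X0" "y \<in> X0" using e y gen_A[OF _ ok] gen_X0 by auto
    have "equ [a, b] ([a, b] @ [e', e])"
      using equ_append_left[OF equ_sym[OF e'(2)], of "[a, b]"] by simp
    also have "equ ([a, b] @ [e', e]) ([a] @ [c] @ [e])"
      using equ_mid[OF c(2), of "[e]" "[a]"] X0 by simp
    also have "equ ([a] @ [c] @ [e]) ([y] @ [e])" using equ_append_right[OF y(2), of "[e]"] X0 by simp
    finally show ?thesis using e X0 by auto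
  qed
  then show ?thesis using es gen_X0 unfolding covers_def by blast
qed

text \<open>The definable form of \<open>equ\<close>, see \<open>geq_iff_equ\<close>.\<close>

definition geq :: "'u list list \<Rightarrow> 'u list list \<Rightarrow> bool" where
  "geq u v \<longleftrightarrow> gall (\<lambda>w. act u w = act v w)"

lemma act_T: "w \<in> T \<Longrightarrow> act u w = Some c \<Longrightarrow> c \<in> T"
  by (cases u) (auto simp: bind_eq_Some_conv dest!: F_X X_T)

lemma tm_shift: "tm C t \<Longrightarrow> tm C (\<lambda>E. t (\<lambda>i. E (Suc i)))"
  unfolding tm_def by fastforce

text \<open>Intermediate values are named by an existential quantifier, which shifts the indices in
  the remaining terms.\<close>

lemma tp_act:
  assumes "A \<subseteq> C" "C \<subseteq> U" "\<And>t. t \<in> set ts \<Longrightarrow> tm C t" "tm C t0" "tm C t1"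
  shows "tp C (\<lambda>E. act (map (\<lambda>t. t E) ts) (t0 E) = Some (t1 E))"
  using assms(3-)
proof (induction "length ts" arbitrary: ts t0 t1)
  case 0
  then show ?case using tp_eq[OF assms(2)] by simp
next
  case (Suc k)
  then obtain t ts' where ts: "ts = t # ts'" by (cases ts) auto
  let ?sh = "\<lambda>t E. t (\<lambda>i. E (Suc i)) :: 'u list"
  have "tp C (\<lambda>E. act (map (\<lambda>t. t E) (map ?sh ts')) (?sh t0 E) = Some (E 0) \<and> F (?sh t E) (E 0) = Some (?sh t1 E))"
  proof (rule tp_conj)
    show "tp C (\<lambda>E. act (map (\<lambda>t. t E) (map ?sh ts')) (?sh t0 E) = Some (E 0))"
      by (rule Suc.hyps(1)) (use Suc.hyps(2) Suc.prems ts in \<open>auto intro: tm_shift tm_var\<close>)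
    show "tp C (\<lambda>E. F (?sh t E) (E 0) = Some (?sh t1 E))"
      by (intro tp_F assms(1,2) tm_var tm_shift) (use Suc.prems ts in auto)
  qed
  then have "tp C (\<lambda>E. \<exists>v\<in>T. act (map (\<lambda>t. t E) ts') (t0 E) = Some v \<and> F (t E) v = Some (t1 E))"
    by (intro tp_ex) (simp add: comp_def)
  moreover have "(\<exists>v\<in>T. act (map (\<lambda>t. t E) ts') (t0 E) = Some v \<and> F (t E) v = Some (t1 E)) \<longleftrightarrow>
      act (map (\<lambda>t. t E) ts) (t0 E) = Some (t1 E)" for E
    by (auto simp: ts bind_eq_Some_conv dest: F_X X_T)
  ultimately show ?case by simp
qed

text \<open>Equality of optional values is stated as having the same values in \<open>T\<close>,
  which covers the undefined case.\<close>

lemma tp_geq: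
  assumes "A \<subseteq> C" "C \<subseteq> U" "\<And>t. t \<in> set ts \<Longrightarrow> tm C t" "\<And>t. t \<in> set ss \<Longrightarrow> tm C t"
  shows "tp C (\<lambda>E. geq (map (\<lambda>t. t E) ts) (map (\<lambda>t. t E) ss))"
  unfolding geq_def
proof (intro tp_gall assms(1,2))
  let ?sh = "\<lambda>t E. t (\<lambda>i. E (Suc i)) :: 'u list"
  let ?sh2 = "\<lambda>t E. t (\<lambda>i. E (Suc (Suc i))) :: 'u list"
  have sh2: "tm C (?sh2 t)" if "tm C t" for t using tm_shift[OF tm_shift[OF that]] .
  have "tp C (\<lambda>E. act (map (\<lambda>t. t E) (map ?sh2 ts)) (E 1) = Some (E 0) \<longleftrightarrow>
      act (map (\<lambda>t. t E) (map ?sh2 ss)) (E 1) = Some (E 0))"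
    by (intro tp_iff tp_act assms(1,2) tm_var) (use assms(3,4) sh2 in auto)
  then have "tp C (\<lambda>E. \<forall>c\<in>T. act (map (\<lambda>t. t E) (map ?sh ts)) (E 0) = Some c \<longleftrightarrow>
      act (map (\<lambda>t. t E) (map ?sh ss)) (E 0) = Some c)"
    by (intro tp_all) (simp add: comp_def)
  moreover have "(\<forall>c\<in>T. act u w = Some c \<longleftrightarrow> act v w = Some c) \<longleftrightarrow> act u w = act v w" if "w \<in> T" for u v w
    using act_T[OF that] by (metis option.exhaust)
  ultimately show "tp C (\<lambda>E. act (map (\<lambda>t. t (\<lambda>i. E (Suc i))) ts) (E 0) = act (map (\<lambda>t. t (\<lambda>i. E (Suc i))) ss) (E 0))"
    by (subst tp_cong[where Q = "\<lambda>E. \<forall>c\<in>T. act (map (\<lambda>t. t E) (map ?sh ts)) (E 0) = Some c \<longleftrightarrow>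
      act (map (\<lambda>t. t E) (map ?sh ss)) (E 0) = Some c"]) (simp_all add: comp_def)
qed

text \<open>\<open>gall\<close> may be read over any good base containing the parameters of both
  words: \<open>A\<close> with these parameters in one direction, a base that also contains
  \<open>D\<close> in the other.\<close>

lemma geq_iff_equ:
  assumes "set u \<subseteq> X0" "set v \<subseteq> X0"
  shows "geq u v \<longleftrightarrow> equ u v"
proof -
  have *: "geq u v \<longleftrightarrow> (\<forall>w. gen C w \<longrightarrow> act u w = act v w)" if "ok C" "params (u @ v) \<subseteq> C" for C
  proof -
    have c: "tm C (\<lambda>E. x)" if "x \<in> set (u @ v)" for x
      by (rule tm_const) (use that assms X0_X X_T \<open>params (u @ v) \<subseteq> C\<close> in \<open>auto simp: params_def\<close>)
    have cc: "tm C t" if "t \<in> set (map (\<lambda>x E. x) u) \<or> t \<in> set (map (\<lambda>x E. x) v)" for t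
      using that c by auto
    have "tp C (\<lambda>E. \<forall>c\<in>T. act u (E 0) = Some c \<longleftrightarrow> act v (E 0) = Some c)"
    proof (rule tp_all, rule tp_iff)
      show "tp C (\<lambda>E. act u (E (Suc 0)) = Some (E 0))"
        using tp_act[OF okD(1,2)[OF that(1)], of "map (\<lambda>x E. x) u" "\<lambda>E. E (Suc 0)" "\<lambda>E. E 0"] cc tm_var
        by (simp add: comp_def)
      show "tp C (\<lambda>E. act v (E (Suc 0)) = Some (E 0))"
        using tp_act[OF okD(1,2)[OF that(1)], of "map (\<lambda>x E. x) v" "\<lambda>E. E (Suc 0)" "\<lambda>E. E 0"] cc tm_var
        by (simp add: comp_def)
    qed
    moreover have "(\<forall>c\<in>T. act u w = Some c \<longleftrightarrow> act v w = Some c) \<longleftrightarrow> act u w = act v w" if "w \<in> T" for w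
      using act_T[OF that] by (metis option.exhaust)
    ultimately have "tp C (\<lambda>E. act u (E 0) = act v (E 0))"
      by (subst tp_cong[where Q = "\<lambda>E. \<forall>c\<in>T. act u (E 0) = Some c \<longleftrightarrow> act v (E 0) = Some c"]) simp_all
    then show ?thesis unfolding geq_def by (rule gall_iff[OF that(1)])
  qed
  have p: "finite (params (u @ v))" "params (u @ v) \<subseteq> U" using params[of "u @ v"] assms by auto
  show ?thesis
  proof
    assume "geq u v"
    moreover have "ok (A \<union> params (u @ v))" by (rule ok_Un[OF ok_A p])
    ultimately have "\<forall>w. gen (A \<union> params (u @ v)) w \<longrightarrow> act u w = act v w" using * by blast
    then show "equ u v" unfolding equ_def using p by blast
  next
    assume "equ u v"
    then obtain D where D: "finite D" "D \<subseteq> U" "\<And>w. gen (A \<union> D) w \<Longrightarrow> act u w = act v w"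
      unfolding equ_def by blast
    have ok: "ok (A \<union> (D \<union> params (u @ v)))" by (rule ok_Un) (use D p in auto)
    have "gen (A \<union> D) w" if "gen (A \<union> (D \<union> params (u @ v))) w" for w
      by (rule gen_mono[OF that]) (use okD[OF ok] in auto)
    then show "geq u v" using *[OF ok] D(3) by blast
  qed
qed

end

section \<open>The definable group\<close>

definition group_realization where
  "group_realization L M A n X F B m (G :: 'u list monoid) h \<longleftrightarrow>
    definable_group L M B m G \<and>
    set_dim L M B (carrier G) = set_dim L M A X \<and>
    definable_pfun1 L M B n X m (carrier G) h \<and>
    generics L M B X \<subseteq> dom h \<and>
    bij_betw (\<lambda>a. the (h a)) (generics L M B X) (generics L M B (carrier G)) \<and>
    set_dim L M B (carrier G - ran h) < set_dim L M B (carrier G) \<and>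
    (\<forall>a\<in>generics L M B X. \<forall>b\<in>generics L M B X. independent_tuples L M B [a, b] \<longrightarrow>
       (\<exists>c. F a b = Some c \<and> c \<in> dom h \<and> the (h c) = the (h a) \<otimes>\<^bsub>G\<^esub> the (h b)))"

context tuple_structure
begin

text \<open>In dimension \<open>0\<close> all points are generic and independent, so \<open>X\<close> is itself a group.
  This case is separate because \<open>M\<close> may then be finite, and adding parameters to \<open>A\<close> need not
  preserve smallness.\<close>

lemma zero_dimensional_realization:
  assumes small: "small M A" and grp: "gen_defined_group L M A n X F g" and zero: "set_dim L M A X = 0"
  shows "\<exists>m G h. group_realization L M A n X F A m G h \<and>
    (\<forall>a\<in>generics L M A X. \<exists>a'. g a = Some a' \<and> a' \<in> dom h \<and> the (h a') = inv\<^bsub>G\<^esub> (the (h a)))"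
proof -
  have A: "A \<subseteq> U" using small by (simp add: small_def)
  have X: "X \<noteq> {}" "definable L M A n X" "definable_pfun2 L M A n X F" "definable_pfun1 L M A n X n X g"
    using grp by (simp_all add: gen_defined_group_def)
  have X_sub: "X \<subseteq> T" using X(2) definable_iff_dpred[OF A] by blast
  then have XU: "set a \<subseteq> U" if "a \<in> X" for a using that by (auto simp: tuples_def)
  have dim: "ldim cl A a = 0" if "a \<in> X" for a
    by (rule set_dim_attained[OF A X_sub X(1)]) (use zero that in fastforce)
  have generic: "generics L M A X = X"
    using tuple_dim_eq[OF A] XU dim zero by (auto simp: generics_def)
  have indep: "independent_tuples L M A [a, b]" if "a \<in> X" "b \<in> X" for a b
  proof -
    have "ldim cl (A \<union> set a) b = 0"
      using ldim_mono[of A "A \<union> set a" b] A XU[OF that(1)] XU[OF that(2)] dim[OF that(2)] by simp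
    then show ?thesis
      using tuple_dim_eq[OF A, of a] tuple_dim_eq[OF A, of b] tuple_dim_eq[OF A, of "a @ b"]
        XU[OF that(1)] XU[OF that(2)] dim that by (simp add: independent_tuples_def ldim_append)
  qed
  have indep3: "independent_tuples L M A [a, b, c]" if "a \<in> X" "b \<in> X" "c \<in> X" for a b c
  proof -
    have "ldim cl (A \<union> set a) b = 0" "ldim cl (A \<union> set a \<union> set b) c = 0"
      using ldim_mono[of A "A \<union> set a" b] ldim_mono[of A "A \<union> set a \<union> set b" c]
        A XU[OF that(1)] XU[OF that(2)] XU[OF that(3)] dim[OF that(2)] dim[OF that(3)] by auto
    then show ?thesis
      using tuple_dim_eq[OF A, of a] tuple_dim_eq[OF A, of b] tuple_dim_eq[OF A, of c]
        tuple_dim_eq[OF A, of "a @ b @ c"]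
        XU[OF that(1)] XU[OF that(2)] XU[OF that(3)] dim that by (simp add: independent_tuples_def ldim_append)
  qed
  define mul where "mul a b = the (F a b)" for a b
  define iv where "iv a = the (g a)" for a
  have F: "F a b = Some (mul a b)" "mul a b \<in> X" if ab: "a \<in> X" "b \<in> X" for a b
  proof -
    obtain c where "F a b = Some c"
      using grp indep[OF ab] ab unfolding gen_defined_group_def generic by blast
    then show "F a b = Some (mul a b)" "mul a b \<in> X"
      using X(3) by (auto simp: mul_def definable_pfun2_def)
  qed
  have assoc: "mul (mul a b) c = mul a (mul b c)" if abc: "a \<in> X" "b \<in> X" "c \<in> X" for a b c
  proof -
    obtain ab bc e where "F a b = Some ab" "F b c = Some bc" "F ab c = Some e" "F a bc = Some e"
      using grp indep3[OF abc] abc unfolding gen_defined_group_def generic by blast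
    then show ?thesis by (simp add: mul_def)
  qed
  have g: "g a = Some (iv a)" "iv a \<in> X" "b \<in> X \<Longrightarrow> mul (iv a) (mul a b) = b" "b \<in> X \<Longrightarrow> mul (mul a b) (iv b) = a"
    if a: "a \<in> X" for a b
  proof -
    obtain a' where a': "a' \<in> X" "g a = Some a'"
      "\<forall>b\<in>X. independent_tuples L M A [a, b] \<longrightarrow> (\<exists>c b'. F a b = Some c \<and> g b = Some b' \<and> F a' c = Some b \<and> F c b' = Some a)"
      using grp a unfolding gen_defined_group_def generic by blast
    then show "g a = Some (iv a)" "iv a \<in> X" by (simp_all add: iv_def)
    assume b: "b \<in> X"
    obtain c b' where "F a b = Some c" "g b = Some b'" "F a' c = Some b" "F c b' = Some a"
      using a' b indep[OF a b] by blast
    then show "mul (iv a) (mul a b) = b" "mul (mul a b) (iv b) = a"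
      using a' by (simp_all add: mul_def iv_def)
  qed
  obtain x where x: "x \<in> X" using X(1) by blast
  define u where "u = mul (iv x) x"
  have u: "u \<in> X" using F g x by (simp add: u_def)
  have ul: "mul u b = b" if "b \<in> X" for b
    using assoc[of "iv x" x b] g x that by (simp add: u_def)
  have iv: "mul (iv a) a = u" if "a \<in> X" for a
  proof -
    have "mul (iv a) a \<in> X" using F g that by simp
    moreover have "mul (mul (iv a) a) b = b" if "b \<in> X" for b
      using assoc[of "iv a" a b] g \<open>a \<in> X\<close> that by simp
    \<comment> \<open>Left identities coincide: if \<open>e x = x\<close>, the inverse axiom gives
      \<open>e = (e x)(iv x) = x (iv x)\<close>, and the right side does not depend on
      \<open>e\<close>.\<close>
    ultimately show ?thesis using g(4)[of "mul (iv a) a" x] g(4)[OF u x] ul[OF x] x by metis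
  qed
  define G where "G = \<lparr>carrier = X, mult = mul, one = u\<rparr>"
  have G: "carrier G = X" "a \<otimes>\<^bsub>G\<^esub> b = mul a b" "\<one>\<^bsub>G\<^esub> = u" for a b by (simp_all add: G_def)
  have group: "group G"
  proof (rule groupI)
    show "\<exists>b\<in>carrier G. b \<otimes>\<^bsub>G\<^esub> a = \<one>\<^bsub>G\<^esub>" if "a \<in> carrier G" for a
      using iv g(2) that by (intro bexI[of _ "iv a"]) (auto simp: G)
  qed (simp_all add: G F(2) u assoc ul)
  define h where "h a = (if a \<in> X then Some a else None)" for a
  have inv: "inv\<^bsub>G\<^esub> a = iv a" if "a \<in> X" for a
    by (rule group.inv_equality[OF group]) (use that iv g(2) in \<open>auto simp: G\<close>)
  have "{a @ b @ a \<otimes>\<^bsub>G\<^esub> b | a b. a \<in> carrier G \<and> b \<in> carrier G} = {a @ b @ c | a b c. F a b = Some c}"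
  proof -
    have "F a b = Some c \<longleftrightarrow> a \<in> X \<and> b \<in> X \<and> c = mul a b" for a b c
      using F(1)[of a b] X(3) by (auto simp: definable_pfun2_def)
    then show ?thesis unfolding G by simp
  qed
  then have 1: "definable_group L M A n G"
    using group X(2,3) by (simp add: definable_group_def G definable_pfun2_def)
  have "tp A (\<lambda>E. E 0 \<in> X)" using X(2) definable_iff_tp[OF A, of 1 X] by simp
  then have "tp A (\<lambda>E. E 0 \<in> X \<and> E 0 = E 1)" by (intro tp_conj tp_eq A tm_var)
  then have "tp A (\<lambda>E. concat (map E [0..<2]) \<in> {a @ a | a. a \<in> X})"
  proof (rule tp_congI)
    fix E :: "nat \<Rightarrow> 'u list" assume E: "\<And>i. E i \<in> T"
    then have "E 0 @ E 1 = a @ a \<longleftrightarrow> E 0 = a \<and> E 1 = a" if "a \<in> X" for a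
      using that X_sub by (auto simp: tuples_def)
    then have "E 0 @ E 1 \<in> {a @ a | a. a \<in> X} \<longleftrightarrow> (\<exists>a\<in>X. E 0 = a \<and> E 1 = a)" by blast
    then show "(E 0 \<in> X \<and> E 0 = E 1) = (concat (map E [0..<2]) \<in> {a @ a | a. a \<in> X})"
      by (auto simp: numeral_2_eq_2)
  qed
  moreover have "{a @ a | a. a \<in> X} \<subseteq> tuples M (2 * n)"
  proof -
    have "a @ a \<in> tuples M (2 * n)" if "a \<in> T" for a using that by (auto simp: tuples_def)
    then show ?thesis using X_sub by blast
  qed
  ultimately have "definable L M A (n + n) {a @ a | a. a \<in> X}"
    using definable_iff_tp[OF A, of 2] by (simp add: mult_2)
  moreover have "{a @ b | a b. h a = Some b} = {a @ a | a. a \<in> X}" by (auto simp: h_def)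
  ultimately have 2: "definable_pfun1 L M A n X n X h" by (auto simp: definable_pfun1_def h_def)
  \<comment> \<open>The range is everything, so its complement is empty and has dimension
    \<open>-1\<close> by convention, below \<open>0\<close>.\<close>
  have 3: "ran h = X" "dom h = X" by (auto simp: ran_def h_def split: if_splits)
  have 4: "bij_betw (\<lambda>a. the (h a)) X X"
    by (rule bij_betwI[where g = id]) (auto simp: h_def)
  have "group_realization L M A n X F A n G h"
    unfolding group_realization_def
    using 1 2 3 4 zero F by (auto simp: G generic h_def set_dim_def[of _ _ _ "{}"])
  moreover have "\<exists>a'. g a = Some a' \<and> a' \<in> dom h \<and> the (h a') = inv\<^bsub>G\<^esub> (the (h a))" if "a \<in> generics L M A X" for a
    using that g inv by (auto simp: generic h_def)
  ultimately show ?thesis by blast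
qed

lemma tp_bex_less: "(\<And>i. i < k \<Longrightarrow> tp C (P i)) \<Longrightarrow> tp C (\<lambda>E. \<exists>i<k. P i E)" for k :: nat
proof (induction k)
  case (Suc k)
  then have "tp C (\<lambda>E. (\<exists>i<k. P i E) \<or> P k E)" by (intro tp_disj) auto
  then show ?case by (rule tp_congI) (auto simp: less_Suc_eq)
qed (simp add: tp_const)

lemma tp_ball_less: "(\<And>i. i < k \<Longrightarrow> tp C (P i)) \<Longrightarrow> tp C (\<lambda>E. \<forall>i<k. P i E)" for k :: nat
  using tp_neg[OF tp_bex_less[of k C "\<lambda>i E. \<not> P i E", OF tp_neg]] by simp

end

context germ_group
begin

lemma tp_geq_42:
  assumes "A \<subseteq> C" "C \<subseteq> U" "tm C a" "tm C b" "tm C c" "tm C e" "tm C x" "tm C y"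
  shows "tp C (\<lambda>E. geq [a E, b E, c E, e E] [x E, y E])"
  by (rule tp_geq[OF assms(1,2), of "[a, b, c, e]" "[x, y]", unfolded list.map])
    (use assms(3-) in auto)

lemma tp_geq_22:
  assumes "A \<subseteq> C" "C \<subseteq> U" "tm C a" "tm C b" "tm C x" "tm C y"
  shows "tp C (\<lambda>E. geq [a E, b E] [x E, y E])"
  by (rule tp_geq[OF assms(1,2), of "[a, b]" "[x, y]", unfolded list.map])
    (use assms(3-) in auto)

lemma tp_geq_21:
  assumes "A \<subseteq> C" "C \<subseteq> U" "tm C a" "tm C b" "tm C x"
  shows "tp C (\<lambda>E. geq [a E, b E] [x E])"
  by (rule tp_geq[OF assms(1,2), of "[a, b]" "[x]", unfolded list.map])
    (use assms(3-) in auto)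

end

lemma (in germ_group) elementary_covers:
  assumes "elementary_substructure L M A"
  shows "\<exists>es. covers es \<and> params es \<subseteq> A"
proof -
  let ?k = "Suc (2 * n)"
  obtain es where es: "length es = ?k" "covers es" using covers_ex by blast
  define P where "P E \<longleftrightarrow> (\<forall>i<?k. E i \<in> X0) \<and> (\<forall>a\<in>T. \<forall>b\<in>T. a \<in> X0 \<longrightarrow> b \<in> X0 \<longrightarrow>
    (\<exists>i<?k. \<exists>y\<in>T. y \<in> X0 \<and> geq [a, b] [y, E i]))" for E
  have geq: "tp A (\<lambda>E. geq [E (Suc (Suc 0)), E (Suc 0)] [E 0, E (Suc (Suc (Suc i)))])" for i
    by (intro tp_geq_22 tm_var A_subset subset_refl)
  have P: "tp A P"
    unfolding P_def
    by (intro tp_conj tp_ball_less tp_bex_less tp_all tp_imp tp_ex tp_X0 tm_var A_subset subset_refl geq)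
  have cov: "P E \<longleftrightarrow> covers (map E [0..<?k])" for E
  proof -
    have set: "set (map E [0..<?k]) = E ` {..<?k}" by (auto simp del: upt_Suc)
    have "(\<forall>i<?k. E i \<in> X0) \<longleftrightarrow> E ` {..<?k} \<subseteq> X0" by auto
    moreover have "(\<exists>i<?k. \<exists>y\<in>T. y \<in> X0 \<and> geq [a, b] [y, E i]) \<longleftrightarrow>
        (\<exists>e\<in>E ` {..<?k}. \<exists>y\<in>X0. equ [a, b] [y, e])"
      if sub: "E ` {..<?k} \<subseteq> X0" and ab: "a \<in> X0" "b \<in> X0" for a b
    proof -
      have "geq [a, b] [y, E i] \<longleftrightarrow> equ [a, b] [y, E i]" if "i < ?k" "y \<in> X0" for i y
        by (rule geq_iff_equ) (use that sub ab in auto)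
      then have "(\<exists>y\<in>T. y \<in> X0 \<and> geq [a, b] [y, E i]) \<longleftrightarrow> (\<exists>y\<in>X0. equ [a, b] [y, E i])" if "i < ?k" for i
        using that X0_X X_T by blast
      then show ?thesis unfolding bex_simps by (metis (no_types, lifting) lessThan_iff)
    qed
    moreover have "(\<forall>a\<in>T. \<forall>b\<in>T. a \<in> X0 \<longrightarrow> b \<in> X0 \<longrightarrow> R a b) \<longleftrightarrow> (\<forall>a\<in>X0. \<forall>b\<in>X0. R a b)" for R
      using X0_X X_T by blast
    ultimately show ?thesis unfolding P_def covers_def set by (simp only: cong: conj_cong ball_cong)
  qed
  \<comment> \<open>Entries from \<open>?k\<close> on repeat \<open>es ! 0\<close> so that the whole
    sequence lies in \<open>T\<close>.\<close>
  define E where "E i = (if i < ?k then es ! i else es ! 0)" for i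
  have E: "map E [0..<?k] = es" using es(1) by (auto intro!: nth_equalityI simp: E_def simp del: upt_Suc)
  have "E i \<in> set es" for i using es(1) by (auto simp: E_def)
  then have "E i \<in> T" for i using es(2) X0_X X_T unfolding covers_def by blast
  then obtain E' where E': "\<And>i. set (E' i) \<subseteq> A" "P E'"
    using tp_elementary_witness[OF assms P, of E] cov[of E] es(2) unfolding E by blast
  then have "covers (map E' [0..<?k])" using cov by blast
  moreover have "params (map E' [0..<?k]) \<subseteq> A" using E'(1) by (auto simp: params_def)
  ultimately show ?thesis by blast
qed

section \<open>The group law on reduced representatives\<close>

locale group_atlas = germ_group +
  fixes es :: "'c list list" and B :: "'c set"
  assumes covers: "covers es" and ok_B: "ok B" and es_B: "params es \<subseteq> B"
begin

lemma B: "A \<subseteq> B" "B \<subseteq> U"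
  using okD[OF ok_B] by auto

lemma es: "i < length es \<Longrightarrow> es ! i \<in> X0" "i < length es \<Longrightarrow> set (es ! i) \<subseteq> B"
  using covers es_B by (fastforce simp: covers_def params_def)+

lemma X0_T: "x \<in> X0 \<Longrightarrow> x \<in> T" and X0_length: "x \<in> X0 \<Longrightarrow> length x = n"
  using X0_X X_T by (auto simp: tuples_def)

text \<open>The list \<open>y @ e\<close> represents the germ of the word \<open>[y, e]\<close>. Every germ has such a
  representative with \<open>e\<close> among \<open>es\<close>, and taking the least possible index makes it unique, so no
  quotient by a definable equivalence relation is needed.\<close>

definition reduced :: "'c list \<Rightarrow> 'c list \<Rightarrow> bool" where
  "reduced y e \<longleftrightarrow> (\<exists>i<length es. e = es ! i \<and> y \<in> X0 \<and> (\<forall>j<i. \<forall>y'\<in>X0. \<not> geq [y, e] [y', es ! j]))"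

definition G_set :: "'c list set" where
  "G_set = {y @ e | y e. reduced y e}"

definition word :: "'c list \<Rightarrow> 'c list list" where
  "word p = [take n p, drop n p]"

lemma reduced_X0: "reduced y e \<Longrightarrow> y \<in> X0 \<and> e \<in> X0 \<and> set e \<subseteq> B"
  using es by (auto simp: reduced_def)

lemma word_append: "y \<in> X0 \<Longrightarrow> word (y @ e) = [y, e]"
  by (simp add: word_def X0_length)

lemma word_X0: "p \<in> G_set \<Longrightarrow> set (word p) \<subseteq> X0"
  using reduced_X0 by (auto simp: G_set_def word_append)

text \<open>Both indices are least for the same germ, so they agree; cancelling \<open>e\<close> and
  faithfulness give \<open>y = y'\<close>.\<close>

lemma reduced_unique:
  assumes "reduced y e" "reduced y' e'" "equ [y, e] [y', e']"
  shows "y = y' \<and> e = e'"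
proof -
  obtain i where i: "i < length es" "e = es ! i" "\<And>j y'. j < i \<Longrightarrow> y' \<in> X0 \<Longrightarrow> \<not> geq [y, e] [y', es ! j]"
    using assms(1) unfolding reduced_def by blast
  obtain i' where i': "i' < length es" "e' = es ! i'" "\<And>j z. j < i' \<Longrightarrow> z \<in> X0 \<Longrightarrow> \<not> geq [y', e'] [z, es ! j]"
    using assms(2) unfolding reduced_def by blast
  note X0 = reduced_X0[OF assms(1)] reduced_X0[OF assms(2)]
  have "geq [y, e] [y', e']" "geq [y', e'] [y, e]"
    using assms(3) equ_sym[OF assms(3)] X0 by (simp_all add: geq_iff_equ)
  then have "i = i'" using i i' X0 by (metis linorder_neqE_nat)
  then have "e = e'" using i i' by simp
  then have "equ [y] [y']" using equ_cancel_right[of "[y]" "[e]" "[y']"] assms(3) X0 by simp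
  then show ?thesis using X0_inj X0 \<open>e = e'\<close> by blast
qed

lemma word_inj:
  assumes "p \<in> G_set" "q \<in> G_set" "equ (word p) (word q)" shows "p = q"
proof -
  obtain y e where p: "p = y @ e" "reduced y e" using assms(1) by (auto simp: G_set_def)
  obtain y' e' where q: "q = y' @ e'" "reduced y' e'" using assms(2) by (auto simp: G_set_def)
  show ?thesis
    using reduced_unique[OF p(2) q(2)] assms(3) p q reduced_X0 by (simp add: word_append)
qed

text \<open>With \<open>w\<close> generic over \<open>x, a, b\<close> and inverse \<open>w'\<close>,
  \<open>x a b = (x (a w)) (w' b)\<close>, and each bracket is the germ of a generic point. The
  empty word is \<open>w w'\<close>.\<close>

lemma two_letters:
  assumes "set u \<subseteq> X0" shows "\<exists>a\<in>X0. \<exists>b\<in>X0. equ u [a, b]"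
  using assms
proof (induction u)
  case Nil
  obtain w where w: "gen A w" using gen_ex[OF ok_A] by blast
  then obtain w' where "gen A w'" "equ [w, w'] []" using g_inverse[OF w ok_A] by blast
  then show ?case using w gen_X0 equ_sym by blast
next
  case (Cons x u)
  then obtain a b where ab: "a \<in> X0" "b \<in> X0" "equ u [a, b]" by auto
  have x: "x \<in> X0" using Cons.prems by simp
  let ?C = "A \<union> set x \<union> set a \<union> set b"
  have ok: "ok ?C" by (intro ok_Un_set ok_A X0_X ab x)
  obtain w where w: "gen ?C w" using gen_ex[OF ok] by blast
  obtain w' where w': "gen ?C w'" "equ [w, w'] []" using g_inverse[OF w ok] by blast
  obtain c where c: "gen ?C c" "equ [a, w] [c]" using mult_left[OF ab(1) ok _ w] by auto
  obtain c' where c': "gen ?C c'" "equ [x, c] [c']" using mult_left[OF x ok _ c(1)] by auto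
  obtain e where e: "gen ?C e" "equ [w', b] [e]" using mult_right[OF ab(2) ok _ w'(1)] by auto
  have X0: "w' \<in> X0" "c \<in> X0" "c' \<in> X0" "e \<in> X0" using w' c c' e gen_A[OF _ ok] gen_X0 by auto
  have "equ (x # u) ([x, a] @ [] @ [b])" using equ_append_left[OF ab(3), of "[x]"] by simp
  also have "equ ([x, a] @ [] @ [b]) ([x, a] @ [w, w'] @ [b])"
    by (rule equ_mid[OF equ_sym[OF w'(2)]]) (use ab in simp)
  also have "equ ([x, a] @ [w, w'] @ [b]) ([x] @ [c] @ [w', b])"
    using equ_mid[OF c(2), of "[w', b]" "[x]"] X0 ab by simp
  also have "equ ([x] @ [c] @ [w', b]) [c', e]"
    using equ_append[OF c'(2) e(2)] X0 ab by simp
  finally show ?case using X0 by blast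
qed

text \<open>Two letters suffice, the covering property makes the second one of \<open>es\<close>,
  and the least possible index is taken.\<close>

lemma normal_form_ex:
  assumes "set u \<subseteq> X0" shows "\<exists>p. p \<in> G_set \<and> equ (word p) u"
proof -
  let ?Q = "\<lambda>i. i < length es \<and> (\<exists>y\<in>X0. equ u [y, es ! i])"
  obtain a b where ab: "a \<in> X0" "b \<in> X0" "equ u [a, b]" using two_letters[OF assms] by blast
  then obtain e y where "e \<in> set es" "y \<in> X0" "equ [a, b] [y, e]" using covers unfolding covers_def by blast
  then have "\<exists>i. ?Q i" using equ_trans[OF ab(3)] by (metis in_set_conv_nth)
  then obtain i where i: "?Q i" "\<And>j. j < i \<Longrightarrow> \<not> ?Q j"
    using LeastI_ex[of ?Q] not_less_Least[of _ ?Q] by blast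
  then obtain y where y: "y \<in> X0" "equ u [y, es ! i]" by blast
  have "\<not> geq [y, es ! i] [y', es ! j]" if "j < i" "y' \<in> X0" for j y'
  proof
    have j: "j < length es" using that i by simp
    assume "geq [y, es ! i] [y', es ! j]"
    then have "equ [y, es ! i] [y', es ! j]" using y that es i j by (simp add: geq_iff_equ)
    then show False using i(2)[OF that(1)] equ_trans[OF y(2)] that(2) j by blast
  qed
  then have "reduced y (es ! i)" using i y unfolding reduced_def by blast
  then show ?thesis using equ_sym[OF y(2)] y(1)
    by (intro exI[of _ "y @ es ! i"]) (auto simp: G_set_def word_append)
qed

definition nf :: "'c list list \<Rightarrow> 'c list" where
  "nf u = (SOME p. p \<in> G_set \<and> equ (word p) u)"

lemma nf: "set u \<subseteq> X0 \<Longrightarrow> nf u \<in> G_set" "set u \<subseteq> X0 \<Longrightarrow> equ (word (nf u)) u"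
  using someI_ex[OF normal_form_ex] by (auto simp: nf_def)

lemma nf_eqI: "set u \<subseteq> X0 \<Longrightarrow> p \<in> G_set \<Longrightarrow> equ (word p) u \<Longrightarrow> nf u = p"
  using word_inj nf equ_trans equ_sym by meson

lemma nf_eq_iff: "set u \<subseteq> X0 \<Longrightarrow> set v \<subseteq> X0 \<Longrightarrow> nf u = nf v \<longleftrightarrow> equ u v"
  using nf nf_eqI equ_trans equ_sym by metis

definition G :: "'c list monoid" where
  "G = \<lparr>carrier = G_set, mult = (\<lambda>p q. nf (word p @ word q)), one = nf []\<rparr>"

lemma G_simps [simp]: "carrier G = G_set" "p \<otimes>\<^bsub>G\<^esub> q = nf (word p @ word q)" "\<one>\<^bsub>G\<^esub> = nf []"
  by (simp_all add: G_def)

text \<open>\<open>nf\<close> carries concatenation of words to the group law; associativity,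
  identity and inverses then come from words.\<close>

lemma nf_mult:
  assumes "set u \<subseteq> X0" "set v \<subseteq> X0"
  shows "nf (word (nf u) @ word (nf v)) = nf (u @ v)"
proof (subst nf_eq_iff)
  have "set (word (nf u)) \<subseteq> X0" "set (word (nf v)) \<subseteq> X0" using nf(1) word_X0 assms by blast+
  then show "set (word (nf u) @ word (nf v)) \<subseteq> X0" "equ (word (nf u) @ word (nf v)) (u @ v)"
    using nf(2) assms by (auto intro: equ_append)
qed (use assms in auto)

lemma nf_word: "p \<in> G_set \<Longrightarrow> nf (word p) = p"
  by (rule nf_eqI) (auto dest: word_X0)

lemma group_G: "group G"
proof (rule groupI)
  fix p q r assume "p \<in> carrier G" "q \<in> carrier G" "r \<in> carrier G"
  then have G: "p \<in> G_set" "q \<in> G_set" "r \<in> G_set" by auto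
  note X0 = word_X0[OF G(1)] word_X0[OF G(2)] word_X0[OF G(3)]
  have pq: "set (word p @ word q) \<subseteq> X0" "set (word q @ word r) \<subseteq> X0" using X0 by auto
  show "p \<otimes>\<^bsub>G\<^esub> q \<otimes>\<^bsub>G\<^esub> r = p \<otimes>\<^bsub>G\<^esub> (q \<otimes>\<^bsub>G\<^esub> r)"
    using nf_mult[OF pq(1) X0(3)] nf_mult[OF X0(1) pq(2)] G by (simp add: nf_word)
next
  fix p q assume "p \<in> carrier G" "q \<in> carrier G"
  then show "p \<otimes>\<^bsub>G\<^esub> q \<in> carrier G" using nf(1)[of "word p @ word q"] word_X0 by simp
next
  fix p assume "p \<in> carrier G"
  then have p: "p \<in> G_set" "set (word p) \<subseteq> X0" using word_X0 by auto
  then show "\<one>\<^bsub>G\<^esub> \<otimes>\<^bsub>G\<^esub> p = p" using nf_mult[of "[]" "word p"] by (simp add: nf_word)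
  obtain v where v: "set v \<subseteq> X0" "equ (v @ word p) []" using word_inverse[OF p(2)] by blast
  then have "nf (v @ word p) = nf []" using p(2) by (subst nf_eq_iff) auto
  then show "\<exists>q\<in>carrier G. q \<otimes>\<^bsub>G\<^esub> p = \<one>\<^bsub>G\<^esub>"
    using nf_mult[OF v(1) p(2)] nf(1)[OF v(1)] p by (intro bexI[of _ "nf v"]) (simp_all add: nf_word)
qed (simp add: nf)

section \<open>Definability of the group\<close>

lemma tp_reduced:
  assumes "tm B t" "tm B s"
  shows "tp B (\<lambda>E. reduced (t E) (s E))"
proof -
  have const: "tm B (\<lambda>E. es ! i)" if "i < length es" for i
    by (rule tm_const) (use that es X0_T in auto)
  have "tp B (\<lambda>E. \<exists>i<length es. s E = es ! i \<and> t E \<in> X0 \<and>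
      (\<forall>j<i. \<forall>y'\<in>T. y' \<in> X0 \<longrightarrow> \<not> geq [t E, s E] [y', es ! j]))"
    by (intro tp_bex_less tp_ball_less tp_conj tp_all tp_imp tp_neg tp_geq_22 tp_X0 tp_eq B assms const
        tm_shift[OF assms(1)] tm_shift[OF assms(2)] tm_var) auto
  then show ?thesis
    by (rule tp_congI) (use X0_T in \<open>auto simp: reduced_def\<close>)
qed

lemma append_in_G_set: "y \<in> T \<Longrightarrow> y @ e \<in> G_set \<longleftrightarrow> reduced y e"
proof (intro iffI)
  assume y: "y \<in> T" "y @ e \<in> G_set"
  then obtain y' e' where *: "y @ e = y' @ e'" "reduced y' e'" by (auto simp: G_set_def)
  have "length y = length y'" using y(1) reduced_X0[OF *(2)] X0_length by (simp add: tuples_def)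
  then show "reduced y e" using * by simp
qed (auto simp: G_set_def)

lemma G_set_tuples: "G_set \<subseteq> tuples M (2 * n)"
proof
  fix p assume "p \<in> G_set"
  then obtain y e where p: "p = y @ e" "reduced y e" by (auto simp: G_set_def)
  then have "y \<in> T" "e \<in> T" using reduced_X0 X0_T by blast+
  then show "p \<in> tuples M (2 * n)" using p by (auto simp: tuples_def)
qed

lemma definable_G_set: "definable L M B (2 * n) G_set"
proof -
  have "tp B (\<lambda>E. reduced (E 0) (E 1))" by (intro tp_reduced tm_var)
  then have "tp B (\<lambda>E. concat (map E [0..<2]) \<in> G_set)"
    by (rule tp_congI) (simp add: numeral_2_eq_2 append_in_G_set)
  then show ?thesis using definable_iff_tp[OF B(2)] G_set_tuples by blast
qed

text \<open>Describes the graph of \<open>nf\<close> by conditions already known to be definable,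
  for the group law and for \<open>h\<close>.\<close>

lemma nf_eq_append_iff:
  assumes "y \<in> T" "set u \<subseteq> X0"
  shows "y @ e = nf u \<longleftrightarrow> reduced y e \<and> geq u [y, e]"
proof
  assume eq: "y @ e = nf u"
  then have r: "reduced y e" using nf(1)[OF assms(2)] append_in_G_set[OF assms(1)] by metis
  moreover have "equ [y, e] u"
    using nf(2)[OF assms(2)] reduced_X0[OF r] by (simp add: eq[symmetric] word_append)
  ultimately show "reduced y e \<and> geq u [y, e]"
    using geq_iff_equ[of u "[y, e]"] equ_sym reduced_X0[OF r] assms(2) by simp
next
  assume *: "reduced y e \<and> geq u [y, e]"
  then have "equ u [y, e]" using geq_iff_equ[of u "[y, e]"] reduced_X0[of y e] assms(2) by simp
  then show "y @ e = nf u"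
    using nf_eqI[OF assms(2), of "y @ e"] * append_in_G_set[OF assms(1)] reduced_X0[of y e]
      equ_sym[of u "[y, e]"] by (simp add: word_append)
qed

lemma definable_group_G: "definable_group L M B (2 * n) G"
proof -
  let ?Gr = "{a @ b @ nf (word a @ word b) | a b. a \<in> G_set \<and> b \<in> G_set}"
  have sub: "?Gr \<subseteq> tuples M (6 * n)"
  proof
    fix x assume "x \<in> ?Gr"
    then obtain a b where x: "x = a @ b @ nf (word a @ word b)" "a \<in> G_set" "b \<in> G_set" by blast
    then have "nf (word a @ word b) \<in> G_set" using word_X0 by (intro nf) auto
    then have "nf (word a @ word b) \<in> tuples M (2 * n)" "a \<in> tuples M (2 * n)" "b \<in> tuples M (2 * n)"
      using x G_set_tuples by blast+
    then show "x \<in> tuples M (6 * n)" using x by (auto simp: tuples_def)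
  qed
  \<comment> \<open>Six blocks: two for each factor and two for the product.\<close>
  have "tp B (\<lambda>E. (reduced (E 0) (E 1) \<and> reduced (E 2) (E 3)) \<and> reduced (E 4) (E 5) \<and>
      geq [E 0, E 1, E 2, E 3] [E 4, E 5])"
    by (intro tp_conj tp_reduced tp_geq_42 B tm_var)
  then have "tp B (\<lambda>E. concat (map E [0..<6]) \<in> ?Gr)"
  proof (rule tp_congI)
    fix E :: "nat \<Rightarrow> 'c list" assume E: "\<And>i. E i \<in> T"
    then have len: "length (E i) = n" for i by (simp add: tuples_def)
    have concat: "concat (map E [0..<6]) = (E 0 @ E 1) @ (E 2 @ E 3) @ (E 4 @ E 5)"
      by (simp add: eval_nat_numeral)
    have "concat (map E [0..<6]) \<in> ?Gr \<longleftrightarrow>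
        E 0 @ E 1 \<in> G_set \<and> E 2 @ E 3 \<in> G_set \<and> E 4 @ E 5 = nf (word (E 0 @ E 1) @ word (E 2 @ E 3))"
    proof
      assume "concat (map E [0..<6]) \<in> ?Gr"
      then obtain a b where ab: "concat (map E [0..<6]) = a @ b @ nf (word a @ word b)" "a \<in> G_set" "b \<in> G_set" by blast
      then have l: "length a = 2 * n" "length b = 2 * n" using G_set_tuples by (auto simp: tuples_def)
      have "E 0 @ E 1 = a \<and> (E 2 @ E 3) @ (E 4 @ E 5) = b @ nf (word a @ word b)"
        using ab(1) unfolding concat
        by (subst (asm) append_eq_append_conv) (simp_all only: length_append len l mult_2 simp_thms)
      moreover from this have "E 2 @ E 3 = b \<and> E 4 @ E 5 = nf (word a @ word b)"
        by (subst (asm) append_eq_append_conv) (simp_all only: length_append len l mult_2 simp_thms)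
      ultimately have "E 0 @ E 1 = a \<and> E 2 @ E 3 = b \<and> E 4 @ E 5 = nf (word a @ word b)"
        by blast
      then show "E 0 @ E 1 \<in> G_set \<and> E 2 @ E 3 \<in> G_set \<and> E 4 @ E 5 = nf (word (E 0 @ E 1) @ word (E 2 @ E 3))"
        using ab by simp
    qed (auto simp only: concat)
    also have "\<dots> \<longleftrightarrow> (reduced (E 0) (E 1) \<and> reduced (E 2) (E 3)) \<and> reduced (E 4) (E 5) \<and>
      geq [E 0, E 1, E 2, E 3] [E 4, E 5]"
    proof (cases "reduced (E 0) (E 1) \<and> reduced (E 2) (E 3)")
      case True
      then have "set [E 0, E 1, E 2, E 3] \<subseteq> X0" "word (E 0 @ E 1) @ word (E 2 @ E 3) = [E 0, E 1, E 2, E 3]"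
        using reduced_X0 by (auto simp: word_append)
      then show ?thesis using True nf_eq_append_iff[OF E[of 4]] by (simp add: append_in_G_set E)
    qed (auto simp: append_in_G_set E)
    finally show "((reduced (E 0) (E 1) \<and> reduced (E 2) (E 3)) \<and> reduced (E 4) (E 5) \<and>
      geq [E 0, E 1, E 2, E 3] [E 4, E 5]) = (concat (map E [0..<6]) \<in> ?Gr)" by blast
  qed
  then have "definable L M B (6 * n) ?Gr" using definable_iff_tp[OF B(2)] sub by blast
  moreover have "2 * n + 2 * n + 2 * n = 6 * n" by simp
  ultimately show ?thesis
    using group_G definable_G_set by (simp only: definable_group_def G_simps)
qed

section \<open>The map \<open>h\<close>, dimension, and generic points of the group\<close>

text \<open>The domain is all of \<open>X0\<close>, which makes the graph definable; the set of
  generic points over \<open>B\<close> need not be definable.\<close>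

definition h :: "'c list \<Rightarrow> 'c list option" where
  "h x = (if x \<in> X0 then Some (nf [x]) else None)"

lemma definable_h: "definable_pfun1 L M B n X (2 * n) (carrier G) h"
proof -
  let ?Gr = "{a @ b | a b. h a = Some b}"
  have hG: "a \<in> X0 \<and> b \<in> G_set \<and> b = nf [a]" if "h a = Some b" for a b
    using that nf(1)[of "[a]"] by (auto simp: h_def split: if_splits)
  have sub: "?Gr \<subseteq> tuples M (3 * n)"
    using hG X0_T G_set_tuples by (fastforce simp: tuples_def)
  have "tp B (\<lambda>E. E 0 \<in> X0 \<and> reduced (E 1) (E 2) \<and> geq [E 1, E 2] [E 0])"
    by (intro tp_conj tp_reduced tp_X0 tp_geq_21 B tm_var)
  then have "tp B (\<lambda>E. concat (map E [0..<3]) \<in> ?Gr)"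
  proof (rule tp_congI)
    fix E :: "nat \<Rightarrow> 'c list" assume E: "\<And>i. E i \<in> T"
    then have len: "length (E i) = n" for i by (simp add: tuples_def)
    have concat: "concat (map E [0..<3]) = E 0 @ E 1 @ E 2" by (simp add: eval_nat_numeral)
    have "concat (map E [0..<3]) \<in> ?Gr \<longleftrightarrow> E 0 \<in> X0 \<and> E 1 @ E 2 = nf [E 0]"
    proof
      assume "concat (map E [0..<3]) \<in> ?Gr"
      then obtain a b where ab: "E 0 @ E 1 @ E 2 = a @ b" "h a = Some b" unfolding concat by blast
      have "length a = n" using hG[OF ab(2)] X0_length by simp
      then have "E 0 = a \<and> E 1 @ E 2 = b" using ab(1) len by simp
      then show "E 0 \<in> X0 \<and> E 1 @ E 2 = nf [E 0]" using hG[OF ab(2)] by simp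
    qed (auto simp: concat h_def)
    also have "\<dots> \<longleftrightarrow> E 0 \<in> X0 \<and> reduced (E 1) (E 2) \<and> geq [E 1, E 2] [E 0]"
      using nf_eq_append_iff[OF E[of 1], of "[E 0]"] geq_iff_equ[of "[E 0]" "[E 1, E 2]"]
        geq_iff_equ[of "[E 1, E 2]" "[E 0]"] equ_sym reduced_X0[of "E 1" "E 2"]
      by auto
    finally show "(E 0 \<in> X0 \<and> reduced (E 1) (E 2) \<and> geq [E 1, E 2] [E 0]) = (concat (map E [0..<3]) \<in> ?Gr)"
      by blast
  qed
  then have "definable L M B (3 * n) ?Gr" using definable_iff_tp[OF B(2)] sub by blast
  moreover have "n + 2 * n = 3 * n" by simp
  ultimately show ?thesis using hG X0_X by (auto simp: definable_pfun1_def)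
qed

lemma ldim_append_B:
  assumes "set y \<subseteq> U" "set e \<subseteq> B" shows "ldim cl B (y @ e) = ldim cl B y"
proof (rule ldim_absorb[OF B(2) assms(1)])
  show "set e \<subseteq> cl (B \<union> set y)" using cl_incl[of "B \<union> set y"] assms B by blast
qed

text \<open>Over \<open>B\<close>, which contains \<open>e\<close>, the points \<open>x\<close> and
  \<open>y\<close> are algebraic over each other: \<open>y\<close> is the only point with
  \<open>y e = x\<close> as germs, by cancellation, and \<open>x\<close> is the only one by
  faithfulness.\<close>

lemma ldim_nf:
  assumes "x \<in> X0" shows "ldim cl B (nf [x]) = ldim cl B x"
proof -
  obtain y e where ye: "nf [x] = y @ e" "reduced y e" using nf(1)[of "[x]"] assms by (auto simp: G_set_def)
  note X0 = reduced_X0[OF ye(2)]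
  have eq: "equ [y, e] [x]" using nf(2)[of "[x]"] assms X0 by (simp add: ye word_append)
  have U: "set x \<subseteq> U" "set y \<subseteq> U" using assms X0 X0_X X_U by blast+
  have "set y \<subseteq> cl (B \<union> set x)"
  proof (rule tp_unique_acl[of _ "\<lambda>y. y \<in> X0 \<and> geq [y, e] [x]"])
    show "tp (B \<union> set x) (\<lambda>E. E 0 \<in> X0 \<and> geq [E 0, e] [x])"
      by (intro tp_conj tp_X0 tp_geq_21 tm_var tm_const) (use B U X0 assms X0_T in auto)
    show "y' = y" if "y' \<in> X0 \<and> geq [y', e] [x]" for y'
    proof -
      have "equ [y', e] [y, e]"
        using geq_iff_equ[of "[y', e]" "[x]"] that X0 assms
        by (intro equ_trans[OF _ equ_sym[OF eq]]) auto
      then have "equ [y'] [y]" using equ_cancel_right[of "[y']" "[e]" "[y]"] that X0 by simp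
      then show ?thesis using X0_inj that X0 by blast
    qed
  qed (use B U X0 assms X0_T eq geq_iff_equ in auto)
  moreover have "set x \<subseteq> cl (B \<union> set y)"
  proof (rule tp_unique_acl[of _ "\<lambda>x. x \<in> X0 \<and> geq [y, e] [x]"])
    show "tp (B \<union> set y) (\<lambda>E. E 0 \<in> X0 \<and> geq [y, e] [E 0])"
      by (intro tp_conj tp_X0 tp_geq_21 tm_var tm_const) (use B U X0 assms X0_T in auto)
    show "x' = x" if "x' \<in> X0 \<and> geq [y, e] [x']" for x'
      using that X0 assms X0_inj equ_trans[OF equ_sym[OF eq]] by (metis geq_iff_equ empty_set empty_subsetI equ_sym insert_subset list.simps(15))
  qed (use B U X0 assms X0_T eq geq_iff_equ in auto)
  ultimately have "ldim cl B y = ldim cl B x"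
    using ldim_le[OF B(2) U(1)] ldim_le[OF B(2) U(2)] by (meson order_antisym)
  then show ?thesis using ldim_append_B[OF U(2)] X0 ye(1) by simp
qed

lemma ldim_G_set: "p \<in> G_set \<Longrightarrow> ldim cl B p \<le> d"
  using reduced_X0 ldim_append_B X_U X0_X ldim_le_d[OF B] by (fastforce simp: G_set_def)

lemma set_dim_B_X: "set_dim L M B X = int d"
proof -
  obtain x where "gen B x" using gen_ex[OF ok_B] by blast
  then show ?thesis
    using set_dim_eqI[OF B(2) X_sub_T, of d x] ldim_le_d[OF B] by (auto simp: gen_def)
qed

lemma gen_B_X0: "gen B x \<Longrightarrow> x \<in> X0"
  using gen_A[OF _ ok_B] gen_X0 by blast

lemma set_dim_G: "set_dim L M B G_set = int d"
proof -
  obtain x where x: "gen B x" using gen_ex[OF ok_B] by blast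
  then have "nf [x] \<in> G_set" "ldim cl B (nf [x]) = d"
    using gen_B_X0 nf(1)[of "[x]"] ldim_nf by (auto simp: gen_def)
  then show ?thesis using set_dim_eqI[OF B(2) G_set_tuples ldim_G_set] by simp
qed

lemma generics_B_X: "generics L M B X = {x. gen B x}"
  using tuple_dim_eq[OF B(2)] X_U set_dim_B_X by (auto simp: gen_def generics_def)

lemma generics_G: "generics L M B G_set = {p \<in> G_set. ldim cl B p = d}"
proof -
  have "set p \<subseteq> U" if "p \<in> G_set" for p using that G_set_tuples by (auto simp: tuples_def)
  then show ?thesis using tuple_dim_eq[OF B(2)] set_dim_G by (auto simp: generics_def)
qed

text \<open>A point of full dimension has a generic first half \<open>y\<close>, as \<open>e\<close>
  lies in \<open>B\<close>; then \<open>y e\<close> is the germ of a generic point by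
  \<open>mult_right\<close>.\<close>

lemma generic_G_obtain:
  assumes "p \<in> G_set" "ldim cl B p = d"
  obtains x where "gen B x" "nf [x] = p"
proof -
  obtain y e where p: "p = y @ e" "reduced y e" using assms(1) by (auto simp: G_set_def)
  note X0 = reduced_X0[OF p(2)]
  have "gen B y" using assms(2) p X0 X0_X X_U ldim_append_B[of y e] by (auto simp: gen_def)
  then obtain x where x: "gen B x" "equ [y, e] [x]"
    using mult_right[of e B y] ok_B X0 by blast
  have "nf [x] = p"
    by (rule nf_eqI) (use x gen_B_X0 assms p X0 in \<open>auto simp: word_append\<close>)
  then show ?thesis using that x by blast
qed

lemma bij_h: "bij_betw (\<lambda>a. the (h a)) (generics L M B X) (generics L M B (carrier G))"
proof (rule bij_betw_imageI)
  show "inj_on (\<lambda>a. the (h a)) (generics L M B X)"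
    using gen_B_X0 nf_eq_iff X0_inj by (auto simp: inj_on_def generics_B_X h_def)
  show "(\<lambda>a. the (h a)) ` generics L M B X = generics L M B (carrier G)"
  proof (intro equalityI subsetI)
    fix p assume "p \<in> (\<lambda>a. the (h a)) ` generics L M B X"
    then obtain x where "gen B x" "p = nf [x]" using gen_B_X0 by (auto simp: generics_B_X h_def)
    then show "p \<in> generics L M B (carrier G)"
      using gen_B_X0[of x] nf(1)[of "[x]"] ldim_nf[of x] by (auto simp: generics_G gen_def)
  next
    fix p assume "p \<in> generics L M B (carrier G)"
    then obtain x where "gen B x" "nf [x] = p" using generic_G_obtain by (auto simp: generics_G)
    then show "p \<in> (\<lambda>a. the (h a)) ` generics L M B X"
      using gen_B_X0[of x] by (intro image_eqI[of _ _ x]) (auto simp: generics_B_X h_def)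
  qed
qed

text \<open>Every point of full dimension is a value of \<open>h\<close>, by
  \<open>generic_G_obtain\<close>; an empty complement has dimension \<open>-1\<close>.\<close>

lemma large_range: "set_dim L M B (carrier G - ran h) < set_dim L M B (carrier G)"
proof (cases "G_set - ran h = {}")
  case True
  then show ?thesis unfolding G_simps set_dim_G by (simp add: set_dim_def)
next
  case False
  have "G_set - ran h \<subseteq> tuples M (2 * n)" using G_set_tuples by blast
  then obtain p where p: "p \<in> G_set - ran h" "set_dim L M B (G_set - ran h) = int (ldim cl B p)"
    using set_dim_attained[OF B(2) _ False] by blast
  have "ldim cl B p \<noteq> d"
  proof
    assume "ldim cl B p = d"
    then obtain x where "gen B x" "nf [x] = p" using generic_G_obtain p by blast
    then have "h x = Some p" using gen_B_X0 by (simp add: h_def)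
    then show False using p(1) by (auto simp: ran_def)
  qed
  then show ?thesis using ldim_G_set[of p] p set_dim_G by simp
qed

lemma h_mult:
  assumes "a \<in> generics L M B X" "b \<in> generics L M B X" "independent_tuples L M B [a, b]"
  shows "\<exists>c. F a b = Some c \<and> c \<in> dom h \<and> the (h c) = the (h a) \<otimes>\<^bsub>G\<^esub> the (h b)"
proof -
  have ab: "gen B a" "gen B b" using assms by (auto simp: generics_B_X)
  have X: "a \<in> X" "b \<in> X" using ab gen_X by auto
  have "gen (B \<union> set a) b"
    using assms(3) tuple_dim_eq[OF B(2), of a] tuple_dim_eq[OF B(2), of b] tuple_dim_eq[OF B(2), of "a @ b"]
      X_U[OF X(1)] X_U[OF X(2)] ab by (simp add: independent_tuples_def ldim_append gen_def)
  moreover have ok: "ok (B \<union> set a)" by (rule ok_Un_set[OF ok_B X(1)])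
  ultimately obtain c where c: "F a b = Some c" "gen (B \<union> set a) c" "equ [a, b] [c]"
    using X0_act[OF gen_B_X0[OF ab(1)] ok] by blast
  have X0: "a \<in> X0" "b \<in> X0" "c \<in> X0" using ab gen_B_X0 gen_A[OF c(2) ok] gen_X0 by auto
  have "nf [c] = nf ([a] @ [b])" using X0 c(3) equ_sym by (subst nf_eq_iff) auto
  then show ?thesis using c(1) X0 nf_mult[of "[a]" "[b]"] by (auto simp: h_def)
qed

lemma h_inv:
  assumes "a \<in> generics L M B X"
  shows "\<exists>a'. g a = Some a' \<and> a' \<in> dom h \<and> the (h a') = inv\<^bsub>G\<^esub> (the (h a))"
proof -
  have a: "gen B a" using assms by (simp add: generics_B_X)
  obtain a' where a': "g a = Some a'" "gen B a'" "equ [a', a] []" using g_inverse[OF a ok_B] by blast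
  have X0: "a \<in> X0" "a' \<in> X0" using a a' gen_B_X0 by auto
  have "nf ([a'] @ [a]) = nf []" using X0 a'(3) by (subst nf_eq_iff) auto
  then have "inv\<^bsub>G\<^esub> (nf [a]) = nf [a']"
    using X0 nf_mult[of "[a']" "[a]"] nf(1)[of "[a]"] nf(1)[of "[a']"]
    by (intro group.inv_equality[OF group_G]) auto
  then show ?thesis using a' X0 by (auto simp: h_def)
qed

lemma realization: "group_realization L M A n X F B (2 * n) G h"
  unfolding group_realization_def
  using definable_group_G set_dim_G set_dim_X definable_h bij_h large_range h_mult gen_B_X0
  by (auto simp: generics_B_X h_def dom_def)

end

section \<open>The zero-dimensional and positive-dimensional cases combined\<close>

theorem theorem1p5:
  fixes L :: "('f, 'r) lang"
    and M :: "('f, 'r, 'u) struct"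
    and A :: "'u set" and n :: nat and X :: "'u list set"
    and F :: "'u list \<Rightarrow> 'u list \<Rightarrow> 'u list option"
    and g :: "'u list \<Rightarrow> 'u list option"
  assumes "geometric L M" and "saturated L M"
    and "small M A"
    and "gen_defined_group L M A n X F g"
  shows "\<exists>B (m::nat) (G :: 'u list monoid) (h :: 'u list \<Rightarrow> 'u list option).
    A \<subseteq> B \<and> small M B \<and> (elementary_substructure L M A \<longrightarrow> B = A) \<and>
    definable_group L M B m G \<and>
    set_dim L M B (carrier G) = set_dim L M A X \<and>
    definable_pfun1 L M B n X m (carrier G) h \<and>
    generics L M B X \<subseteq> dom h \<and>
    bij_betw (\<lambda>a. the (h a)) (generics L M B X) (generics L M B (carrier G)) \<and>
    set_dim L M B (carrier G - ran h) < set_dim L M B (carrier G) \<and>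
    (\<forall>a\<in>generics L M B X. \<forall>b\<in>generics L M B X. independent_tuples L M B [a, b] \<longrightarrow>
       (\<exists>c. F a b = Some c \<and> c \<in> dom h \<and> the (h c) = the (h a) \<otimes>\<^bsub>G\<^esub> the (h b))) \<and>
    (\<forall>a\<in>generics L M B X.
       (\<exists>a'. g a = Some a' \<and> a' \<in> dom h \<and> the (h a') = inv\<^bsub>G\<^esub> (the (h a))))"
proof -
  interpret tuple_structure L M n
    by unfold_locales (use assms in auto)
  have "\<exists>B m G h. A \<subseteq> B \<and> small M B \<and> (elementary_substructure L M A \<longrightarrow> B = A) \<and>
    group_realization L M A n X F B m G h \<and> (\<forall>a\<in>generics L M B X.
       (\<exists>a'. g a = Some a' \<and> a' \<in> dom h \<and> the (h a') = inv\<^bsub>G\<^esub> (the (h a))))"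
  proof (cases "set_dim L M A X = 0")
    case True
    then show ?thesis using zero_dimensional_realization[OF assms(3,4)] assms(3) by blast
  next
    case False
    have A: "A \<subseteq> univ M" using assms(3) by (simp add: small_def)
    have X: "X \<noteq> {}" "X \<subseteq> tuples M n"
      using assms(4) definable_iff_dpred[OF A] by (auto simp: gen_defined_group_def)
    \<comment> \<open>In a finite universe every point is algebraic over \<open>A\<close>, so all
      dimensions would be \<open>0\<close>.\<close>
    have "infinite (univ M)"
    proof
      assume fin: "finite (univ M)"
      have "dpred A (\<lambda>e. e 0 \<in> univ M)"
        using dpred_const[of A True] by (rule dpred_cong[THEN iffD1, rotated]) auto
      then have cl: "univ M \<subseteq> acl L M A" using in_cl_finite[OF A _ subset_refl fin] by blast
      have "ldim (acl L M) A x = 0" if "x \<in> X" for x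
      proof (rule ldim_0[OF _ A])
        show "set x \<subseteq> acl L M A" using that X(2) cl unfolding tuples_def by blast
      qed
      moreover obtain x where "x \<in> X" using X by blast
      ultimately show False using set_dim_eqI[OF A X(2), of 0 x] False by auto
    qed
    then interpret germ_group L M n A X F g
      by unfold_locales (use assms in auto)
    \<comment> \<open>For an elementary substructure the list is taken inside \<open>A\<close>, so
      that \<open>B\<close> below equals \<open>A\<close>.\<close>
    obtain es where cov: "covers es" "elementary_substructure L M A \<Longrightarrow> params es \<subseteq> A"
      using covers_ex elementary_covers by blast
    define B where "B = A \<union> params es"
    have "ok B" unfolding B_def
      by (rule ok_Un) (use params[of es] cov(1) in \<open>auto simp: covers_def\<close>)
    then interpret group_atlas L M n A X F g es B
      by unfold_locales (use cov(1) \<open>ok B\<close> in \<open>auto simp: B_def\<close>)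
    have "A \<subseteq> B \<and> small M B \<and> (elementary_substructure L M A \<longrightarrow> B = A)"
      using cov(2) okD[OF ok_B] by (auto simp: B_def)
    then show ?thesis using realization h_inv by blast
  qed
  then show ?thesis unfolding group_realization_def by blast
qed

end
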